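(* Let $\gamma \in W^{2,2}(\mathbb{S}^{1}; \mathbb{R}^{2})$ be an immersed curve with $$\mathcal{E}(\gamma)\mathcal{L}(\gamma)< c^*:= \mathcal{E}(\gamma^{\ast})\mathcal{L}(\gamma^{\ast}),$$ where $\gamma^*$ is the one-fold cover of the elastic figure eight. Then $\gamma$ is an embedding.
   Context: $\mathbb{S}^1=\mathbb{R}/\mathbb{Z}$; $W^{2,2}(\mathbb{S}^1;\mathbb{R}^2)$ is the Sobolev space of $1$-periodic curves (it embeds into $C^1(\mathbb{S}^1;\mathbb{R}^2)$). Immersed means $|\gamma'|>0$ everywhere. With signed curvature $\kappa=|\gamma'|^{-3}\det(\gamma',\gamma'')$ and $\mathrm{d}s=|\gamma'|\,\mathrm{d}x$, the elastic energy is $\mathcal{E}(\gamma)=\int|\kappa|^2\,\mathrm{d}s$ and the length is $\mathcal{L}(\gamma)=\int \mathrm{d}s$, the integrals being over the parameter domain of the curve. Elliptic functions: for $m\in[0,1)$, $F(x,m)=\int_0^x(1-m\sin^2\theta)^{-1/2}\,\mathrm{d}\theta$, $E(x,m)=\int_0^x(1-m\sin^2\theta)^{1/2}\,\mathrm{d}\theta$, $K(m)=F(\tfrac{\pi}{2},m)$, $E(m)=E(\tfrac{\pi}{2},m)$, $\mathrm{am}(\cdot,m)$ is the inverse function of $F(\cdot,m):\mathbb{R}\to\mathbb{R}$, and $\mathrm{cn}(s,m)=\cos(\mathrm{am}(s,m))$. Figure eight: let $m^*\in(0,1)$ be the unique root of $(0,1)\ni m\mapsto 2E(m)-K(m)$.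 The one-fold cover of the elastic figure eight is $$\gamma^*:[0,4K(m^* )]\to\mathbb{R}^2,\quad \gamma^*(s)=\begin{pmatrix}2E(\mathrm{am}(s,m^* ),m^* )-s\\ -2\sqrt{m^*}\,\mathrm{cn}(s,m^* )\end{pmatrix}.$$ *)

theory Defs
  imports "HOL-Analysis.Analysis"
begin

section \<open>Weak derivatives and the Sobolev space\<close>

definition test_function :: "real set \<Rightarrow> (real \<Rightarrow> real) \<Rightarrow> bool" where
  "test_function S \<phi> \<longleftrightarrow>
     (\<forall>n. (deriv ^^ n) \<phi> differentiable_on UNIV) \<and>
     compact (closure {x. \<phi> x \<noteq> 0}) \<and> closure {x. \<phi> x \<noteq> 0} \<subseteq> S"

definition locally_integrable :: "real set \<Rightarrow> (real \<Rightarrow> 'a::euclidean_space) \<Rightarrow> bool" where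
  "locally_integrable S u \<longleftrightarrow> (\<forall>C. compact C \<and> C \<subseteq> S \<longrightarrow> set_integrable lborel C u)"

definition is_weak_deriv ::
    "real set \<Rightarrow> (real \<Rightarrow> 'a::euclidean_space) \<Rightarrow> (real \<Rightarrow> 'a) \<Rightarrow> bool" where
  "is_weak_deriv S u v \<longleftrightarrow>
     locally_integrable S u \<and> locally_integrable S v \<and>
     (\<forall>\<phi>. test_function S \<phi> \<longrightarrow>
        (LINT x:S|lborel. deriv \<phi> x *\<^sub>R u x) = - (LINT x:S|lborel. \<phi> x *\<^sub>R v x))"

text \<open>For open \<open>S\<close> a weak derivative is unique up to null sets; an arbitrary representative is
  chosen, and it is only used under integrals.\<close>

definition weak_deriv ::
    "real set \<Rightarrow> (real \<Rightarrow> 'a::euclidean_space) \<Rightarrow> real \<Rightarrow> 'a" where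
  "weak_deriv S u = (SOME v. is_weak_deriv S u v)"

definition L2_on :: "real set \<Rightarrow> (real \<Rightarrow> 'a::euclidean_space) \<Rightarrow> bool" where
  "L2_on S u \<longleftrightarrow> set_borel_measurable lborel S u \<and> set_integrable lborel S (\<lambda>x. (norm (u x))\<^sup>2)"

text \<open>A map on \<open>\<real>/\<int>\<close> is a 1-periodic map on the real line, and its weak derivatives
  are taken on the whole line, which excludes jumps at the integers. They are themselves 1-periodic
  almost everywhere, so it is enough to ask for square integrability over one period.
  Continuity selects, in the almost-everywhere class, the representative given by the embedding
  into \<open>C\<^sup>1\<close>.\<close>

definition W22_circle :: "(real \<Rightarrow> real^2) set" where
  "W22_circle = {\<gamma>. (\<forall>x. \<gamma> (x + 1) = \<gamma> x) \<and> continuous_on UNIV \<gamma> \<and>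
     (\<exists>\<gamma>1 \<gamma>2. is_weak_deriv UNIV \<gamma> \<gamma>1 \<and> is_weak_deriv UNIV \<gamma>1 \<gamma>2 \<and>
        L2_on {0..1} \<gamma> \<and> L2_on {0..1} \<gamma>1 \<and> L2_on {0..1} \<gamma>2)}"


section \<open>Geometry of planar curves\<close>

abbreviation velocity :: "(real \<Rightarrow> real^2) \<Rightarrow> real \<Rightarrow> real^2" where
  "velocity \<gamma> x \<equiv> vector_derivative \<gamma> (at x)"

text \<open>Differentiability, automatic for \<open>W22_circle\<close>, is stated because
  \<^const>\<open>vector_derivative\<close> is unspecified where no derivative exists.\<close>

definition immersed :: "(real \<Rightarrow> real^2) \<Rightarrow> bool" where
  "immersed \<gamma> \<longleftrightarrow> (\<forall>x. \<gamma> differentiable (at x) \<and> norm (velocity \<gamma> x) > 0)"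

text \<open>The parameter domain is \<open>[a, b]\<close>; a closed curve on \<open>\<real>/\<int>\<close> is cut open to \<open>[0, 1]\<close>.
  The derivative \<open>\<gamma>'\<close> is classical and \<open>\<gamma>''\<close> is the weak derivative of \<open>\<gamma>'\<close>.\<close>

definition signed_curvature :: "real \<Rightarrow> real \<Rightarrow> (real \<Rightarrow> real^2) \<Rightarrow> real \<Rightarrow> real" where
  "signed_curvature a b \<gamma> x =
     det (vector [velocity \<gamma> x, weak_deriv {a<..<b} (velocity \<gamma>) x] :: real^2^2)
       / norm (velocity \<gamma> x) ^ 3"

definition elastic_energy :: "real \<Rightarrow> real \<Rightarrow> (real \<Rightarrow> real^2) \<Rightarrow> real" where
  "elastic_energy a b \<gamma> =
     (LINT x:{a<..<b}|lborel. \<bar>signed_curvature a b \<gamma> x\<bar>\<^sup>2 * norm (velocity \<gamma> x))"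

definition curve_length :: "real \<Rightarrow> real \<Rightarrow> (real \<Rightarrow> real^2) \<Rightarrow> real" where
  "curve_length a b \<gamma> = (LINT x:{a<..<b}|lborel. norm (velocity \<gamma> x))"

text \<open>An embedding is an immersion whose induced map on \<open>\<real>/\<int>\<close> is a homeomorphism onto its image.
  Here \<open>\<real>/\<int>\<close> is identified with the unit circle by \<open>x \<mapsto> exp (2 \<pi> i x)\<close>.\<close>

definition circle_embedding :: "(real \<Rightarrow> real^2) \<Rightarrow> bool" where
  "circle_embedding \<gamma> \<longleftrightarrow> immersed \<gamma> \<and>
     (\<exists>g. (\<forall>x. g (cis (2 * pi * x)) = \<gamma> x) \<and>
          embedding_map (top_of_set (sphere (0::complex) 1)) euclidean g)"


section \<open>Elliptic functions and the figure eight\<close>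

definition ellF :: "real \<Rightarrow> real \<Rightarrow> real" where
  "ellF x m = (LBINT \<theta>=0..x. 1 / sqrt (1 - m * (sin \<theta>)\<^sup>2))"

definition ellE :: "real \<Rightarrow> real \<Rightarrow> real" where
  "ellE x m = (LBINT \<theta>=0..x. sqrt (1 - m * (sin \<theta>)\<^sup>2))"

definition complete_K :: "real \<Rightarrow> real" where
  "complete_K m = ellF (pi / 2) m"

definition complete_E :: "real \<Rightarrow> real" where
  "complete_E m = ellE (pi / 2) m"

definition jacobi_am :: "real \<Rightarrow> real \<Rightarrow> real" where
  "jacobi_am s m = inv (\<lambda>x. ellF x m) s"

definition jacobi_cn :: "real \<Rightarrow> real \<Rightarrow> real" where
  "jacobi_cn s m = cos (jacobi_am s m)"

definition m_star :: real where
  "m_star = (THE m. 0 < m \<and> m < 1 \<and> 2 * complete_E m - complete_K m = 0)"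

definition figure_eight :: "real \<Rightarrow> real^2" where
  "figure_eight s =
     vector [2 * ellE (jacobi_am s m_star) m_star - s, - 2 * sqrt m_star * jacobi_cn s m_star]"

definition c_star :: real where
  "c_star = elastic_energy 0 (4 * complete_K m_star) figure_eight
          * curve_length 0 (4 * complete_K m_star) figure_eight"

end

theory Submission
  imports Defs
begin

text \<open>
  A closed curve that is not an embedding has a double point \<open>\<gamma> x\<^sub>0 = \<gamma> x\<^sub>1\<close>. It cuts the curve into two
  loops, each of which returns to its starting point, possibly with a corner there. Write
  \<open>K\<close> for the complete integral \<open>K(m\<^sup>*)\<close> and \<open>C = 8 K\<^sup>2 (2 m\<^sup>* - 1)\<close>. Every loop satisfies
  \<open>E L \<ge> C\<close> (\<open>loop_energy_ge\<close>), and the two loops of the figure eight are congruent and attain this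
  bound, so that \<open>c\<^sup>* = 4 C\<close> (\<open>c_star_eq\<close>). The arithmetic-geometric mean inequality then gives
  \<open>(E\<^sub>1 + E\<^sub>2) (L\<^sub>1 + L\<^sub>2) \<ge> 4 C\<close> for the two loops together (\<open>self_intersection_energy_ge\<close>).

  The bound for one loop is a calibration argument.
  Write \<open>\<gamma>' = \<rho> e\<^sup>i\<^sup>\<theta>\<close>. The energy is \<open>\<integral> \<theta>'\<^sup>2 / \<rho>\<close>, and since the loop closes up,
  \<open>\<integral> \<rho> cos (\<theta> - c) = 0\<close> for every \<open>c\<close>. Take for \<open>c\<close> the midpoint of the range of \<open>\<theta>\<close>, so that
  \<open>\<phi> = \<theta> - c\<close> ranges over some interval \<open>[-b, b]\<close>, and put \<open>m = sin\<^sup>2 (min b \<pi> / 2)\<close>. Then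
  \<open>g(\<phi>)\<^sup>2 = 4 m - 2 + 2 cos \<phi>\<close> is nonnegative along the loop, and completing the square gives
  \<open>\<theta>'\<^sup>2 / \<rho> \<ge> 2 s g(\<phi>) \<bar>\<theta>'\<bar> - s\<^sup>2 g(\<phi>)\<^sup>2 \<rho>\<close> for every \<open>s\<close>. The last term integrates to
  \<open>s\<^sup>2 (4 m - 2) L\<close> by the closing condition, and \<open>\<integral> g(\<phi>) \<bar>\<theta>'\<bar>\<close> is at least the integral \<open>A(m)\<close> of \<open>g\<close>
  over \<open>[- min b \<pi>, min b \<pi>]\<close>, because \<open>\<phi>\<close> passes through all these angles. With \<open>s = 2 K / L\<close> this reads
  \<open>E L \<ge> 4 K A(m) - 4 K\<^sup>2 (4 m - 2)\<close>.

  It remains to see that the right-hand side is at least \<open>C\<close> for every \<open>m\<close>. The function \<open>A\<close> is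
  convex, and its tangent at \<open>m\<^sup>*\<close> is \<open>m \<mapsto> 4 K (m + m\<^sup>* - 1)\<close>: the slope is \<open>4 K\<close>, and the equation
  \<open>2 E(m\<^sup>*) = K(m\<^sup>*)\<close> gives the value at \<open>m\<^sup>*\<close> (\<open>loop_momentum_integral_ge\<close>). Inserting the tangent,
  the terms in \<open>m\<close> cancel and \<open>C\<close> is left.

  The velocity of a \<open>W\<^sup>2\<^sup>,\<^sup>2\<close> curve is only absolutely continuous. The relation \<open>primitive_on\<close> replaces
  the derivative, with rules for products, logarithms and compositions. The link to weak
  derivatives is the fundamental lemma of the calculus of variations and its du Bois-Reymond form,
  for which smooth bump functions are constructed from \<open>exp (- 1 / x)\<close>.
\<close>

section \<open>Smooth bump functions\<close>

text \<open>Smoothness of products is an induction on the number of derivatives. The recursion peels off the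
  innermost derivative, so that the induction hypothesis applies to \<open>deriv f\<close>.\<close>
primrec times_differentiable :: "nat \<Rightarrow> (real \<Rightarrow> real) \<Rightarrow> bool" where
  "times_differentiable 0 f \<longleftrightarrow> True"
| "times_differentiable (Suc n) f \<longleftrightarrow> f differentiable_on UNIV \<and> times_differentiable n (deriv f)"

lemma times_differentiable_iff:
  "times_differentiable n f \<longleftrightarrow> (\<forall>k<n. (deriv ^^ k) f differentiable_on UNIV)"
proof (induction n arbitrary: f)
  case (Suc n)
  show ?case
    by (auto simp: Suc.IH All_less_Suc2 funpow_Suc_right simp del: funpow.simps)
qed auto

lemma smooth_iff_times_differentiable:
  "(\<forall>n. (deriv ^^ n) f differentiable_on UNIV) \<longleftrightarrow> (\<forall>n. times_differentiable n f)"
  by (auto simp: times_differentiable_iff)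

lemma times_differentiable_SucD: "times_differentiable (Suc n) f \<Longrightarrow> times_differentiable n f"
  by (simp add: times_differentiable_iff)

lemma times_differentiableI:
  assumes "\<And>x. (f has_real_derivative f' x) (at x)" "times_differentiable n f'"
  shows "times_differentiable (Suc n) f"
proof -
  have "deriv f = f'" using assms(1) by (intro ext DERIV_imp_deriv) auto
  thus ?thesis using assms
    by (auto simp: differentiable_on_def real_differentiable_def)
qed

lemma times_differentiable_SucE:
  assumes "times_differentiable (Suc n) f"
  shows "\<And>x. (f has_real_derivative deriv f x) (at x)" "times_differentiable n (deriv f)"
  using assms by (auto simp: differentiable_on_def DERIV_deriv_iff_real_differentiable)

lemma times_differentiable_add:
  "times_differentiable n f \<Longrightarrow> times_differentiable n g \<Longrightarrow> times_differentiable n (\<lambda>x. f x + g x)"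
proof (induction n arbitrary: f g)
  case (Suc n)
  show ?case
    by (rule times_differentiableI[of _ "\<lambda>x. deriv f x + deriv g x"])
       (use Suc in \<open>auto intro!: derivative_eq_intros times_differentiable_SucE(1) simp del: times_differentiable.simps(2) dest: times_differentiable_SucE(2)\<close>)
qed auto

lemma times_differentiable_mult:
  "times_differentiable n f \<Longrightarrow> times_differentiable n g \<Longrightarrow> times_differentiable n (\<lambda>x. f x * g x)"
proof (induction n arbitrary: f g)
  case (Suc n)
  have "times_differentiable n (\<lambda>x. deriv f x * g x + f x * deriv g x)"
    by (intro times_differentiable_add Suc.IH)
       (use Suc.prems in \<open>auto dest: times_differentiable_SucE(2) times_differentiable_SucD simp del: times_differentiable.simps(2)\<close>)
  thus ?case
    by (intro times_differentiableI[of _ "\<lambda>x. deriv f x * g x + f x * deriv g x"])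
       (auto intro!: derivative_eq_intros times_differentiable_SucE(1)[OF Suc.prems(1)] times_differentiable_SucE(1)[OF Suc.prems(2)])
qed auto

lemma times_differentiable_const: "times_differentiable n (\<lambda>x. c)"
proof (induction n arbitrary: c)
  case (Suc n)
  show ?case by (rule times_differentiableI[of _ "\<lambda>x. 0"]) (use Suc in auto)
qed auto

lemma times_differentiable_affine:
  "times_differentiable n f \<Longrightarrow> times_differentiable n (\<lambda>x. f (a * x + b))"
proof (induction n arbitrary: f)
  case (Suc n)
  have "times_differentiable n (\<lambda>x. a * deriv f (a * x + b))"
    by (intro times_differentiable_mult times_differentiable_const Suc.IH)
       (use Suc.prems in auto)
  moreover have "((\<lambda>x. f (a * x + b)) has_real_derivative a * deriv f (a * x + b)) (at x)" for x
  proof -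
    have "((\<lambda>x. a * x + b) has_real_derivative a) (at x)" by (auto intro!: derivative_eq_intros)
    from DERIV_chain2[OF times_differentiable_SucE(1)[OF Suc.prems] this] show ?thesis
      by (simp add: mult.commute)
  qed
  ultimately show ?case by (intro times_differentiableI)
qed auto

text \<open>The functions \<open>p (1 / x) exp (- 1 / x)\<close>, with \<open>p\<close> ranging over all polynomials, form a class that is
  closed under differentiation, which makes each of them smooth, also across the origin.\<close>
definition flat :: "real poly \<Rightarrow> real \<Rightarrow> real" where
  "flat p x = (if x > 0 then poly p (1 / x) * exp (- (1 / x)) else 0)"

text \<open>With \<open>y = 1 / x\<close> this is the decay of \<open>p y / exp y\<close> at infinity.\<close>
lemma flat_tendsto_0: "(flat p \<longlongrightarrow> 0) (at_right 0)"
proof -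
  have "((\<lambda>y. \<Sum>i\<le>degree p. coeff p i * (y ^ i / exp y)) \<longlongrightarrow> (\<Sum>i\<le>degree p. coeff p i * 0)) at_top"
    by (intro tendsto_intros tendsto_power_div_exp_0)
  hence "((\<lambda>y::real. poly p y * exp (- y)) \<longlongrightarrow> 0) at_top"
    by (simp add: poly_altdef sum_distrib_right exp_minus divide_inverse mult.assoc)
  hence "((\<lambda>x::real. poly p (inverse x) * exp (- inverse x)) \<longlongrightarrow> 0) (at_right 0)"
    by (rule filterlim_compose) (rule filterlim_inverse_at_top_right)
  thus ?thesis
    by (rule Lim_transform_eventually) (auto simp: eventually_at_filter flat_def inverse_eq_divide)
qed

lemma flat_has_derivative:
  "(flat p has_real_derivative flat ([:0, 0, 1:] * (p - pderiv p)) x) (at x)"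
proof -
  consider "x > 0" | "x < 0" | "x = 0" by linarith
  thus ?thesis
  proof cases
    case 1
    have "((\<lambda>x. poly p (1 / x) * exp (- (1 / x))) has_real_derivative
        flat ([:0, 0, 1:] * (p - pderiv p)) x) (at x)"
      using 1
      by (auto intro!: derivative_eq_intros DERIV_chain2[OF poly_DERIV] simp: flat_def field_simps power2_eq_square)
    thus ?thesis
      by (rule has_field_derivative_transform_within_open[of _ _ _ "{0<..}"]) (use 1 in \<open>auto simp: flat_def\<close>)
  next
    case 2
    have "((\<lambda>x. 0) has_real_derivative flat ([:0, 0, 1:] * (p - pderiv p)) x) (at x)"
      using 2 by (auto simp: flat_def)
    thus ?thesis
      by (rule has_field_derivative_transform_within_open[of _ _ _ "{..<0}"]) (use 2 in \<open>auto simp: flat_def\<close>)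
  next
    case 3
    \<comment> \<open>The difference quotient at 0 is the flat function of the polynomial \<open>X p\<close>.\<close>
    have "((\<lambda>h. (flat p (0 + h) - flat p 0) / h) \<longlongrightarrow> 0) (at_right 0)"
      by (rule Lim_transform_eventually[OF flat_tendsto_0[of "[:0, 1:] * p"]])
         (auto simp: eventually_at_filter flat_def)
    moreover have "((\<lambda>h. (flat p (0 + h) - flat p 0) / h) \<longlongrightarrow> 0) (at_left 0)"
      by (rule Lim_transform_eventually[OF tendsto_const])
         (auto simp: eventually_at_filter flat_def)
    ultimately have "((\<lambda>h. (flat p (0 + h) - flat p 0) / h) \<longlongrightarrow> 0) (at 0)"
      by (simp add: filterlim_split_at)
    thus ?thesis using 3 by (simp add: DERIV_def flat_def)
  qed
qed

lemma times_differentiable_flat: "times_differentiable n (flat p)"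
proof (induction n arbitrary: p)
  case (Suc n)
  show ?case by (rule times_differentiableI[OF flat_has_derivative Suc.IH])
qed auto

text \<open>Scaling by \<open>n\<close> drives the bump to the indicator of the interval while its support stays in \<open>[c, d]\<close>.\<close>
definition bump :: "nat \<Rightarrow> real \<Rightarrow> real \<Rightarrow> real \<Rightarrow> real" where
  "bump n c d x = flat 1 (real n * (x - c)) * flat 1 (real n * (d - x))"

lemma times_differentiable_bump: "times_differentiable k (bump n c d)"
  using times_differentiable_mult[OF times_differentiable_affine[OF times_differentiable_flat, of _ _ "real n" "- (real n * c)"]
      times_differentiable_affine[OF times_differentiable_flat, of _ _ "- real n" "real n * d"]]
  unfolding bump_def by (simp add: algebra_simps)

lemma flat_1_bounds: "0 \<le> flat 1 x" "flat 1 x \<le> 1"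
  by (auto simp: flat_def)

lemma bump_bounds: "0 \<le> bump n c d x" "bump n c d x \<le> 1"
  by (auto simp: bump_def flat_1_bounds intro!: mult_le_one)

lemma bump_eq_0: "x \<notin> {c<..<d} \<Longrightarrow> bump n c d x = 0"
  by (auto simp: bump_def flat_def zero_less_mult_iff)

lemma bump_pos: "n > 0 \<Longrightarrow> x \<in> {c<..<d} \<Longrightarrow> bump n c d x > 0"
  by (auto simp: bump_def flat_def)

lemma bump_tendsto: "(\<lambda>n. bump n c d x) \<longlonglongrightarrow> indicat_real {c<..<d} x"
proof (cases "x \<in> {c<..<d}")
  case True
  have *: "(\<lambda>n. flat 1 (real n * y)) \<longlonglongrightarrow> 1" if "y > 0" for y
  proof -
    have "(\<lambda>n. exp (- (inverse y * (1 / real n)))) \<longlonglongrightarrow> exp (- (inverse y * 0))"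
      by (intro tendsto_intros lim_1_over_n)
    hence "(\<lambda>n. exp (- (1 / (real n * y)))) \<longlonglongrightarrow> 1"
      by (simp add: field_simps)
    thus ?thesis
      by (rule Lim_transform_eventually)
         (use that in \<open>auto intro!: eventually_mono[OF eventually_gt_at_top[of 0]] simp: flat_def\<close>)
  qed
  have "(\<lambda>n. bump n c d x) \<longlonglongrightarrow> 1 * 1"
    unfolding bump_def by (intro tendsto_mult *) (use True in auto)
  thus ?thesis using True by simp
next
  case False
  thus ?thesis by (simp add: bump_eq_0)
qed

lemma test_functionI:
  assumes "\<And>n. times_differentiable n \<phi>" "\<And>x. x \<notin> {c..d} \<Longrightarrow> \<phi> x = 0" "{c..d} \<subseteq> S"
  shows "test_function S \<phi>"
proof -
  have "{x. \<phi> x \<noteq> 0} \<subseteq> {c..d}" using assms(2) by blast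
  hence *: "closure {x. \<phi> x \<noteq> 0} \<subseteq> {c..d}" by (simp add: closure_minimal)
  moreover have "compact (closure {x. \<phi> x \<noteq> 0})"
    unfolding compact_closure by (rule bounded_subset[of "{c..d}"])
       (use \<open>{x. \<phi> x \<noteq> 0} \<subseteq> {c..d}\<close> in auto)
  ultimately show ?thesis
    unfolding test_function_def using assms by (auto simp: smooth_iff_times_differentiable)
qed

lemma test_functionE:
  assumes "test_function S \<phi>"
  obtains c d where "c < d" "\<And>x. x \<notin> {c..d} \<Longrightarrow> \<phi> x = 0" "\<And>x. x \<notin> {c..d} \<Longrightarrow> deriv \<phi> x = 0"
    "\<And>x. x \<notin> S \<Longrightarrow> \<phi> x = 0" "\<And>x. x \<notin> S \<Longrightarrow> deriv \<phi> x = 0"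
    "\<And>x. (\<phi> has_real_derivative deriv \<phi> x) (at x)" "continuous_on UNIV (deriv \<phi>)" 
    "continuous_on UNIV \<phi>"
proof -
  define K where "K = closure {x. \<phi> x \<noteq> 0}"
  have K: "compact K" "K \<subseteq> S" "closed K" using assms by (auto simp: test_function_def K_def)
  have 0: "\<phi> x = 0" if "x \<notin> K" for x
    using that closure_subset[of "{x. \<phi> x \<noteq> 0}"] by (auto simp: K_def)
  have D: "deriv \<phi> x = 0" if "x \<notin> K" for x
  proof (rule DERIV_imp_deriv)
    have "((\<lambda>x. 0) has_real_derivative 0) (at x)" by simp
    thus "(\<phi> has_real_derivative 0) (at x)"
      by (rule has_field_derivative_transform_within_open[of _ _ _ "- K"]) (use that 0 K in auto)
  qed
  obtain r where r: "\<forall>x\<in>K. norm x \<le> r" using K compact_imp_bounded bounded_iff by blast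
  have KS: "K \<subseteq> {-\<bar>r\<bar> - 1..\<bar>r\<bar> + 1}" using r by (force simp: abs_le_iff)
  have KS': "\<phi> x = 0" "deriv \<phi> x = 0" if "x \<notin> {-\<bar>r\<bar> - 1..\<bar>r\<bar> + 1}" for x
    using 0[of x] D[of x] KS that by blast+
  have KS'': "\<phi> x = 0" "deriv \<phi> x = 0" if "x \<notin> S" for x
    using 0[of x] D[of x] K that by blast+
  have s: "(\<forall>n. times_differentiable n \<phi>)" using assms by (simp add: test_function_def smooth_iff_times_differentiable)
  hence d: "(\<phi> has_real_derivative deriv \<phi> x) (at x)" for x using times_differentiable_SucE(1) by blast
  have "deriv \<phi> differentiable_on UNIV" using s[rule_format, of 2] by (simp add: numeral_2_eq_2)
  hence c: "continuous_on UNIV (deriv \<phi>)" by (rule differentiable_imp_continuous_on)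
  have c': "continuous_on UNIV \<phi>" using d by (meson DERIV_continuous_on continuous_on_subset DERIV_subset top_greatest)
  show ?thesis
    by (rule that[of "-\<bar>r\<bar> - 1" "\<bar>r\<bar> + 1"]) (use KS' KS'' d c c' in auto)
qed

lemma test_function_bump: "{c..d} \<subseteq> S \<Longrightarrow> test_function S (bump n c d)"
  by (rule test_functionI[of _ c d]) (auto simp: times_differentiable_bump bump_eq_0)

section \<open>Absolutely continuous functions\<close>

lemma interval_integral_add:
  fixes v :: "real \<Rightarrow> 'a::euclidean_space"
  assumes "a \<le> b" "b \<le> c" "set_integrable lborel {a..c} v"
  shows "(LINT t:{a..c}|lborel. v t) = (LINT t:{a..b}|lborel. v t) + (LINT t:{b..c}|lborel. v t)"
proof -
  have "set_integrable lborel {a..b} v" "set_integrable lborel {b..c} v"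
    by (rule set_integrable_subset[OF assms(3)]; use assms in auto)+
  thus ?thesis using assms
    by (simp add: set_borel_integral_eq_integral Henstock_Kurzweil_Integration.integral_combine)
qed

text \<open>The continuous factor is bounded on the compact interval. The general product covers scalar
  multiples of vectors and the product of complex numbers.\<close>
lemma set_integrable_bilinear:
  fixes D :: "real \<Rightarrow> 'a::euclidean_space" and v :: "real \<Rightarrow> 'b::euclidean_space"
    and prod :: "'a \<Rightarrow> 'b \<Rightarrow> 'c::euclidean_space"
  assumes "bounded_bilinear prod" "continuous_on {a..b} D" "set_integrable lborel {a..b} v"
  shows "set_integrable lborel {a..b} (\<lambda>t. prod (D t) (v t))"
proof -
  interpret bounded_bilinear prod by fact
  obtain K where K: "0 \<le> K" "\<And>x y. norm (prod x y) \<le> norm x * norm y * K" using nonneg_bounded by blast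
  have "compact (D ` {a..b})" using assms(2) by (intro compact_continuous_image) auto
  then obtain B where B: "\<And>t. t \<in> {a..b} \<Longrightarrow> norm (D t) \<le> B" "0 \<le> B"
    by (metis bounded_pos compact_imp_bounded image_eqI less_imp_le)
  have m: "(\<lambda>t. indicator {a..b} t *\<^sub>R D t) \<in> borel_measurable lborel"
    using borel_measurable_continuous_on_indicator[OF _ assms(2)] by simp
  have i: "integrable lborel (\<lambda>t. indicator {a..b} t *\<^sub>R v t)" using assms(3) by (simp add: set_integrable_def)
  have m2: "(\<lambda>t. prod (indicator {a..b} t *\<^sub>R D t) (indicator {a..b} t *\<^sub>R v t)) \<in> borel_measurable lborel"
    by (rule borel_measurable_continuous_Pair[OF m]) 
       (use i in \<open>auto intro!: continuous_on continuous_intros\<close>)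
  have e: "(\<lambda>t. prod (indicator {a..b} t *\<^sub>R D t) (indicator {a..b} t *\<^sub>R v t)) = 
     (\<lambda>t. indicator {a..b} t *\<^sub>R prod (D t) (v t))"
    by (auto simp: indicator_def zero_left)
  have i': "integrable lborel (\<lambda>t. (B * K) *\<^sub>R (indicator {a..b} t *\<^sub>R v t))" using i by (rule integrable_scaleR_right)
  show ?thesis
    unfolding set_integrable_def
  proof (rule Bochner_Integration.integrable_bound[OF i'])
    show "(\<lambda>t. indicator {a..b} t *\<^sub>R prod (D t) (v t)) \<in> borel_measurable lborel" using m2 by (simp only: e)
    show "AE x in lborel. norm (indicat_real {a..b} x *\<^sub>R prod (D x) (v x))
         \<le> norm ((B * K) *\<^sub>R indicat_real {a..b} x *\<^sub>R v x)"
    proof (rule AE_I2)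
      fix x
      show "norm (indicat_real {a..b} x *\<^sub>R prod (D x) (v x)) \<le> norm ((B * K) *\<^sub>R indicat_real {a..b} x *\<^sub>R v x)"
      proof (cases "x \<in> {a..b}")
        case True
        have "norm (prod (D x) (v x)) \<le> norm (D x) * norm (v x) * K" by (rule K)
        also have "\<dots> \<le> B * norm (v x) * K"
          using B(1)[OF True] B(2) K by (intro mult_right_mono) auto
        finally show ?thesis using True B K by (simp add: mult_ac)
      qed auto
    qed
  qed
qed

text \<open>Summing the increments over a fine subdivision gives \<open>norm (R b - R a) \<le> e * (N b - N a)\<close> for every
  \<open>e\<close>. All calculus rules below for absolutely continuous functions rest on this.\<close>
lemma eq_if_small_increments:
  fixes R :: "real \<Rightarrow> 'a::real_normed_vector" and N :: "real \<Rightarrow> real"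
  assumes "a \<le> b"
    and small: "\<And>e. e > 0 \<Longrightarrow> \<exists>d>0. \<forall>p q. a \<le> p \<longrightarrow> p \<le> q \<longrightarrow> q \<le> b \<longrightarrow> q - p < d
                   \<longrightarrow> norm (R q - R p) \<le> e * (N q - N p)"
  shows "R b = R a"
proof -
  have bound: "norm (R b - R a) \<le> e * (N b - N a)" if "e > 0" for e
  proof -
    obtain d where d: "d > 0" and small: "\<And>p q. a \<le> p \<Longrightarrow> p \<le> q \<Longrightarrow> q \<le> b \<Longrightarrow> q - p < d
                   \<Longrightarrow> norm (R q - R p) \<le> e * (N q - N p)"
      using small[OF \<open>e > 0\<close>] by blast
    obtain n :: nat where n: "(b - a) / d < real n" using reals_Archimedean2 by blast
    hence n0: "n > 0" using d assms(1) by (metis divide_nonneg_pos gr0I diff_ge_0_iff_ge not_le of_nat_0)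
    define p where "p i = a + real i * ((b - a) / real n)" for i
    have eq: "p (Suc i) - p i = (b - a) / real n" for i
      by (simp add: p_def distrib_right add_divide_distrib)
    have "b - a < d * real n" using n d by (simp add: divide_less_eq mult.commute)
    hence step: "p (Suc i) - p i < d" "p (Suc i) - p i \<ge> 0" for i
      using n0 assms(1) unfolding eq by (simp_all add: divide_less_eq)
    have range: "a \<le> p i" "i \<le> n \<Longrightarrow> p i \<le> b" for i
    proof -
      show "a \<le> p i" using n0 assms(1) by (simp add: p_def)
      assume "i \<le> n"
      hence "real i * (b - a) \<le> real n * (b - a)" using assms(1) by (intro mult_right_mono) auto
      thus "p i \<le> b" using n0 by (simp add: p_def field_simps)
    qed
    have "norm (R (p k) - R (p 0)) \<le> e * (N (p k) - N (p 0))" if "k \<le> n" for k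
      using that
    proof (induction k)
      case (Suc k)
      have "norm (R (p (Suc k)) - R (p 0)) \<le> norm (R (p (Suc k)) - R (p k)) + norm (R (p k) - R (p 0))"
        by (metis add_diff_cancel_left' diff_add_cancel diff_diff_eq2 norm_triangle_ineq)
      also have "\<dots> \<le> e * (N (p (Suc k)) - N (p k)) + e * (N (p k) - N (p 0))"
        using Suc.prems step[of k] range[of k] range[of "Suc k"] by (intro add_mono Suc.IH small) auto
      finally show ?case by (simp add: algebra_simps)
    qed auto
    from this[of n] show ?thesis using n0 by (simp add: p_def)
  qed
  have "norm (R b - R a) \<le> 0"
  proof (rule ccontr)
    assume "\<not> ?thesis"
    hence pos: "norm (R b - R a) > 0" by simp
    define C where "C = \<bar>N b - N a\<bar> + 1"
    have C: "C > 0" "N b - N a \<le> C" by (auto simp: C_def)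
    have "norm (R b - R a) \<le> norm (R b - R a) / (2 * C) * (N b - N a)"
      using pos C by (intro bound) auto
    also have "\<dots> \<le> norm (R b - R a) / (2 * C) * C"
      using C pos by (intro mult_left_mono) auto
    also have "\<dots> = norm (R b - R a) / 2" using C by simp
    finally show False using pos by simp
  qed
  thus ?thesis by simp
qed

text \<open>Absolute continuity of \<open>f\<close> on \<open>[a, b]\<close> with almost everywhere derivative \<open>v\<close>, in integrated form.\<close>
definition primitive_on :: "real \<Rightarrow> real \<Rightarrow> (real \<Rightarrow> 'a::euclidean_space) \<Rightarrow> (real \<Rightarrow> 'a) \<Rightarrow> bool" where
  "primitive_on a b f v \<longleftrightarrow> set_integrable lborel {a..b} v \<and>
     (\<forall>p q. a \<le> p \<longrightarrow> p \<le> q \<longrightarrow> q \<le> b \<longrightarrow> f q - f p = (LINT t:{p..q}|lborel. v t))"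

lemma primitive_onD:
  assumes "primitive_on a b f v" "a \<le> p" "p \<le> q" "q \<le> b"
  shows "f q - f p = (LINT t:{p..q}|lborel. v t)" "set_integrable lborel {p..q} v"
  using assms set_integrable_subset[of lborel "{a..b}" v "{p..q}"] by (auto simp: primitive_on_def)

lemma primitive_on_C1:
  fixes f :: "real \<Rightarrow> 'a::euclidean_space"
  assumes "\<And>x. x \<in> {a..b} \<Longrightarrow> (f has_vector_derivative v x) (at x within {a..b})" "continuous_on {a..b} v"
  shows "primitive_on a b f v"
  unfolding primitive_on_def
proof (intro conjI allI impI)
  show "set_integrable lborel {a..b} v" by (rule borel_integrable_atLeastAtMost'[OF assms(2)])
  fix p q assume pq: "a \<le> p" "p \<le> q" "q \<le> b"
  have "set_integrable lborel {p..q} v"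
    using pq continuous_on_subset[OF assms(2)] by (intro borel_integrable_atLeastAtMost') auto
  moreover have "(v has_integral (f q - f p)) {p..q}"
    using pq assms(1) by (intro fundamental_theorem_of_calculus) 
       (auto intro!: has_vector_derivative_within_subset[of f _ _ "{a..b}" "{p..q}"])
  ultimately show "f q - f p = (LINT t:{p..q}|lborel. v t)"
    by (simp add: set_borel_integral_eq_integral integral_unique)
qed

lemma primitive_on_continuous:
  assumes "primitive_on a b f v"
  shows "continuous_on {a..b} f"
proof (cases "a \<le> b")
  case True
  have "continuous_on {a..b} (\<lambda>x. f a + integral {a..x} v)"
    using assms set_borel_integral_eq_integral(1)[of "{a..b}" v]
    by (intro continuous_intros indefinite_integral_continuous_1) (auto simp: primitive_on_def)
  moreover have "f a + integral {a..x} v = f x" if "x \<in> {a..b}" for x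
    using primitive_onD[OF assms, of a x] that set_borel_integral_eq_integral(2)[of "{a..x}" v]
    by (auto simp: algebra_simps)
  ultimately show ?thesis using continuous_on_cong by (metis (no_types, lifting))
qed auto

lemma norm_set_integral_le:
  fixes v :: "real \<Rightarrow> 'a::euclidean_space"
  assumes "set_integrable lborel A v"
  shows "norm (LINT t:A|lborel. v t) \<le> (LINT t:A|lborel. norm (v t))"
  using integral_norm_bound[of lborel "\<lambda>t. indicator A t *\<^sub>R v t"] 
  by (simp add: set_lebesgue_integral_def)

lemma primitive_on_indefinite:
  fixes v :: "real \<Rightarrow> 'a::euclidean_space"
  assumes "set_integrable lborel {a..b} v"
  shows "primitive_on a b (\<lambda>x. LINT t:{a..x}|lborel. v t) v"
  unfolding primitive_on_def
proof (intro conjI allI impI assms)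
  fix p q assume pq: "a \<le> p" "p \<le> q" "q \<le> b"
  have "set_integrable lborel {a..q} v" by (rule set_integrable_subset[OF assms]) (use pq in auto)
  from interval_integral_add[OF pq(1,2) this]
  show "(LINT t:{a..q}|lborel. v t) - (LINT t:{a..p}|lborel. v t) = (LINT t:{p..q}|lborel. v t)" by simp
qed

lemma set_integrable_norm':
  fixes v :: "real \<Rightarrow> 'a::euclidean_space"
  shows "set_integrable lborel A v \<Longrightarrow> set_integrable lborel A (\<lambda>t. norm (v t))"
  unfolding set_integrable_def by (drule integrable_norm) simp

lemma continuous_on_Icc_uniformD:
  fixes f :: "real \<Rightarrow> 'a::real_normed_vector"
  assumes "continuous_on {a..b} f" "e > 0"
  obtains d where "d > 0" "\<And>p t. p \<in> {a..b} \<Longrightarrow> t \<in> {a..b} \<Longrightarrow> \<bar>t - p\<bar> < d \<Longrightarrow> norm (f t - f p) < e"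
proof -
  have "uniformly_continuous_on {a..b} f" using assms(1) by (intro compact_uniformly_continuous) auto
  then obtain d where "d > 0" "\<forall>p\<in>{a..b}. \<forall>t\<in>{a..b}. dist t p < d \<longrightarrow> dist (f t) (f p) < e"
    unfolding uniformly_continuous_on_def using assms(2) by blast
  thus ?thesis by (intro that[of d]) (auto simp: dist_norm)
qed

text \<open>The criterion by which the rules below are proved: \<open>h\<close> is a primitive of \<open>w\<close> as soon as the error
  over short intervals is small compared with the integral of a fixed function \<open>g\<close>.\<close>
lemma primitive_on_if_small_increments:
  fixes h w :: "real \<Rightarrow> 'a::euclidean_space" and g :: "real \<Rightarrow> real"
  assumes w: "set_integrable lborel {a..b} w" and g: "set_integrable lborel {a..b} g"
    and small: "\<And>e. e > 0 \<Longrightarrow> \<exists>d>0. \<forall>p q. a \<le> p \<longrightarrow> p \<le> q \<longrightarrow> q \<le> b \<longrightarrow> q - p < d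
                   \<longrightarrow> norm (h q - h p - (LINT t:{p..q}|lborel. w t)) \<le> e * (LINT t:{p..q}|lborel. g t)"
  shows "primitive_on a b h w"
  unfolding primitive_on_def
proof (intro conjI allI impI w)
  fix r s assume rs: "a \<le> r" "r \<le> s" "s \<le> b"
  let ?R = "\<lambda>x. h x - (LINT t:{a..x}|lborel. w t)"
  let ?N = "\<lambda>x. (LINT t:{a..x}|lborel. g t)"
  have "?R s = ?R r"
  proof (rule eq_if_small_increments[OF rs(2), of _ ?N])
    fix e :: real assume "e > 0"
    from small[OF this] obtain d where d: "d > 0" "\<And>p q. a \<le> p \<Longrightarrow> p \<le> q \<Longrightarrow> q \<le> b \<Longrightarrow> q - p < d
                   \<Longrightarrow> norm (h q - h p - (LINT t:{p..q}|lborel. w t)) \<le> e * (LINT t:{p..q}|lborel. g t)"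
      by blast
    show "\<exists>d>0. \<forall>p q. r \<le> p \<longrightarrow> p \<le> q \<longrightarrow> q \<le> s \<longrightarrow> q - p < d \<longrightarrow> norm (?R q - ?R p) \<le> e * (?N q - ?N p)"
    proof (intro exI[of _ d] conjI allI impI d(1))
      fix p q assume pq: "r \<le> p" "p \<le> q" "q \<le> s" "q - p < d"
      have "(LINT t:{p..q}|lborel. w t) = (LINT t:{a..q}|lborel. w t) - (LINT t:{a..p}|lborel. w t)"
           "(LINT t:{p..q}|lborel. g t) = ?N q - ?N p"
        using primitive_onD(1)[OF primitive_on_indefinite[OF w], of p q]
          primitive_onD(1)[OF primitive_on_indefinite[OF g], of p q] pq rs by auto
      moreover have "norm (h q - h p - (LINT t:{p..q}|lborel. w t)) \<le> e * (LINT t:{p..q}|lborel. g t)"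
        using pq rs by (intro d) auto
      moreover have "?R q - ?R p = h q - h p - ((LINT t:{a..q}|lborel. w t) - (LINT t:{a..p}|lborel. w t))" by simp
      ultimately show "norm (?R q - ?R p) \<le> e * (?N q - ?N p)" by metis
    qed
  qed
  thus "h s - h r = (LINT t:{r..s}|lborel. w t)"
    using primitive_onD(1)[OF primitive_on_indefinite[OF w], of r s] rs by (simp add: algebra_simps)
qed

text \<open>A chain rule in which \<open>h\<close> need not be a function of \<open>f\<close>. It is enough that the increments of \<open>h\<close>
  are to first order \<open>D\<close> times those of \<open>f\<close>. This covers composition with a \<open>C\<^sup>1\<close> function as well as
  a continuous branch of the logarithm, which is only locally a function of its argument.\<close>
lemma primitive_on_chain:
  fixes f v :: "real \<Rightarrow> 'a::euclidean_space" and D :: "real \<Rightarrow> 'b::euclidean_space"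
    and h :: "real \<Rightarrow> 'c::euclidean_space" and prod :: "'b \<Rightarrow> 'a \<Rightarrow> 'c"
  assumes prod: "bounded_bilinear prod" and f: "primitive_on a b f v" and D: "continuous_on {a..b} D"
    and diff: "\<And>e. e > 0 \<Longrightarrow> \<exists>d>0. \<forall>p q. a \<le> p \<longrightarrow> p \<le> q \<longrightarrow> q \<le> b \<longrightarrow> q - p < d
                   \<longrightarrow> norm (h q - h p - prod (D p) (f q - f p)) \<le> e * norm (f q - f p)"
  shows "primitive_on a b h (\<lambda>t. prod (D t) (v t))"
proof -
  interpret bounded_bilinear prod by fact
  obtain K where K: "0 < K" "\<And>x y. norm (prod x y) \<le> norm x * norm y * K" using pos_bounded by blast
  have v: "set_integrable lborel {a..b} v" using f by (simp add: primitive_on_def)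
  show ?thesis
  proof (rule primitive_on_if_small_increments[where g = "\<lambda>t. norm (v t)"])
    show "set_integrable lborel {a..b} (\<lambda>t. prod (D t) (v t))"
      by (rule set_integrable_bilinear[OF prod D v])
    show "set_integrable lborel {a..b} (\<lambda>t. norm (v t))" by (rule set_integrable_norm'[OF v])
    fix e :: real assume e: "e > 0"
    obtain d1 where d1: "d1 > 0" "\<And>p q. a \<le> p \<Longrightarrow> p \<le> q \<Longrightarrow> q \<le> b \<Longrightarrow> q - p < d1
                   \<Longrightarrow> norm (h q - h p - prod (D p) (f q - f p)) \<le> e / 2 * norm (f q - f p)"
      using diff[of "e / 2"] e by (meson half_gt_zero)
    obtain d2 where d2: "d2 > 0" "\<And>p t. p \<in> {a..b} \<Longrightarrow> t \<in> {a..b} \<Longrightarrow> \<bar>t - p\<bar> < d2 \<Longrightarrow> norm (D t - D p) < e / (2 * K)"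
      using continuous_on_Icc_uniformD[OF D, of "e / (2 * K)"] e K by auto
    show "\<exists>d>0. \<forall>p q. a \<le> p \<longrightarrow> p \<le> q \<longrightarrow> q \<le> b \<longrightarrow> q - p < d \<longrightarrow> 
       norm (h q - h p - (LINT t:{p..q}|lborel. prod (D t) (v t))) \<le> e * (LINT t:{p..q}|lborel. norm (v t))"
    proof (intro exI[of _ "min d1 d2"] conjI allI impI)
      fix p q assume pq: "a \<le> p" "p \<le> q" "q \<le> b" "q - p < min d1 d2"
      note fpq = primitive_onD[OF f pq(1-3)]
      let ?I = "LINT t:{p..q}|lborel. norm (v t)"
      have Dpq: "continuous_on {p..q} D" using pq by (intro continuous_on_subset[OF D]) auto
      have vn: "set_integrable lborel {p..q} (\<lambda>t. norm (v t))" by (rule set_integrable_norm'[OF fpq(2)])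
      have "prod (D p) (f q - f p) = (LINT t:{p..q}|lborel. prod (D p) (v t))"
        unfolding fpq(1) set_lebesgue_integral_def
        using integral_bounded_linear[OF bounded_linear_right, of lborel "\<lambda>t. indicator {p..q} t *\<^sub>R v t" "D p"] fpq(2)
        by (simp add: set_integrable_def scaleR_right)
      moreover have i1: "set_integrable lborel {p..q} (\<lambda>t. prod (D t) (v t))"
        by (rule set_integrable_bilinear[OF prod Dpq fpq(2)])
      moreover have i2: "set_integrable lborel {p..q} (\<lambda>t. prod (D p) (v t))"
        by (rule set_integrable_bilinear[OF prod _ fpq(2)]) auto
      ultimately have "prod (D p) (f q - f p) - (LINT t:{p..q}|lborel. prod (D t) (v t)) = 
          (LINT t:{p..q}|lborel. prod (D p) (v t) - prod (D t) (v t))"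
        by (simp add: set_integral_diff)
      also have "norm \<dots> \<le> (LINT t:{p..q}|lborel. norm (prod (D p) (v t) - prod (D t) (v t)))"
        by (rule norm_set_integral_le) (use i1 i2 in auto)
      also have "\<dots> \<le> (LINT t:{p..q}|lborel. e / 2 * norm (v t))"
      proof (rule set_integral_mono)
        fix t assume t: "t \<in> {p..q}"
        have "norm (prod (D p) (v t) - prod (D t) (v t)) \<le> norm (D p - D t) * norm (v t) * K"
          using K(2)[of "D p - D t" "v t"] by (simp add: diff_left)
        also have "\<dots> \<le> e / (2 * K) * norm (v t) * K"
          using d2(2)[of t p] t pq K by (intro mult_right_mono) (auto simp: dist_norm norm_minus_commute intro!: less_imp_le)
        finally show "norm (prod (D p) (v t) - prod (D t) (v t)) \<le> e / 2 * norm (v t)" using K by simp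
      qed (use i1 i2 vn in \<open>auto intro: set_integrable_norm'\<close>)
      also have "\<dots> = e / 2 * ?I" by simp
      finally have 1: "norm (prod (D p) (f q - f p) - (LINT t:{p..q}|lborel. prod (D t) (v t))) \<le> e / 2 * ?I" .
      have "norm (h q - h p - prod (D p) (f q - f p)) \<le> e / 2 * norm (f q - f p)"
        using pq by (intro d1) auto
      also have "\<dots> \<le> e / 2 * ?I"
        unfolding fpq(1) using e by (intro mult_left_mono norm_set_integral_le fpq) auto
      finally show "norm (h q - h p - (LINT t:{p..q}|lborel. prod (D t) (v t))) \<le> e * ?I"
        using 1 norm_triangle_ineq[of "h q - h p - prod (D p) (f q - f p)" "prod (D p) (f q - f p) - (LINT t:{p..q}|lborel. prod (D t) (v t))"]
        by (simp add: algebra_simps)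
    qed (use d1 d2 in auto)
  qed
qed

text \<open>The product rule, whose integral over an interval is integration by parts.\<close>
lemma primitive_on_scaleR:
  fixes V v :: "real \<Rightarrow> 'a::euclidean_space" and \<phi> :: "real \<Rightarrow> real"
  assumes V: "primitive_on a b V v" and \<phi>: "\<And>x. (\<phi> has_real_derivative \<phi>' x) (at x)"
    and \<phi>': "continuous_on UNIV \<phi>'"
  shows "primitive_on a b (\<lambda>t. \<phi> t *\<^sub>R V t) (\<lambda>t. \<phi>' t *\<^sub>R V t + \<phi> t *\<^sub>R v t)"
proof -
  have v: "set_integrable lborel {a..b} v" using V by (simp add: primitive_on_def)
  have cV: "continuous_on {a..b} V" by (rule primitive_on_continuous[OF V])
  have c\<phi>': "continuous_on A \<phi>'" for A using \<phi>' continuous_on_subset by blast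
  have c\<phi>: "continuous_on A \<phi>" for A using \<phi> by (meson DERIV_isCont continuous_at_imp_continuous_on)
  have \<phi>v: "set_integrable lborel {a..b} (\<lambda>t. \<phi> t *\<^sub>R v t)"
    by (rule set_integrable_bilinear[OF bounded_bilinear_scaleR c\<phi> v])
  have \<phi>V: "set_integrable lborel {a..b} (\<lambda>t. \<phi>' t *\<^sub>R V t)"
    by (intro borel_integrable_atLeastAtMost' continuous_intros cV c\<phi>')
  have p\<phi>: "primitive_on a b \<phi> \<phi>'"
    using \<phi> c\<phi>' by (intro primitive_on_C1) (auto simp: has_real_derivative_iff_has_vector_derivative intro: has_vector_derivative_at_within)
  have i\<phi>': "set_integrable lborel {a..b} \<phi>'" using p\<phi> by (simp add: primitive_on_def)
  show ?thesis
  proof (rule primitive_on_if_small_increments[where g = "\<lambda>t. norm (v t) + \<bar>\<phi>' t\<bar>"])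
    show "set_integrable lborel {a..b} (\<lambda>t. \<phi>' t *\<^sub>R V t + \<phi> t *\<^sub>R v t)" using \<phi>v \<phi>V by auto
    show "set_integrable lborel {a..b} (\<lambda>t. norm (v t) + \<bar>\<phi>' t\<bar>)"
      using set_integrable_norm'[OF v] set_integrable_abs[OF i\<phi>'] by auto
    fix e :: real assume e: "e > 0"
    obtain d1 where d1: "d1 > 0" "\<And>p t. p \<in> {a..b} \<Longrightarrow> t \<in> {a..b} \<Longrightarrow> \<bar>t - p\<bar> < d1 \<Longrightarrow> norm (V t - V p) < e"
      using continuous_on_Icc_uniformD[OF cV e] by auto
    obtain d2 where d2: "d2 > 0" "\<And>p t. p \<in> {a..b} \<Longrightarrow> t \<in> {a..b} \<Longrightarrow> \<bar>t - p\<bar> < d2 \<Longrightarrow> norm (\<phi> t - \<phi> p) < e"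
      using continuous_on_Icc_uniformD[OF c\<phi> e] by auto
    show "\<exists>d>0. \<forall>p q. a \<le> p \<longrightarrow> p \<le> q \<longrightarrow> q \<le> b \<longrightarrow> q - p < d \<longrightarrow> 
       norm (\<phi> q *\<^sub>R V q - \<phi> p *\<^sub>R V p - (LINT t:{p..q}|lborel. \<phi>' t *\<^sub>R V t + \<phi> t *\<^sub>R v t)) 
         \<le> e * (LINT t:{p..q}|lborel. norm (v t) + \<bar>\<phi>' t\<bar>)"
    proof (intro exI[of _ "min d1 d2"] conjI allI impI)
      fix p q assume pq: "a \<le> p" "p \<le> q" "q \<le> b" "q - p < min d1 d2"
      have sub: "set_integrable lborel {p..q} g" if "set_integrable lborel {a..b} g" for g :: "real \<Rightarrow> 'z::euclidean_space"
        by (rule set_integrable_subset[OF that]) (use pq in auto)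
      note V1 = primitive_onD[OF V pq(1-3)] and \<phi>1 = primitive_onD[OF p\<phi> pq(1-3)]
      have a: "(LINT t:{p..q}|lborel. \<phi> q *\<^sub>R v t) = \<phi> q *\<^sub>R (V q - V p)" using V1 by simp
      have b: "(LINT t:{p..q}|lborel. \<phi>' t *\<^sub>R V p) = (\<phi> q - \<phi> p) *\<^sub>R V p" 
        using \<phi>1 integral_scaleR_left[of "V p" lborel "\<lambda>t. indicator {p..q} t *\<^sub>R \<phi>' t"]
        by (simp add: set_integrable_def set_lebesgue_integral_def)
      have i1: "set_integrable lborel {p..q} (\<lambda>t. \<phi> q *\<^sub>R v t + \<phi>' t *\<^sub>R V p)"
        using V1 \<phi>1 by auto
      have i2: "set_integrable lborel {p..q} (\<lambda>t. \<phi>' t *\<^sub>R V t + \<phi> t *\<^sub>R v t)"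
        using \<phi>v \<phi>V by (intro sub) auto
      have "\<phi> q *\<^sub>R V q - \<phi> p *\<^sub>R V p = \<phi> q *\<^sub>R (V q - V p) + (\<phi> q - \<phi> p) *\<^sub>R V p"
        by (simp add: algebra_simps)
      also have "\<dots> = (LINT t:{p..q}|lborel. \<phi> q *\<^sub>R v t + \<phi>' t *\<^sub>R V p)"
        using V1 \<phi>1 a b by (subst set_integral_add(2)) auto
      finally have "\<phi> q *\<^sub>R V q - \<phi> p *\<^sub>R V p - (LINT t:{p..q}|lborel. \<phi>' t *\<^sub>R V t + \<phi> t *\<^sub>R v t)
         = (LINT t:{p..q}|lborel. (\<phi> q *\<^sub>R v t + \<phi>' t *\<^sub>R V p) - (\<phi>' t *\<^sub>R V t + \<phi> t *\<^sub>R v t))"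
        using i1 i2 by (subst set_integral_diff(2)) auto
      also have "norm \<dots> \<le> (LINT t:{p..q}|lborel. norm ((\<phi> q *\<^sub>R v t + \<phi>' t *\<^sub>R V p) - (\<phi>' t *\<^sub>R V t + \<phi> t *\<^sub>R v t)))"
        by (rule norm_set_integral_le) (use i1 i2 in auto)
      also have "\<dots> \<le> (LINT t:{p..q}|lborel. e * (norm (v t) + \<bar>\<phi>' t\<bar>))"
      proof (rule set_integral_mono)
        fix t assume t: "t \<in> {p..q}"
        have "(\<phi> q *\<^sub>R v t + \<phi>' t *\<^sub>R V p) - (\<phi>' t *\<^sub>R V t + \<phi> t *\<^sub>R v t) = (\<phi> q - \<phi> t) *\<^sub>R v t + \<phi>' t *\<^sub>R (V p - V t)"
          by (simp add: algebra_simps)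
        also have "norm \<dots> \<le> \<bar>\<phi> q - \<phi> t\<bar> * norm (v t) + \<bar>\<phi>' t\<bar> * norm (V p - V t)"
          by (rule norm_triangle_le) simp
        also have "\<dots> \<le> e * norm (v t) + \<bar>\<phi>' t\<bar> * e"
          using d1(2)[of t p] d2(2)[of t q] t pq 
          by (intro add_mono mult_right_mono mult_left_mono) (auto simp: norm_minus_commute intro!: less_imp_le)
        finally show "norm ((\<phi> q *\<^sub>R v t + \<phi>' t *\<^sub>R V p) - (\<phi>' t *\<^sub>R V t + \<phi> t *\<^sub>R v t)) \<le> e * (norm (v t) + \<bar>\<phi>' t\<bar>)"
          by (simp add: algebra_simps)
      qed (use i1 i2 V1 \<phi>1 in \<open>auto intro!: set_integrable_norm' set_integrable_abs\<close>)
      also have "\<dots> = e * (LINT t:{p..q}|lborel. norm (v t) + \<bar>\<phi>' t\<bar>)" by simp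
      finally show "norm (\<phi> q *\<^sub>R V q - \<phi> p *\<^sub>R V p - (LINT t:{p..q}|lborel. \<phi>' t *\<^sub>R V t + \<phi> t *\<^sub>R v t)) 
         \<le> e * (LINT t:{p..q}|lborel. norm (v t) + \<bar>\<phi>' t\<bar>)" .
    qed (use d1 d2 in auto)
  qed
qed

section \<open>The fundamental lemma of the calculus of variations\<close>

text \<open>The sets over which \<open>w\<close> integrates to zero form a Dynkin system that contains the half-lines.\<close>
lemma AE_zero_if_interval_integrals_zero:
  fixes w :: "real \<Rightarrow> 'a::euclidean_space"
  assumes w: "set_integrable lborel {c..d} w"
    and zero: "\<And>p q. c \<le> p \<Longrightarrow> p \<le> q \<Longrightarrow> q \<le> d \<Longrightarrow> (LINT t:{p..q}|lborel. w t) = 0"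
  shows "AE t in lborel. t \<in> {c..d} \<longrightarrow> w t = 0"
proof -
  let ?f = "\<lambda>t. indicator {c..d} t *\<^sub>R w t"
  have f: "integrable lborel ?f" using w by (simp add: set_integrable_def)
  have fA: "set_integrable lborel A ?f" if "A \<in> sets borel" for A
    unfolding set_integrable_def using that by (intro integrable_mult_indicator f) auto
  have all: "integral\<^sup>L lborel ?f = 0"
  proof (cases "c \<le> d")
    case True
    thus ?thesis using zero[of c d] by (simp add: set_lebesgue_integral_def)
  qed auto
  have "(LINT t:A|lborel. ?f t) = 0" if "A \<in> sets borel" for A
  proof -
    have stable: "Int_stable (range (\<lambda>a::real. {..a}))" by (auto simp: Int_stable_def)
    have sub: "range (\<lambda>a::real. {..a}) \<subseteq> Pow UNIV" by simp
    have "A \<in> sigma_sets UNIV (range (\<lambda>a::real. {..a}))" using that by (simp add: borel_eq_atMost)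
    with stable sub show ?thesis
    proof (induction rule: sigma_sets_induct_disjoint)
      case (basic A)
      then obtain x where x: "A = {..x}" by blast
      have "(\<lambda>t. indicator A t *\<^sub>R ?f t) = (\<lambda>t. indicator {c..min x d} t *\<^sub>R w t)"
        by (auto simp: x indicator_def)
      hence "(LINT t:A|lborel. ?f t) = (LINT t:{c..min x d}|lborel. w t)"
        by (simp add: set_lebesgue_integral_def)
      also have "\<dots> = 0" 
        using zero[of c "min x d"] by (cases "c \<le> min x d") (auto simp: set_lebesgue_integral_def)
      finally show ?case .
    next
      case empty
      show ?case by (simp add: set_lebesgue_integral_def)
    next
      case (compl A)
      hence A: "A \<in> sets borel" by (simp add: borel_eq_atMost)
      have "(LINT t:UNIV|lborel. ?f t) = (LINT t:A|lborel. ?f t) + (LINT t:UNIV - A|lborel. ?f t)"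
        using set_integral_Un[of A "UNIV - A" lborel ?f] A fA[of A] fA[of "UNIV - A"] by auto
      thus ?case using compl all by (simp add: set_lebesgue_integral_def)
    next
      case (union A)
      hence A: "A i \<in> sets borel" for i by (auto simp: borel_eq_atMost)
      have "(LINT t:(\<Union>i. A i)|lborel. ?f t) = (\<Sum>i. (LINT t:(A i)|lborel. ?f t))"
        using union A by (intro lebesgue_integral_countable_add fA) (auto simp: disjoint_family_on_def)
      thus ?case using union by simp
    qed
  qed
  hence "AE t in lborel. ?f t = 0" by (intro sigma_finite_measure.density_zero[OF lborel.sigma_finite_measure_axioms f]) auto
  thus ?thesis by eventually_elim (metis indicator_simps(1) scaleR_one)
qed

lemma locally_integrableD: "locally_integrable S w \<Longrightarrow> {c..d} \<subseteq> S \<Longrightarrow> set_integrable lborel {c..d} w"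
  by (auto simp: locally_integrable_def)

lemma set_integral_supported:
  fixes f :: "real \<Rightarrow> 'a::euclidean_space"
  assumes "\<And>x. x \<notin> {c..d} \<Longrightarrow> f x = 0" "\<And>x. x \<notin> S \<Longrightarrow> f x = 0"
  shows "(LINT x:S|lborel. f x) = (LINT x:{c..d}|lborel. f x)"
  unfolding set_lebesgue_integral_def
  by (intro Bochner_Integration.integral_cong refl) (use assms in \<open>auto simp: indicator_def\<close>)

lemma continuous_test_function: 
  assumes "test_function S \<phi>" shows "continuous_on A \<phi>" "continuous_on A (deriv \<phi>)"
proof -
  have "continuous_on UNIV \<phi> \<and> continuous_on UNIV (deriv \<phi>)"
    using assms by (rule test_functionE) blast
  thus "continuous_on A \<phi>" "continuous_on A (deriv \<phi>)" by (auto intro: continuous_on_subset)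
qed

text \<open>The bumps converge boundedly to the indicator of an interval, so the integral of \<open>w\<close> over every
  interval in \<open>S\<close> vanishes. Countably many intervals with rational endpoints exhaust \<open>S\<close>.\<close>
lemma AE_zero_if_test_integrals_zero:
  fixes w :: "real \<Rightarrow> 'a::euclidean_space"
  assumes S: "open S" and w: "locally_integrable S w"
    and test: "\<And>\<phi>. test_function S \<phi> \<Longrightarrow> (LINT x:S|lborel. \<phi> x *\<^sub>R w x) = 0"
  shows "AE t in lborel. t \<in> S \<longrightarrow> w t = 0"
proof -
  have int0: "(LINT t:{p..q}|lborel. w t) = 0" if "{p..q} \<subseteq> S" for p q
  proof -
    let ?w = "\<lambda>x. indicator {p..q} x *\<^sub>R w x"
    have i: "integrable lborel ?w" using locally_integrableD[OF w that] by (simp add: set_integrable_def)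
    have m: "bump n p q \<in> borel_measurable lborel" for n
      using borel_measurable_continuous_onI[OF continuous_test_function(1)[OF test_function_bump[OF subset_UNIV]]]
      by simp
    have "(\<lambda>n. LINT x|lborel. bump n p q x *\<^sub>R ?w x) \<longlonglongrightarrow> (LINT x|lborel. indicat_real {p<..<q} x *\<^sub>R ?w x)"
    proof (rule integral_dominated_convergence[where w = "\<lambda>x. norm (?w x)"])
      show "(\<lambda>x. indicat_real {p<..<q} x *\<^sub>R ?w x) \<in> borel_measurable lborel"
        using i by measurable
      show "(\<lambda>x. bump n p q x *\<^sub>R ?w x) \<in> borel_measurable lborel" for n
        using i m by measurable
      show "integrable lborel (\<lambda>x. norm (?w x))" using i by (rule integrable_norm)
      show "AE x in lborel. (\<lambda>n. bump n p q x *\<^sub>R ?w x) \<longlonglongrightarrow> indicat_real {p<..<q} x *\<^sub>R ?w x"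
        by (intro AE_I2 tendsto_intros bump_tendsto)
      show "AE x in lborel. norm (bump n p q x *\<^sub>R ?w x) \<le> norm (?w x)" for n
      proof (rule AE_I2)
        fix x
        have "\<bar>bump n p q x\<bar> * norm (?w x) \<le> 1 * norm (?w x)"
          using bump_bounds[of n p q x] by (intro mult_right_mono) auto
        thus "norm (bump n p q x *\<^sub>R ?w x) \<le> norm (?w x)" by (simp add: abs_mult mult.assoc)
      qed
    qed
    moreover have "(LINT x|lborel. bump n p q x *\<^sub>R ?w x) = 0" for n
    proof -
      have "(LINT x|lborel. bump n p q x *\<^sub>R ?w x) = (LINT x:{p..q}|lborel. bump n p q x *\<^sub>R w x)"
        by (simp add: set_lebesgue_integral_def mult.commute)
      also have "\<dots> = (LINT x:S|lborel. bump n p q x *\<^sub>R w x)"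
      proof (rule set_integral_supported[symmetric])
        fix x
        show "bump n p q x *\<^sub>R w x = 0" if "x \<notin> {p..q}" using bump_eq_0[of x p q n] that by auto
        show "bump n p q x *\<^sub>R w x = 0" if "x \<notin> S"
        proof -
          have "x \<notin> {p..q}" using subsetD[OF \<open>{p..q} \<subseteq> S\<close>] that by blast
          hence "x \<notin> {p<..<q}" by auto
          thus ?thesis using bump_eq_0[of x p q n] by simp
        qed
      qed
      also have "\<dots> = 0" by (rule test[OF test_function_bump[OF that]])
      finally show ?thesis .
    qed
    ultimately have "(LINT x|lborel. indicat_real {p<..<q} x *\<^sub>R ?w x) = 0" 
      by (simp add: LIMSEQ_const_iff)
    also have "(LINT x|lborel. indicat_real {p<..<q} x *\<^sub>R ?w x) = (LINT x|lborel. ?w x)"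
    proof (rule integral_cong_AE)
      have "AE x in lborel. x \<noteq> p" "AE x in lborel. x \<noteq> q" by (rule AE_lborel_singleton)+
      thus "AE x in lborel. indicat_real {p<..<q} x *\<^sub>R ?w x = ?w x"
        by eventually_elim (auto simp: indicator_def)
    qed (use i in measurable)
    finally show ?thesis by (simp add: set_lebesgue_integral_def)
  qed
  have loc: "AE t in lborel. t \<in> {c..d} \<longrightarrow> w t = 0" if "{c..d} \<subseteq> S" for c d
    using that by (intro AE_zero_if_interval_integrals_zero locally_integrableD[OF w] int0) auto
  have "AE t in lborel. \<forall>(c, d)\<in>{(c, d)\<in>\<rat> \<times> \<rat>. {c..d} \<subseteq> S}. t \<in> {c..d} \<longrightarrow> w t = 0"
  proof (subst AE_ball_countable)
    show "countable {(c, d)\<in>\<rat> \<times> \<rat>. {c..d::real} \<subseteq> S}"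
      by (rule countable_subset[of _ "\<rat> \<times> \<rat>"]) (auto simp: countable_rat)
    show "\<forall>x\<in>{(c, d)\<in>\<rat> \<times> \<rat>. {c..d} \<subseteq> S}. AE t in lborel. case x of (c, d) \<Rightarrow> t \<in> {c..d} \<longrightarrow> w t = 0"
      using loc by auto
  qed
  thus ?thesis
  proof eventually_elim
    case (elim t)
    show ?case
    proof
      assume "t \<in> S"
      then obtain e where e: "e > 0" "ball t e \<subseteq> S" using S openE by blast
      obtain c where c: "c \<in> \<rat>" "t - e < c" "c < t" using Rats_dense_in_real[of "t - e" t] e by auto
      obtain d where d: "d \<in> \<rat>" "t < d" "d < t + e" using Rats_dense_in_real[of t "t + e"] e by auto
      have "{c..d} \<subseteq> ball t e" using c d by (auto simp: dist_real_def)
      hence "(c, d) \<in> {(c, d)\<in>\<rat> \<times> \<rat>. {c..d} \<subseteq> S}" using c d e by auto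
      thus "w t = 0" using elim c d by fastforce
    qed
  qed
qed

lemma set_integrable_test:
  fixes w :: "real \<Rightarrow> 'a::euclidean_space"
  assumes \<phi>: "continuous_on UNIV \<phi>" "\<And>x. x \<notin> K \<Longrightarrow> \<phi> x = 0" "compact K" "K \<subseteq> S" and w: "locally_integrable S w"
  shows "set_integrable lborel S (\<lambda>x. \<phi> x *\<^sub>R w x)"
proof -
  obtain r where r: "K \<subseteq> {-r..r}" using compact_imp_bounded[OF assms(3)] 
      bounded_subset_cbox_symmetric[of K] by auto
  have "set_integrable lborel K w" using w assms by (auto simp: locally_integrable_def)
  hence "set_integrable lborel {-r..r} (\<lambda>x. indicator K x *\<^sub>R w x)"
    unfolding set_integrable_def by (rule integrable_mult_indicator[rotated]) auto
  from set_integrable_bilinear[OF bounded_bilinear_scaleR continuous_on_subset[OF \<phi>(1)] this]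
  have "set_integrable lborel {-r..r} (\<lambda>x. \<phi> x *\<^sub>R indicat_real K x *\<^sub>R w x)" by simp
  moreover have "(\<lambda>x. indicat_real {-r..r} x *\<^sub>R \<phi> x *\<^sub>R indicat_real K x *\<^sub>R w x) = (\<lambda>x. indicat_real S x *\<^sub>R \<phi> x *\<^sub>R w x)"
  proof
    fix x show "indicat_real {-r..r} x *\<^sub>R \<phi> x *\<^sub>R indicat_real K x *\<^sub>R w x = indicat_real S x *\<^sub>R \<phi> x *\<^sub>R w x"
      using \<phi>(2)[of x] r assms(4) by (cases "x \<in> K") (auto simp: indicator_def)
  qed
  ultimately show ?thesis by (simp add: set_integrable_def)
qed

lemma test_function_integrable:
  fixes w :: "real \<Rightarrow> 'a::euclidean_space"
  assumes "test_function S \<phi>" "locally_integrable S w"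
  shows "set_integrable lborel S (\<lambda>x. \<phi> x *\<^sub>R w x)"
proof (rule set_integrable_test[OF continuous_test_function(1)[OF assms(1)] _ _ _ assms(2)])
  fix x assume "x \<notin> closure {x. \<phi> x \<noteq> 0}"
  thus "\<phi> x = 0" using closure_subset[of "{x. \<phi> x \<noteq> 0}"] by auto
qed (use assms in \<open>auto simp: test_function_def\<close>)

lemma is_weak_deriv_unique:
  fixes v v' :: "real \<Rightarrow> 'a::euclidean_space"
  assumes S: "open S" and v: "is_weak_deriv S u v" and v': "is_weak_deriv S u v'"
  shows "AE t in lborel. t \<in> S \<longrightarrow> v t = v' t"
proof -
  have l: "locally_integrable S v" "locally_integrable S v'" using v v' by (auto simp: is_weak_deriv_def)
  have "AE t in lborel. t \<in> S \<longrightarrow> v t - v' t = 0"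
  proof (rule AE_zero_if_test_integrals_zero[OF S])
    show "locally_integrable S (\<lambda>t. v t - v' t)" using l unfolding locally_integrable_def by auto
    fix \<phi> assume \<phi>: "test_function S \<phi>"
    have "(LINT x:S|lborel. deriv \<phi> x *\<^sub>R u x) = - (LINT x:S|lborel. \<phi> x *\<^sub>R v x)"
      using v \<phi> unfolding is_weak_deriv_def by blast
    moreover have "(LINT x:S|lborel. deriv \<phi> x *\<^sub>R u x) = - (LINT x:S|lborel. \<phi> x *\<^sub>R v' x)"
      using v' \<phi> unfolding is_weak_deriv_def by blast
    ultimately have "(LINT x:S|lborel. \<phi> x *\<^sub>R v x) = (LINT x:S|lborel. \<phi> x *\<^sub>R v' x)" by simp
    thus "(LINT x:S|lborel. \<phi> x *\<^sub>R (v x - v' x)) = 0"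
      using test_function_integrable[OF \<phi> l(1)] test_function_integrable[OF \<phi> l(2)]
      by (simp add: scaleR_diff_right)
  qed
  thus ?thesis by eventually_elim auto
qed

lemma locally_integrable_Icc:
  assumes "\<And>a b. set_integrable lborel {a..b} v"
  shows "locally_integrable S v"
  unfolding locally_integrable_def
proof (intro allI impI)
  fix C assume C: "compact C \<and> C \<subseteq> S"
  then obtain r where "C \<subseteq> {-r..r}" using compact_imp_bounded[of C] bounded_subset_cbox_symmetric[of C] by auto
  thus "set_integrable lborel C v"
    using C by (intro set_integrable_subset[OF assms]) (auto dest: borel_compact)
qed

lemma primitive_on_imp_is_weak_deriv:
  fixes u v :: "real \<Rightarrow> 'a::euclidean_space"
  assumes "\<And>a b. primitive_on a b u v"
  shows "is_weak_deriv S u v"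
proof -
  have u: "set_integrable lborel {a..b} u" for a b
    by (rule borel_integrable_atLeastAtMost'[OF primitive_on_continuous[OF assms]])
  have v: "set_integrable lborel {a..b} v" for a b using assms by (simp add: primitive_on_def)
  show ?thesis
    unfolding is_weak_deriv_def
  proof (intro conjI locally_integrable_Icc u v allI impI)
    fix \<phi> assume "test_function S \<phi>"
    then obtain c d where cd: "c < d" "\<And>x. x \<notin> {c..d} \<Longrightarrow> \<phi> x = 0" "\<And>x. x \<notin> {c..d} \<Longrightarrow> deriv \<phi> x = 0"
      "\<And>x. x \<notin> S \<Longrightarrow> \<phi> x = 0" "\<And>x. x \<notin> S \<Longrightarrow> deriv \<phi> x = 0"
      "\<And>x. (\<phi> has_real_derivative deriv \<phi> x) (at x)" "continuous_on UNIV (deriv \<phi>)" 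
      "continuous_on UNIV \<phi>" by (rule test_functionE) blast
    let ?c = "c - 1" and ?d = "d + 1"
    have "(LINT x:S|lborel. deriv \<phi> x *\<^sub>R u x) = (LINT x:{?c..?d}|lborel. deriv \<phi> x *\<^sub>R u x)"
      by (rule set_integral_supported) (use cd in auto)
    moreover have "(LINT x:S|lborel. \<phi> x *\<^sub>R v x) = (LINT x:{?c..?d}|lborel. \<phi> x *\<^sub>R v x)"
      by (rule set_integral_supported) (use cd in auto)
    moreover have "primitive_on ?c ?d (\<lambda>t. \<phi> t *\<^sub>R u t) (\<lambda>t. deriv \<phi> t *\<^sub>R u t + \<phi> t *\<^sub>R v t)"
      by (rule primitive_on_scaleR[OF assms cd(6,7)])
    hence "\<phi> ?d *\<^sub>R u ?d - \<phi> ?c *\<^sub>R u ?c = (LINT x:{?c..?d}|lborel. deriv \<phi> x *\<^sub>R u x + \<phi> x *\<^sub>R v x)"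
      using cd(1) by (intro primitive_onD) auto
    moreover have "\<dots> = (LINT x:{?c..?d}|lborel. deriv \<phi> x *\<^sub>R u x) + (LINT x:{?c..?d}|lborel. \<phi> x *\<^sub>R v x)"
      by (intro set_integral_add(2) set_integrable_bilinear[OF bounded_bilinear_scaleR] u v continuous_on_subset[OF cd(7)] continuous_on_subset[OF cd(8)]) auto
    ultimately show "(LINT x:S|lborel. deriv \<phi> x *\<^sub>R u x) = - (LINT x:S|lborel. \<phi> x *\<^sub>R v x)"
      using cd(2)[of ?c] cd(2)[of ?d] by (simp add: eq_neg_iff_add_eq_0)
  qed
qed

text \<open>The arbitrary choice in \<^const>\<open>weak_deriv\<close> is harmless, because weak derivatives on an open set agree
  almost everywhere.\<close>
lemma weak_deriv_eq:
  fixes u v :: "real \<Rightarrow> 'a::euclidean_space"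
  assumes "\<And>a b. primitive_on a b u v" "open S"
  shows "AE t in lborel. t \<in> S \<longrightarrow> weak_deriv S u t = v t"
proof (rule is_weak_deriv_unique[OF assms(2)])
  show v: "is_weak_deriv S u v" by (rule primitive_on_imp_is_weak_deriv[OF assms(1)])
  show "is_weak_deriv S u (weak_deriv S u)" 
    unfolding weak_deriv_def by (rule someI[of "\<lambda>v. is_weak_deriv S u v", OF v])
qed

text \<open>The lemma of du Bois-Reymond. A test function \<open>\<beta>\<close> is itself a derivative of a test function once a
  multiple of a fixed normalised bump \<open>\<beta>0\<close> is subtracted to make its integral zero. So \<open>w\<close> tested with
  \<open>\<beta>\<close> gives the same as the constant \<open>k\<close>, which is the integral of \<open>\<beta>0\<close> times \<open>w\<close>.\<close>
lemma AE_const_if_weak_deriv_zero: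
  fixes w :: "real \<Rightarrow> 'a::euclidean_space"
  assumes w: "locally_integrable UNIV w"
    and test: "\<And>\<phi>. test_function UNIV \<phi> \<Longrightarrow> (LINT x:UNIV|lborel. deriv \<phi> x *\<^sub>R w x) = 0"
  obtains k where "AE t in lborel. w t = k"
proof -
  define \<beta>0 where "\<beta>0 = (\<lambda>x. bump 1 0 1 x / integral {0..1} (bump 1 0 1))"
  have cb: "continuous_on A (bump 1 0 1)" for A
    by (rule continuous_test_function(1)[OF test_function_bump[OF subset_UNIV]])
  have pos: "integral {0..1} (bump 1 0 1) > 0"
  proof -
    have "integral {0..1} (bump 1 0 1) \<noteq> 0"
    proof
      assume "integral {0..1} (bump 1 0 1) = 0"
      hence "\<forall>x\<in>{0..1}. bump 1 0 1 x = 0"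
        using integral_cbox_eq_0_iff[of 0 1 "bump 1 0 1"] bump_bounds(1)[of 1 0 1] cb[of "{0..1}"] by simp
      hence "bump 1 0 1 (1 / 2) = 0" by (rule bspec) auto
      thus False using bump_pos[of 1 "1/2" 0 1] by simp
    qed
    moreover have "integral {0..1} (bump 1 0 1) \<ge> 0"
      by (intro integral_nonneg integrable_continuous_real cb) (auto simp: bump_bounds)
    ultimately show ?thesis by linarith
  qed
  have s0: "times_differentiable n \<beta>0" for n
    unfolding \<beta>0_def divide_inverse by (intro times_differentiable_mult times_differentiable_const times_differentiable_bump)
  have z0: "\<beta>0 x = 0" if "x \<notin> {0..1}" for x using bump_eq_0[of x 0 1 1] that by (auto simp: \<beta>0_def)
  have t0: "test_function UNIV \<beta>0" by (rule test_functionI[of _ 0 1]) (use s0 z0 in auto)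
  have i0: "integral {0..1} \<beta>0 = 1" using pos by (simp add: \<beta>0_def integral_divide)
  define k where "k = (LINT x:UNIV|lborel. \<beta>0 x *\<^sub>R w x)"
  have "AE t in lborel. t \<in> UNIV \<longrightarrow> w t - k = 0"
  proof (rule AE_zero_if_test_integrals_zero)
    show "locally_integrable UNIV (\<lambda>t. w t - k)" 
      by (intro locally_integrable_Icc set_integral_diff(1) borel_integrable_atLeastAtMost'[of _ _ "\<lambda>_. k"] locally_integrableD[OF w])
        auto
    fix \<beta> assume \<beta>: "test_function UNIV \<beta>"
    then obtain c d where cd: "c < d" "\<And>x. x \<notin> {c..d} \<Longrightarrow> \<beta> x = 0" by (rule test_functionE) blast
    define a b where "a = min c 0" and "b = max d 1"
    have ab: "a < b" using cd(1) by (auto simp: a_def b_def)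
    define J where "J = integral {a..b} \<beta>"
    define \<psi> where "\<psi> x = \<beta> x - J * \<beta>0 x" for x
    have c\<beta>: "continuous_on A \<beta>" "continuous_on A \<beta>0" for A using continuous_test_function(1) \<beta> t0 by auto
    have s\<psi>: "times_differentiable n \<psi>" for n
      unfolding \<psi>_def diff_conv_add_uminus mult_minus_left[symmetric] using \<beta>
      by (intro times_differentiable_add times_differentiable_mult times_differentiable_const s0)
         (auto simp: test_function_def smooth_iff_times_differentiable)
    have z\<psi>: "\<psi> x = 0" if "x \<notin> {a..b}" for x
    proof -
      have "x \<notin> {c..d}" "x \<notin> {0..1}" using that by (auto simp: a_def b_def)
      thus ?thesis using cd(2) z0 by (simp add: \<psi>_def)
    qed
    have i0': "integral {a..b} \<beta>0 = 1"
    proof -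
      have "(\<beta>0 has_integral integral {0..1} \<beta>0) {0..1}"
        by (intro integrable_integral integrable_continuous_real c\<beta>)
      hence "(\<beta>0 has_integral integral {0..1} \<beta>0) {a..b}"
        by (rule has_integral_on_superset) (use z0 in \<open>auto simp: a_def b_def\<close>)
      hence "integral {a..b} \<beta>0 = integral {0..1} \<beta>0" by (rule integral_unique)
      thus ?thesis using i0 by simp
    qed
    have c\<psi>: "continuous_on A \<psi>" for A unfolding \<psi>_def by (intro continuous_intros c\<beta>)
    have i\<psi>: "integral {a..b} \<psi> = 0"
      unfolding \<psi>_def using i0' c\<beta>
      by (subst integral_diff) (auto intro!: integrable_continuous_real continuous_intros simp: J_def)
    \<comment> \<open>The integral of \<open>\<psi>\<close> vanishes, so its primitive from the left has compact support.\<close>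
    define \<phi> where "\<phi> x = (if x < a then 0 else integral {a..x} \<psi>)" for x
    have \<phi>0: "\<phi> x = 0" if "x \<notin> {a..b}" for x
    proof (cases "x < a")
      case False
      hence x: "b < x" using that by auto
      have "integral {a..x} \<psi> = integral {a..b} \<psi> + integral {b..x} \<psi>"
        using x ab by (intro Henstock_Kurzweil_Integration.integral_combine[symmetric] integrable_continuous_real c\<psi>) auto
      moreover have "integral {b..x} \<psi> = 0"
        by (rule integral_unique, rule has_integral_spike_finite[of "{b}" _ _ "\<lambda>_. 0"]) (use z\<psi> ab in auto)
      ultimately show ?thesis using False i\<psi> by (simp add: \<phi>_def)
    qed (simp add: \<phi>_def)
    have \<phi>d: "(\<phi> has_real_derivative \<psi> x) (at x)" for x
    proof -
      \<comment> \<open>Starting the integral at \<open>l\<close>, to the left of \<open>a\<close> and of \<open>x\<close>, gives one formula near \<open>x\<close>.\<close>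
      define l where "l = min a x - 1"
      have "((\<lambda>u. integral {l..u} \<psi>) has_vector_derivative \<psi> x) (at x within {l..x + 1})"
        by (rule integral_has_vector_derivative) (auto intro: c\<psi> simp: l_def)
      hence D: "((\<lambda>u. integral {l..u} \<psi>) has_real_derivative \<psi> x) (at x)"
        by (subst (asm) at_within_Icc_at) (auto simp: l_def has_real_derivative_iff_has_vector_derivative)
      have eq: "integral {l..u} \<psi> = \<phi> u" if "u > l" for u
      proof (cases "u < a")
        case True
        have "(\<psi> has_integral 0) {l..u}"
          by (rule has_integral_eq[of _ "\<lambda>_. 0"]) (use z\<psi> True in auto)
        thus ?thesis using True by (auto simp: \<phi>_def)
      next
        case False
        have "integral {l..u} \<psi> = integral {l..a} \<psi> + integral {a..u} \<psi>"
          using False that by (intro Henstock_Kurzweil_Integration.integral_combine[symmetric] integrable_continuous_real c\<psi>) (auto simp: l_def)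
        moreover have "integral {l..a} \<psi> = 0"
          by (rule integral_unique, rule has_integral_spike_finite[of "{a}" _ _ "\<lambda>_. 0"]) (use z\<psi> ab in auto)
        ultimately show ?thesis using False by (simp add: \<phi>_def)
      qed
      show ?thesis
        by (rule has_field_derivative_transform_within_open[OF D, of "{l<..}"]) (auto simp: eq, auto simp: l_def)
    qed
    have "times_differentiable n \<phi>" for n
      by (rule times_differentiable_SucD[OF times_differentiableI[OF \<phi>d s\<psi>]])
    hence "test_function UNIV \<phi>" by (intro test_functionI[of _ a b]) (use \<phi>0 in auto)
    from test[OF this] have "(LINT x:UNIV|lborel. \<psi> x *\<^sub>R w x) = 0"
      using DERIV_imp_deriv[OF \<phi>d] by simp
    hence "(LINT x:UNIV|lborel. \<beta> x *\<^sub>R w x - J *\<^sub>R \<beta>0 x *\<^sub>R w x) = 0"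
      by (simp add: \<psi>_def scaleR_diff_left)
    hence 1: "(LINT x:UNIV|lborel. \<beta> x *\<^sub>R w x) = J *\<^sub>R k"
      using test_function_integrable[OF \<beta> w] test_function_integrable[OF t0 w]
      by (subst (asm) set_integral_diff(2)) (auto simp: k_def simp del: scaleR_scaleR)
    have lk: "locally_integrable UNIV (\<lambda>_. k)" by (intro locally_integrable_Icc borel_integrable_atLeastAtMost') auto
    have "(LINT x:UNIV|lborel. \<beta> x *\<^sub>R k) = (LINT x:{a..b}|lborel. \<beta> x *\<^sub>R k)"
    proof (rule set_integral_supported)
      fix x assume "x \<notin> {a..b}"
      hence "x \<notin> {c..d}" by (auto simp: a_def b_def)
      thus "\<beta> x *\<^sub>R k = 0" using cd(2) by simp
    qed auto
    also have "\<dots> = J *\<^sub>R k"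
      using set_borel_integral_eq_integral(2)[of "{a..b}" \<beta>] borel_integrable_atLeastAtMost'[OF c\<beta>(1), of a b]
        integral_scaleR_left[of k lborel "\<lambda>t. indicator {a..b} t *\<^sub>R \<beta> t"]
      by (simp add: J_def set_integrable_def set_lebesgue_integral_def)
    finally show "(LINT x:UNIV|lborel. \<beta> x *\<^sub>R (w x - k)) = 0"
      using 1 test_function_integrable[OF \<beta> w] test_function_integrable[OF \<beta> lk]
      by (simp add: scaleR_diff_right)
  qed auto
  hence "AE t in lborel. w t = k" by eventually_elim auto
  thus ?thesis by (rule that)
qed

lemma primitive_on_global_ex:
  fixes v :: "real \<Rightarrow> 'a::euclidean_space"
  assumes v: "\<And>a b. set_integrable lborel {a..b} v"
  obtains V where "\<And>a b. primitive_on a b V v"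
proof -
  define V where "V x = (if x \<ge> 0 then (LINT t:{0..x}|lborel. v t) else - (LINT t:{x..0}|lborel. v t))" for x
  have "V q - V p = (LINT t:{p..q}|lborel. v t)" if "p \<le> q" for p q
  proof -
    consider "0 \<le> p" | "q < 0" | "p < 0" "0 \<le> q" by linarith
    thus ?thesis
    proof cases
      case 1 thus ?thesis using interval_integral_add[of 0 p q v] v that by (auto simp: V_def)
    next
      case 2 thus ?thesis using interval_integral_add[of p q 0 v] v that by (auto simp: V_def)
    next
      case 3 thus ?thesis using interval_integral_add[of p 0 q v] v that by (auto simp: V_def)
    qed
  qed
  thus ?thesis using v by (intro that[of V]) (auto simp: primitive_on_def)
qed

text \<open>A primitive \<open>V\<close> of \<open>v\<close> has the same weak derivative as \<open>u\<close>, so \<open>u - V\<close> is almost everywhere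
  constant. This supplies the absolutely continuous representative of \<open>u\<close>.\<close>
lemma is_weak_deriv_imp_primitive:
  fixes u v :: "real \<Rightarrow> 'a::euclidean_space"
  assumes "is_weak_deriv UNIV u v"
  obtains V where "\<And>a b. primitive_on a b V v" "AE t in lborel. u t = V t"
proof -
  have u: "locally_integrable UNIV u" and v: "locally_integrable UNIV v" using assms by (auto simp: is_weak_deriv_def)
  obtain V where V: "\<And>a b. primitive_on a b V v"
    using primitive_on_global_ex[of v] locally_integrableD[OF v] by auto
  hence wV: "is_weak_deriv UNIV V v" by (rule primitive_on_imp_is_weak_deriv)
  hence lV: "locally_integrable UNIV V" by (simp add: is_weak_deriv_def)
  have "locally_integrable UNIV (\<lambda>t. u t - V t)"
    using u lV unfolding locally_integrable_def by auto
  moreover have "(LINT x:UNIV|lborel. deriv \<phi> x *\<^sub>R (u x - V x)) = 0" if \<phi>: "test_function UNIV \<phi>" for \<phi>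
  proof -
    obtain c d where cd: "\<And>x. x \<notin> {c..d} \<Longrightarrow> deriv \<phi> x = 0" using \<phi> by (rule test_functionE) blast
    have i: "set_integrable lborel UNIV (\<lambda>x. deriv \<phi> x *\<^sub>R f x)" if "locally_integrable UNIV f" for f :: "real \<Rightarrow> 'a"
      by (rule set_integrable_test[OF continuous_test_function(2)[OF \<phi>] _ _ _ that, of "{c..d}"]) (use cd in auto)
    show ?thesis
      using assms wV \<phi> i[OF u] i[OF lV] unfolding is_weak_deriv_def by (simp add: scaleR_diff_right)
  qed
  ultimately obtain k where k: "AE t in lborel. u t - V t = k"
    using AE_const_if_weak_deriv_zero[of "\<lambda>t. u t - V t"] by blast
  show ?thesis
  proof (rule that[of "\<lambda>t. V t + k"])
    show "primitive_on a b (\<lambda>t. V t + k) v" for a b using V[of a b] by (auto simp: primitive_on_def)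
    show "AE t in lborel. u t = V t + k" using k by eventually_elim (auto simp: algebra_simps)
  qed
qed

section \<open>Velocity, angle and energy of a Sobolev curve\<close>

lemma primitive_on_cong_AE:
  fixes f v v' :: "real \<Rightarrow> 'a::euclidean_space"
  assumes f: "primitive_on a b f v" and v': "set_integrable lborel {a..b} v'" 
    and ae: "AE t in lborel. t \<in> {a..b} \<longrightarrow> v t = v' t"
  shows "primitive_on a b f v'"
  unfolding primitive_on_def
proof (intro conjI allI impI v')
  fix p q assume pq: "a \<le> p" "p \<le> q" "q \<le> b"
  have "f q - f p = (LINT t:{p..q}|lborel. v t)" by (rule primitive_onD[OF f pq])
  also have "\<dots> = (LINT t:{p..q}|lborel. v' t)"
    unfolding set_lebesgue_integral_def
  proof (rule integral_cong_AE)
    show "(\<lambda>t. indicator {p..q} t *\<^sub>R v t) \<in> borel_measurable lborel"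
      using primitive_onD(2)[OF f pq] by (auto simp: set_integrable_def)
    have "set_integrable lborel {p..q} v'" by (rule set_integrable_subset[OF v']) (use pq in auto)
    thus "(\<lambda>t. indicator {p..q} t *\<^sub>R v' t) \<in> borel_measurable lborel"
      by (auto simp: set_integrable_def)
    show "AE t in lborel. indicat_real {p..q} t *\<^sub>R v t = indicat_real {p..q} t *\<^sub>R v' t"
      using ae by eventually_elim (use pq in \<open>auto simp: indicator_def\<close>)
  qed
  finally show "f q - f p = (LINT t:{p..q}|lborel. v' t)" .
qed

lemma continuous_on_UNIV_Icc:
  fixes f :: "real \<Rightarrow> 'a::topological_space"
  assumes "\<And>a b. continuous_on {a..b} f"
  shows "continuous_on UNIV f"
proof -
  have "isCont f x" for x
    using assms[of "x - 1" "x + 1"] by (intro continuous_on_interior[of "{x - 1..x + 1}"]) auto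
  thus ?thesis by (simp add: continuous_at_imp_continuous_on)
qed

lemma primitive_on_has_vector_derivative:
  fixes f v :: "real \<Rightarrow> 'a::euclidean_space"
  assumes f: "\<And>a b. primitive_on a b f v" and v: "continuous_on UNIV v"
  shows "(f has_vector_derivative v x) (at x)"
proof -
  define l where "l = x - 1"
  have cv: "continuous_on A v" for A using v continuous_on_subset by blast
  have "((\<lambda>u. f l + integral {l..u} v) has_vector_derivative v x) (at x within {l..x + 1})"
    using has_vector_derivative_add[OF has_vector_derivative_const integral_has_vector_derivative[OF cv, of x l "x + 1"]]
    by (auto simp: l_def)
  hence D: "((\<lambda>u. f l + integral {l..u} v) has_vector_derivative v x) (at x)"
    by (subst (asm) at_within_Icc_at) (auto simp: l_def)
  show ?thesis
  proof (rule has_vector_derivative_transform_within_open[OF D, of "{l<..}"])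
    fix u assume "u \<in> {l<..}"
    hence "f u - f l = integral {l..u} v"
      using primitive_onD[OF f[of l u], of l u] by (simp add: set_borel_integral_eq_integral)
    thus "f l + integral {l..u} v = f u" by (simp add: algebra_simps)
  qed (auto simp: l_def)
qed

text \<open>The continuous representative of the first weak derivative is an honest derivative of \<open>\<gamma>\<close>, and it
  is in turn a primitive of the second weak derivative.\<close>
lemma W22_circle_velocity:
  assumes "\<gamma> \<in> W22_circle"
  obtains \<gamma>2 where "\<And>x. (\<gamma> has_vector_derivative velocity \<gamma> x) (at x)"
    "\<And>a b. primitive_on a b (velocity \<gamma>) \<gamma>2" "L2_on {0..1} \<gamma>2"
proof -
  obtain \<gamma>1 \<gamma>2 where c: "continuous_on UNIV \<gamma>" and 1: "is_weak_deriv UNIV \<gamma> \<gamma>1" and 2: "is_weak_deriv UNIV \<gamma>1 \<gamma>2"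
    and L2: "L2_on {0..1} \<gamma>2" using assms by (auto simp: W22_circle_def)
  obtain V0 where V0: "\<And>a b. primitive_on a b V0 \<gamma>1" "AE t in lborel. \<gamma> t = V0 t"
    using is_weak_deriv_imp_primitive[OF 1] by blast
  obtain V1 where V1: "\<And>a b. primitive_on a b V1 \<gamma>2" "AE t in lborel. \<gamma>1 t = V1 t"
    using is_weak_deriv_imp_primitive[OF 2] by blast
  have cV0: "continuous_on UNIV V0" by (rule continuous_on_UNIV_Icc[OF primitive_on_continuous[OF V0(1)]])
  have cV1: "continuous_on UNIV V1" by (rule continuous_on_UNIV_Icc[OF primitive_on_continuous[OF V1(1)]])
  have "\<gamma> t = V0 t" for t
  proof -
    have "closed {t. \<gamma> t = V0 t}" using c cV0 by (intro closed_Collect_eq)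
    moreover have "AE t in lebesgue. t \<in> {t. \<gamma> t = V0 t}" using V0(2) by (auto intro: AE_completion)
    ultimately show ?thesis using mem_closed_if_AE_lebesgue by blast
  qed
  hence "\<gamma> = V0" by auto
  moreover have "primitive_on a b V0 V1" for a b
    by (rule primitive_on_cong_AE[OF V0(1) borel_integrable_atLeastAtMost']) 
       (use V1(2) cV1 in \<open>auto elim: eventually_mono intro: continuous_on_subset\<close>)
  ultimately have D: "(\<gamma> has_vector_derivative V1 x) (at x)" for x
    using primitive_on_has_vector_derivative[OF _ cV1, of \<gamma>] by blast
  hence v: "velocity \<gamma> x = V1 x" for x by (rule vector_derivative_at)
  show ?thesis by (rule that[of \<gamma>2]) (use D V1(1) L2 in \<open>simp_all only: v\<close>)
qed

lemma primitive_on_linear: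
  fixes f v :: "real \<Rightarrow> 'a::euclidean_space" and T :: "'a \<Rightarrow> 'b::euclidean_space"
  assumes T: "bounded_linear T" and f: "primitive_on a b f v"
  shows "primitive_on a b (\<lambda>t. T (f t)) (\<lambda>t. T (v t))"
proof -
  interpret T: bounded_linear T by fact
  have "set_integrable lborel {a..b} (\<lambda>t. T (v t))"
    using integrable_bounded_linear[OF T, of lborel "\<lambda>t. indicator {a..b} t *\<^sub>R v t"] f
    by (simp add: primitive_on_def set_integrable_def T.scaleR)
  moreover have "T (f q) - T (f p) = (LINT t:{p..q}|lborel. T (v t))" if "a \<le> p" "p \<le> q" "q \<le> b" for p q
    using integral_bounded_linear[OF T, of lborel "\<lambda>t. indicator {p..q} t *\<^sub>R v t"] primitive_onD[OF f that]
    by (simp add: set_integrable_def set_lebesgue_integral_def T.scaleR T.diff[symmetric])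
  ultimately show ?thesis by (auto simp: primitive_on_def)
qed

text \<open>The imaginary part of \<open>lg\<close> is a tangent angle if \<open>z\<close> is the velocity. A continuous logarithm exists
  because an interval is contractible. Its increments are those of \<open>z\<close> divided by \<open>z\<close> up to higher
  order, since \<open>exp u - 1 = u + o(u)\<close>.\<close>
lemma primitive_on_log:
  fixes z w :: "real \<Rightarrow> complex"
  assumes z: "primitive_on a b z w" and nz: "\<And>t. t \<in> {a..b} \<Longrightarrow> z t \<noteq> 0" and ab: "a \<le> b"
  obtains lg where "\<And>t. t \<in> {a..b} \<Longrightarrow> z t = exp (lg t)" "primitive_on a b lg (\<lambda>t. inverse (z t) * w t)"
proof -
  have cz: "continuous_on {a..b} z" by (rule primitive_on_continuous[OF z])
  obtain lg where clg: "continuous_on {a..b} lg" and lg: "\<And>t. t \<in> {a..b} \<Longrightarrow> z t = exp (lg t)"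
    using continuous_logarithm_on_contractible[OF cz convex_imp_contractible nz] by auto
  obtain t0 where t0: "t0 \<in> {a..b}" "\<And>t. t \<in> {a..b} \<Longrightarrow> norm (z t0) \<le> norm (z t)"
    using continuous_attains_inf[of "{a..b}" "\<lambda>t. norm (z t)"] continuous_on_norm[OF cz] ab
    by (metis atLeastatMost_empty_iff2 compact_Icc)
  define \<mu> where "\<mu> = norm (z t0)"
  have \<mu>: "\<mu> > 0" "\<And>t. t \<in> {a..b} \<Longrightarrow> \<mu> \<le> norm (z t)" using t0 nz by (auto simp: \<mu>_def)
  have "primitive_on a b lg (\<lambda>t. inverse (z t) * w t)"
  proof (rule primitive_on_chain[OF bounded_bilinear_mult z])
    show "continuous_on {a..b} (\<lambda>t. inverse (z t))" using nz by (intro continuous_intros cz) auto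
    fix e :: real assume e: "e > 0"
    \<comment> \<open>The bound \<open>1 / 2\<close> makes \<open>norm u\<close> at most twice \<open>norm (exp u - 1)\<close>; the other one absorbs this factor
      and the lower bound \<open>\<mu>\<close> of the norm of \<open>z\<close>.\<close>
    define \<eta> where "\<eta> = min (1 / 2) (e * \<mu> / 2)"
    have \<eta>: "\<eta> > 0" "\<eta> \<le> 1 / 2" "\<eta> \<le> e * \<mu> / 2" using e \<mu> by (auto simp: \<eta>_def)
    have "((\<lambda>u::complex. exp u) has_derivative (\<lambda>h. h)) (at 0)"
      using DERIV_exp[of "0::complex"] 
      by (simp add: has_field_derivative_def lambda_one[symmetric])
    then obtain r where r: "r > 0" "\<And>u::complex. norm u < r \<Longrightarrow> norm (exp u - 1 - u) \<le> \<eta> * norm u"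
      using \<eta>(1) unfolding has_derivative_at_alt by fastforce
    obtain d where d: "d > 0" "\<And>p t. p \<in> {a..b} \<Longrightarrow> t \<in> {a..b} \<Longrightarrow> \<bar>t - p\<bar> < d \<Longrightarrow> norm (lg t - lg p) < r"
      using continuous_on_Icc_uniformD[OF clg r(1)] by auto
    show "\<exists>d>0. \<forall>p q. a \<le> p \<longrightarrow> p \<le> q \<longrightarrow> q \<le> b \<longrightarrow> q - p < d \<longrightarrow>
           norm (lg q - lg p - inverse (z p) * (z q - z p)) \<le> e * norm (z q - z p)"
    proof (intro exI[of _ d] conjI allI impI d(1))
      fix p q assume pq: "a \<le> p" "p \<le> q" "q \<le> b" "q - p < d"
      define u where "u = lg q - lg p"
      have zp: "z p \<noteq> 0" "\<mu> \<le> norm (z p)" using nz[of p] \<mu>(2)[of p] pq by auto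
      have eu: "inverse (z p) * (z q - z p) = exp u - 1"
        using zp pq lg[of p] lg[of q] by (simp add: u_def exp_diff field_simps)
      have "norm u < r" unfolding u_def using pq by (intro d) auto
      hence 1: "norm (exp u - 1 - u) \<le> \<eta> * norm u" by (rule r)
      also have "\<dots> \<le> 1 / 2 * norm u" using \<eta> by (intro mult_right_mono) auto
      finally have "norm u \<le> 2 * norm (exp u - 1)"
        using norm_triangle_ineq4[of "exp u - 1" "exp u - 1 - u"] by simp
      hence "\<eta> * norm u \<le> \<eta> * (2 * norm (exp u - 1))" using \<eta> by (intro mult_left_mono) auto
      also have "\<dots> \<le> (e * \<mu> / 2) * (2 * norm (exp u - 1))" using \<eta> by (intro mult_right_mono) auto
      also have "\<dots> = e * (\<mu> * norm (exp u - 1))" by simp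
      also have "\<dots> \<le> e * (norm (z p) * norm (exp u - 1))" using zp e by (intro mult_left_mono mult_right_mono) auto
      also have "norm (z p) * norm (exp u - 1) = norm (z q - z p)"
        unfolding eu[symmetric] norm_mult[symmetric] using zp(1) by (simp add: mult.assoc[symmetric])
      finally show "norm (lg q - lg p - inverse (z p) * (z q - z p)) \<le> e * norm (z q - z p)"
        using 1 unfolding eu u_def[symmetric] by (simp add: norm_minus_commute)
    qed
  qed
  thus ?thesis using lg by (intro that[of lg]) auto
qed

lemma primitive_on_real_chain:
  fixes \<theta> \<omega> :: "real \<Rightarrow> real"
  assumes \<theta>: "primitive_on a b \<theta> \<omega>" and \<Phi>: "\<And>x. (\<Phi> has_real_derivative G x) (at x)"
    and G: "continuous_on UNIV G"
  shows "primitive_on a b (\<lambda>t. \<Phi> (\<theta> t)) (\<lambda>t. G (\<theta> t) * \<omega> t)"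
proof (rule primitive_on_chain[OF bounded_bilinear_mult \<theta>])
  have c: "continuous_on {a..b} \<theta>" by (rule primitive_on_continuous[OF \<theta>])
  show "continuous_on {a..b} (\<lambda>t. G (\<theta> t))"
    by (rule continuous_on_compose2[OF G c]) auto
  have "compact (\<theta> ` {a..b})" by (intro compact_continuous_image c) auto
  then obtain r where "\<theta> ` {a..b} \<subseteq> {-r..r}"
    using bounded_subset_cbox_symmetric[OF compact_imp_bounded, of "\<theta> ` {a..b}"] by auto
  hence r: "\<theta> t \<in> {-r..r}" if "t \<in> {a..b}" for t using that by blast
  fix e :: real assume e: "e > 0"
  obtain \<delta> where \<delta>: "\<delta> > 0" "\<And>p t. p \<in> {-r..r} \<Longrightarrow> t \<in> {-r..r} \<Longrightarrow> \<bar>t - p\<bar> < \<delta> \<Longrightarrow> norm (G t - G p) < e"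
    using continuous_on_Icc_uniformD[OF continuous_on_subset[OF G] e, of "-r" r] by auto
  obtain d where d: "d > 0" "\<And>p t. p \<in> {a..b} \<Longrightarrow> t \<in> {a..b} \<Longrightarrow> \<bar>t - p\<bar> < d \<Longrightarrow> norm (\<theta> t - \<theta> p) < \<delta>"
    using continuous_on_Icc_uniformD[OF c \<delta>(1)] by auto
  have mvt: "norm (\<Phi> y - \<Phi> x - G x * (y - x)) \<le> e * norm (y - x)"
    if x: "x \<in> {-r..r}" and y: "y \<in> {-r..r}" and xy: "\<bar>y - x\<bar> < \<delta>" for x y
  proof -
    have "\<exists>s\<in>{-r..r}. \<bar>s - x\<bar> < \<delta> \<and> \<Phi> y - \<Phi> x = G s * (y - x)"
    proof -
      consider "x < y" | "y < x" | "x = y" by linarith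
      thus ?thesis
      proof cases
        case 1
        from MVT2[OF 1, of \<Phi> G] \<Phi> obtain s where "x < s" "s < y" "\<Phi> y - \<Phi> x = (y - x) * G s" by blast
        thus ?thesis using x y xy by (intro bexI[of _ s]) auto
      next
        case 2
        from MVT2[OF 2, of \<Phi> G] \<Phi> obtain s where "y < s" "s < x" "\<Phi> x - \<Phi> y = (x - y) * G s" by blast
        thus ?thesis using x y xy by (intro bexI[of _ s]) (auto simp: algebra_simps)
      next
        case 3
        thus ?thesis using x \<delta>(1) by (intro bexI[of _ x]) auto
      qed
    qed
    then obtain s where s: "s \<in> {-r..r}" "\<bar>s - x\<bar> < \<delta>" "\<Phi> y - \<Phi> x = G s * (y - x)" by blast
    have "\<Phi> y - \<Phi> x - G x * (y - x) = (G s - G x) * (y - x)" using s(3) by (simp add: algebra_simps)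
    also have "norm \<dots> \<le> e * norm (y - x)"
      using \<delta>(2)[OF x s(1,2)] by (simp add: abs_mult mult_right_mono)
    finally show ?thesis .
  qed
  show "\<exists>d>0. \<forall>p q. a \<le> p \<longrightarrow> p \<le> q \<longrightarrow> q \<le> b \<longrightarrow> q - p < d \<longrightarrow>
     norm (\<Phi> (\<theta> q) - \<Phi> (\<theta> p) - G (\<theta> p) * (\<theta> q - \<theta> p)) \<le> e * norm (\<theta> q - \<theta> p)"
  proof (intro exI[of _ d] conjI allI impI d(1))
    fix p q assume pq: "a \<le> p" "p \<le> q" "q \<le> b" "q - p < d"
    show "norm (\<Phi> (\<theta> q) - \<Phi> (\<theta> p) - G (\<theta> p) * (\<theta> q - \<theta> p)) \<le> e * norm (\<theta> q - \<theta> p)"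
      using d(2)[of p q] pq by (intro mvt r) auto
  qed
qed

lemma abs_increment_le:
  fixes \<Psi> v :: "real \<Rightarrow> real"
  assumes "primitive_on a b \<Psi> v" "p \<in> {a..b}" "q \<in> {a..b}"
  shows "\<bar>\<Psi> q - \<Psi> p\<bar> \<le> (LINT t:{a..b}|lborel. \<bar>v t\<bar>)"
proof -
  have *: "\<bar>\<Psi> q - \<Psi> p\<bar> \<le> (LINT t:{a..b}|lborel. \<bar>v t\<bar>)" if "a \<le> p" "p \<le> q" "q \<le> b" for p q
  proof -
    note P = primitive_onD[OF assms(1) that]
    have ab: "set_integrable lborel {a..b} (\<lambda>t. \<bar>v t\<bar>)" 
      using assms(1) by (intro set_integrable_abs) (simp add: primitive_on_def)
    have "\<bar>\<Psi> q - \<Psi> p\<bar> \<le> (LINT t:{p..q}|lborel. \<bar>v t\<bar>)"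
      using norm_set_integral_le[OF P(2)] P(1) by simp
    also have "\<dots> \<le> (LINT t:{a..b}|lborel. \<bar>v t\<bar>)"
      unfolding set_lebesgue_integral_def
      using ab set_integrable_abs[OF P(2)] that
      by (intro integral_mono) (auto simp: set_integrable_def indicator_def)
    finally show ?thesis .
  qed
  show ?thesis
  proof (cases "p \<le> q")
    case True thus ?thesis using * assms by auto
  next
    case False thus ?thesis using *[of q p] assms by (auto simp: abs_minus_commute)
  qed
qed

lemma set_integral_open_closed:
  fixes f :: "real \<Rightarrow> 'a::{banach, second_countable_topology}"
  shows "(LINT x:{a<..<b}|lborel. f x) = (LINT x:{a..b}|lborel. f x)"
  by (rule set_integral_discrete_difference[of "{a, b}"]) auto

text \<open>Local integrability gives measurability on compact subintervals, and these exhaust the open one.\<close>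
lemma locally_integrable_borel_measurable:
  fixes w :: "real \<Rightarrow> 'a::euclidean_space"
  assumes "locally_integrable {a<..<b} w"
  shows "(\<lambda>x. indicat_real {a<..<b} x *\<^sub>R w x) \<in> borel_measurable lborel"
proof (rule borel_measurable_LIMSEQ_metric)
  let ?I = "\<lambda>n::nat. {a + 1 / real (Suc n)..b - 1 / real (Suc n)}"
  show "(\<lambda>x. indicat_real (?I n) x *\<^sub>R w x) \<in> borel_measurable lborel" for n
  proof -
    have "1 / real (Suc n) > 0" by simp
    hence "?I n \<subseteq> {a<..<b}" unfolding subset_iff atLeastAtMost_iff greaterThanLessThan_iff by (auto simp only:)
    hence "set_integrable lborel (?I n) w" using assms by (auto simp: locally_integrable_def)
    thus ?thesis by (auto simp: set_integrable_def)
  qed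
  fix x
  have lim: "(\<lambda>n. 1 / real (Suc n)) \<longlonglongrightarrow> 0" using LIMSEQ_inverse_real_of_nat by (simp add: inverse_eq_divide)
  show "(\<lambda>n. indicat_real (?I n) x *\<^sub>R w x) \<longlonglongrightarrow> indicat_real {a<..<b} x *\<^sub>R w x"
  proof (rule tendsto_eventually)
    show "\<forall>\<^sub>F n in sequentially. indicat_real (?I n) x *\<^sub>R w x = indicat_real {a<..<b} x *\<^sub>R w x"
    proof (cases "x \<in> {a<..<b}")
      case True
      hence "min (x - a) (b - x) > 0" by auto
      from order_tendstoD(2)[OF lim this] show ?thesis
      proof eventually_elim
        case (elim n)
        hence "x \<in> ?I n" unfolding atLeastAtMost_iff by linarith
        thus ?case using True by simp
      qed
    next
      case False
      have "x \<notin> ?I n" for n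
      proof
        assume "x \<in> ?I n"
        moreover have "1 / real (Suc n) > 0" by simp
        ultimately show False using False unfolding atLeastAtMost_iff greaterThanLessThan_iff by linarith
      qed
      thus ?thesis using False by (intro always_eventually allI) simp
    qed
  qed
qed

text \<open>Any density of the velocity may stand in for the chosen weak derivative. Since Lebesgue-Borel measure
  is not complete, equality almost everywhere is not enough for this, and both integrands are shown
  to be measurable.\<close>
lemma elastic_energy_eq:
  assumes prim: "\<And>a b. primitive_on a b (velocity \<gamma>) acc"
  shows "elastic_energy a b \<gamma> = (LINT x:{a<..<b}|lborel.
    (det (vector [velocity \<gamma> x, acc x] :: real^2^2) / norm (velocity \<gamma> x) ^ 3)\<^sup>2 * norm (velocity \<gamma> x))"
proof -
  let ?S = "{a<..<b}"
  let ?k = "\<lambda>w x. (det (vector [velocity \<gamma> x, w] :: real^2^2) / norm (velocity \<gamma> x) ^ 3)\<^sup>2 * norm (velocity \<gamma> x)"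
  have wd: "is_weak_deriv ?S (velocity \<gamma>) acc" by (rule primitive_on_imp_is_weak_deriv[OF prim])
  hence "is_weak_deriv ?S (velocity \<gamma>) (weak_deriv ?S (velocity \<gamma>))"
    unfolding weak_deriv_def by (rule someI[of "is_weak_deriv ?S (velocity \<gamma>)"])
  hence l: "locally_integrable ?S acc" "locally_integrable ?S (weak_deriv ?S (velocity \<gamma>))"
    using wd by (auto simp: is_weak_deriv_def)
  have cv: "continuous_on UNIV (velocity \<gamma>)"
    by (rule continuous_on_UNIV_Icc[OF primitive_on_continuous[OF prim]])
  have mv: "velocity \<gamma> \<in> borel_measurable lborel"
    using borel_measurable_continuous_onI[OF cv] by simp
  have meas: "(\<lambda>x. indicator ?S x *\<^sub>R ?k (w x) x) \<in> borel_measurable lborel" if "locally_integrable ?S w" for w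
  proof -
    have m: "(\<lambda>x. indicat_real ?S x *\<^sub>R w x) \<in> borel_measurable lborel"
      by (rule locally_integrable_borel_measurable[OF that])
    have comp: "(\<lambda>x. f x $ i) \<in> borel_measurable lborel" if "f \<in> borel_measurable lborel" for f :: "real \<Rightarrow> real^2" and i
      using borel_measurable_inner[OF that borel_measurable_const, of "axis i 1"] by (simp add: inner_axis)
    have "(\<lambda>x. ?k (indicat_real ?S x *\<^sub>R w x) x) \<in> borel_measurable lborel"
      unfolding det_2 vector_2 
      by (intro borel_measurable_times borel_measurable_power borel_measurable_divide borel_measurable_diff 
          measurable_compose[OF mv borel_measurable_norm] comp mv m)
    moreover have "(\<lambda>x. ?k (indicat_real ?S x *\<^sub>R w x) x) = (\<lambda>x. indicator ?S x *\<^sub>R ?k (w x) x)"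
      by (auto simp: indicator_def det_2)
    ultimately show ?thesis by simp
  qed
  have "elastic_energy a b \<gamma> = (LINT x:?S|lborel. ?k (weak_deriv ?S (velocity \<gamma>) x) x)"
    unfolding elastic_energy_def signed_curvature_def power2_abs ..
  also have "\<dots> = (LINT x:?S|lborel. ?k (acc x) x)"
    unfolding set_lebesgue_integral_def
  proof (rule integral_cong_AE[OF meas[OF l(2)] meas[OF l(1)]])
    show "AE x in lborel. indicat_real ?S x *\<^sub>R ?k (weak_deriv ?S (velocity \<gamma>) x) x = indicat_real ?S x *\<^sub>R ?k (acc x) x"
      using weak_deriv_eq[OF prim open_greaterThanLessThan, of a b]
      by eventually_elim (auto simp: indicator_def)
  qed
  finally show ?thesis .
qed

section \<open>Complete elliptic integrals and the modulus of the figure eight\<close>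

abbreviation ell_delta :: "real \<Rightarrow> real \<Rightarrow> real" where
  "ell_delta m u \<equiv> sqrt (1 - m * (sin u)\<^sup>2)"

lemma ell_delta_arg_pos: "0 \<le> m \<Longrightarrow> m < 1 \<Longrightarrow> 1 - m * (sin u)\<^sup>2 > (0::real)"
proof -
  assume m: "0 \<le> m" "m < 1"
  have "m * (sin u)\<^sup>2 \<le> m * 1" using m by (intro mult_left_mono) (auto simp: abs_square_le_1)
  thus ?thesis using m by simp
qed

lemma ell_delta_pos: "0 \<le> m \<Longrightarrow> m < 1 \<Longrightarrow> ell_delta m u > 0"
  using ell_delta_arg_pos[of m u] by simp

lemma ell_delta_le_1: "0 \<le> m \<Longrightarrow> ell_delta m u \<le> 1"
  by simp

lemma
  assumes "0 \<le> m" "m < 1"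
  shows continuous_on_ell_delta: "continuous_on A (ell_delta m)"
    and continuous_on_inverse_ell_delta: "continuous_on A (\<lambda>t. 1 / ell_delta m t)"
proof -
  show c: "continuous_on A (ell_delta m)" by (intro continuous_intros)
  have "ell_delta m t \<noteq> 0" for t using ell_delta_pos[OF assms, of t] by linarith
  thus "continuous_on A (\<lambda>t. 1 / ell_delta m t)" by (intro continuous_on_divide continuous_on_const c) blast
qed

lemma interval_integral_has_derivative:
  fixes f :: "real \<Rightarrow> real"
  assumes "continuous_on UNIV f"
  shows "((\<lambda>x. LBINT t=0..x. f t) has_real_derivative f x) (at x)"
proof -
  let ?a = "- \<bar>x\<bar> - 1" and ?b = "\<bar>x\<bar> + 1"
  have "((\<lambda>u. LBINT y=ereal 0..u. f y) has_vector_derivative f x) (at x within {?a..?b})"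
    by (rule interval_integral_FTC2) (use assms continuous_on_subset in auto)
  moreover have "at x within {?a..?b} = at x" by (rule at_within_Icc_at) auto
  ultimately show ?thesis
    unfolding has_real_derivative_iff_has_vector_derivative zero_ereal_def by (simp only:)
qed

lemma ellF_has_derivative:
  assumes "0 \<le> m" "m < 1"
  shows "((\<lambda>x. ellF x m) has_real_derivative 1 / ell_delta m x) (at x)"
  unfolding ellF_def by (rule interval_integral_has_derivative[OF continuous_on_inverse_ell_delta[OF assms]])

lemma ellE_has_derivative:
  assumes "0 \<le> m" "m < 1"
  shows "((\<lambda>x. ellE x m) has_real_derivative ell_delta m x) (at x)"
  unfolding ellE_def by (intro interval_integral_has_derivative continuous_intros)

lemma ellF_0 [simp]: "ellF 0 m = 0" and ellE_0 [simp]: "ellE 0 m = 0"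
proof -
  have "einterval (ereal 0) (ereal 0) = {}" by (auto simp: einterval_def)
  thus "ellF 0 m = 0" "ellE 0 m = 0"
    unfolding ellF_def ellE_def zero_ereal_def
    by (simp_all add: interval_lebesgue_integral_def set_lebesgue_integral_def)
qed

text \<open>Reflection in \<open>0\<close> and in \<open>\<pi> / 2\<close> reduces everything to a quarter period.\<close>
lemma primitive_symmetries:
  fixes F f :: "real \<Rightarrow> real"
  assumes F: "\<And>x. (F has_real_derivative f x) (at x)" and F0: "F 0 = 0"
    and even: "\<And>x. f (- x) = f x" and refl: "\<And>x. f (pi - x) = f x"
  shows "F (- x) = - F x" "F (2 * pi) = 4 * F (pi / 2)"
proof -
  have 1: "F (- x) + F x = F (- 0) + F 0" for x
    by (rule DERIV_isconst_all) (auto intro!: derivative_eq_intros DERIV_chain2[OF F] F simp: even)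
  show "F (- x) = - F x" using 1[of x] F0 by simp
  have per: "f (x + pi) = f x" for x using refl[of "- x"] even[of x] by (simp add: add.commute)
  have 2: "F (x + pi) - F x = F (0 + pi) - F 0" for x
    by (rule DERIV_isconst_all) (auto intro!: derivative_eq_intros DERIV_chain2[OF F] F simp: per)
  have 3: "F (pi - x) + F x = F (pi - 0) + F 0" for x
    by (rule DERIV_isconst_all) (auto intro!: derivative_eq_intros DERIV_chain2[OF F] F simp: refl)
  have 4: "F pi = 2 * F (pi / 2)" using 3[of "pi / 2"] F0 by simp
  show "F (2 * pi) = 4 * F (pi / 2)" using 2[of pi] 4 F0 by (simp add: mult.commute)
qed

lemma
  assumes "0 \<le> m" "m < 1"
  shows ellF_minus: "ellF (- x) m = - ellF x m" and ellF_2pi: "ellF (2 * pi) m = 4 * complete_K m"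
    and ellE_minus: "ellE (- x) m = - ellE x m" and ellE_2pi: "ellE (2 * pi) m = 4 * complete_E m"
proof -
  note F = primitive_symmetries[of "\<lambda>x. ellF x m", OF ellF_has_derivative[OF assms] ellF_0]
    and E = primitive_symmetries[of "\<lambda>x. ellE x m", OF ellE_has_derivative[OF assms] ellE_0]
  show "ellF (- x) m = - ellF x m" by (rule F(1)) auto
  show "ellE (- x) m = - ellE x m" by (rule E(1)) auto
  show "ellF (2 * pi) m = 4 * complete_K m" unfolding complete_K_def by (rule F(2)) auto
  show "ellE (2 * pi) m = 4 * complete_E m" unfolding complete_E_def by (rule E(2)) auto
qed

lemma
  assumes "0 \<le> m" "m < 1"
  shows complete_K_integral: "complete_K m = integral {0..pi / 2} (\<lambda>t. 1 / ell_delta m t)"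
    and complete_E_integral: "complete_E m = integral {0..pi / 2} (ell_delta m)"
proof -
  note c = continuous_on_inverse_ell_delta[OF assms] continuous_on_ell_delta[OF assms]
  have "set_integrable lborel {0..pi / 2} (\<lambda>t. 1 / ell_delta m t)" "set_integrable lborel {0..pi / 2} (ell_delta m)"
    by (rule borel_integrable_atLeastAtMost'[OF c(1)], rule borel_integrable_atLeastAtMost'[OF c(2)])
  thus "complete_K m = integral {0..pi / 2} (\<lambda>t. 1 / ell_delta m t)" 
    "complete_E m = integral {0..pi / 2} (ell_delta m)"
    using interval_integral_eq_integral[of 0 "pi / 2" "\<lambda>t. 1 / ell_delta m t"]
      interval_integral_eq_integral[of 0 "pi / 2" "ell_delta m"]
    unfolding complete_K_def complete_E_def ellF_def ellE_def zero_ereal_def by simp_all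
qed

text \<open>The integrand of \<open>2 E(m) - K(m)\<close>. It is nonincreasing in \<open>m\<close> at every point and strictly
  decreasing at \<open>\<pi> / 2\<close>, which gives uniqueness of the root of \<open>2 E - K\<close>.\<close>
definition EK_gap :: "real \<Rightarrow> real \<Rightarrow> real" where
  "EK_gap m t = 2 * ell_delta m t - 1 / ell_delta m t"

lemma complete_gap_integral:
  assumes "0 \<le> m" "m < 1"
  shows "2 * complete_E m - complete_K m = integral {0..pi / 2} (EK_gap m)"
proof -
  have "(\<lambda>t. 2 * ell_delta m t) integrable_on {0..pi / 2}" "(\<lambda>t. 1 / ell_delta m t) integrable_on {0..pi / 2}"
    by (intro integrable_continuous_real continuous_on_mult continuous_on_const
        continuous_on_inverse_ell_delta continuous_on_ell_delta assms)+
  thus ?thesis unfolding EK_gap_def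
    by (simp add: complete_K_integral[OF assms] complete_E_integral[OF assms] integral_diff)
qed

lemma EK_gap_mono:
  assumes "0 \<le> m" "m \<le> m'" "m' < 1"
  shows "EK_gap m' t \<le> EK_gap m t"
proof -
  have p: "ell_delta m' t > 0" "ell_delta m t > 0" using ell_delta_pos[of m' t] ell_delta_pos[of m t] assms by linarith+
  have l: "ell_delta m' t \<le> ell_delta m t" using assms by (intro real_sqrt_le_mono diff_left_mono mult_right_mono) auto
  hence "1 / ell_delta m t \<le> 1 / ell_delta m' t" using p by (intro divide_left_mono) auto
  thus ?thesis using l unfolding EK_gap_def by linarith
qed

lemma complete_gap_strict:
  assumes "0 \<le> m" "m < m'" "m' < 1"
  shows "2 * complete_E m' - complete_K m' < 2 * complete_E m - complete_K m"
proof -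
  have m: "m < 1" "0 \<le> m'" using assms by auto
  have c: "continuous_on {0..pi / 2} (EK_gap k)" if "0 \<le> k" "k < 1" for k
  proof -
    show ?thesis unfolding EK_gap_def
      by (intro continuous_on_diff continuous_on_mult continuous_on_const
        continuous_on_inverse_ell_delta continuous_on_ell_delta that)
  qed
  let ?g = "\<lambda>t. EK_gap m t - EK_gap m' t"
  have cg: "continuous_on {0..pi / 2} ?g" using c assms m by (intro continuous_intros) auto
  have nn: "?g t \<ge> 0" for t using EK_gap_mono[of m m' t] assms by simp
  have "integral {0..pi / 2} ?g \<noteq> 0"
  proof
    assume "integral {0..pi / 2} ?g = 0"
    hence "\<forall>t\<in>{0..pi / 2}. ?g t = 0"
      using integral_cbox_eq_0_iff[of 0 "pi / 2" ?g] cg nn pi_gt_zero unfolding cbox_interval by simp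
    hence "?g (pi / 2) = 0" by (rule bspec) auto
    hence "EK_gap m (pi / 2) = EK_gap m' (pi / 2)" by simp
    hence eq: "2 * sqrt (1 - m) - 1 / sqrt (1 - m) = 2 * sqrt (1 - m') - 1 / sqrt (1 - m')"
      by (simp add: EK_gap_def)
    have "sqrt (1 - m') < sqrt (1 - m)" "sqrt (1 - m') > 0" using assms by auto
    moreover from this have "1 / sqrt (1 - m) < 1 / sqrt (1 - m')" by (intro divide_strict_left_mono) auto
    ultimately show False using eq by linarith
  qed
  moreover have "integral {0..pi / 2} ?g \<ge> 0" by (intro integral_nonneg integrable_continuous_real cg nn)
  moreover have "integral {0..pi / 2} ?g = (2 * complete_E m - complete_K m) - (2 * complete_E m' - complete_K m')"
    using assms m by (simp add: complete_gap_integral integral_diff integrable_continuous_real c)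
  ultimately show ?thesis by linarith
qed

lemma complete_gap_continuous:
  assumes "M < 1"
  shows "continuous_on {0..M} (\<lambda>m. 2 * complete_E m - complete_K m)"
proof -
  have "continuous_on ({0..M} \<times> cbox 0 (pi / 2)) (\<lambda>(m, t). EK_gap m t)"
  proof -
    have "1 - fst x * (sin (snd x))\<^sup>2 \<noteq> 0" if "x \<in> {0..M} \<times> cbox 0 (pi / 2)" for x
      using ell_delta_arg_pos[of "fst x" "snd x"] that assms by auto
    thus ?thesis unfolding EK_gap_def case_prod_unfold by (intro continuous_intros) auto
  qed
  from integral_continuous_on_param[OF this]
  have "continuous_on {0..M} (\<lambda>m. integral {0..pi / 2} (EK_gap m))" by simp
  thus ?thesis
    by (rule continuous_on_eq) (use assms in \<open>auto simp: complete_gap_integral\<close>)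
qed

text \<open>\<open>K\<close> diverges logarithmically at \<open>1\<close>: with \<open>M = 1 - \<delta>\<^sup>2\<close> the integrand of \<open>K(M)\<close> is at least
  \<open>1 / (\<delta> + \<pi> / 2 - t)\<close>. The value of \<open>\<delta>\<close> is the one for which this lower bound integrates to exactly
  \<open>\<pi>\<close>, and \<open>\<pi>\<close> is an upper bound of \<open>2 E(M)\<close>.\<close>
lemma complete_gap_nonpos_near_1:
  obtains M where "0 < M" "M < 1" "2 * complete_E M - complete_K M \<le> 0"
proof -
  define \<delta> where "\<delta> = pi / (2 * (exp pi - 1))"
  have ep: "exp pi - 1 \<ge> pi" using exp_ge_add_one_self[of pi] by linarith
  have "pi < pi + pi" by simp
  also have "\<dots> \<le> (exp pi - 1) + (exp pi - 1)" by (intro add_mono ep)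
  finally have "pi < 2 * (exp pi - 1)" by simp
  hence \<delta>: "\<delta> > 0" "\<delta> < 1"
    using pi_gt_zero unfolding \<delta>_def by (simp_all add: divide_less_eq_1)
  define M where "M = 1 - \<delta>\<^sup>2"
  have "\<delta>\<^sup>2 < 1" using \<delta> by (simp add: power_less_one_iff abs_square_less_1)
  hence M: "0 < M" "M < 1" using \<delta> by (auto simp: M_def)
  have K: "complete_K M \<ge> pi"
  proof -
    have "((\<lambda>t. 1 / (\<delta> + pi / 2 - t)) has_integral (- ln (\<delta> + pi / 2 - pi / 2) - (- ln (\<delta> + pi / 2 - 0)))) {0..pi / 2}"
      by (rule fundamental_theorem_of_calculus)
         (use \<delta> in \<open>auto intro!: derivative_eq_intros simp: has_real_derivative_iff_has_vector_derivative[symmetric] field_simps\<close>)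
    moreover have "- ln (\<delta> + pi / 2 - pi / 2) - (- ln (\<delta> + pi / 2 - 0)) = pi"
    proof -
      have "\<delta> + pi / 2 = exp pi * \<delta>" using ep pi_gt_zero by (simp add: \<delta>_def field_simps)
      hence "ln (\<delta> + pi / 2) = pi + ln \<delta>" using \<delta> by (simp add: ln_mult)
      thus ?thesis by simp
    qed
    ultimately have h: "((\<lambda>t. 1 / (\<delta> + pi / 2 - t)) has_integral pi) {0..pi / 2}" by simp
    have "pi \<le> integral {0..pi / 2} (\<lambda>t. 1 / ell_delta M t)"
    proof (rule has_integral_le[OF h integrable_integral])
      show "(\<lambda>t. 1 / ell_delta M t) integrable_on {0..pi / 2}"
        using M by (intro integrable_continuous_real continuous_on_inverse_ell_delta) auto
      fix t assume t: "t \<in> {0..pi / 2}"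
      have "cos t \<le> pi / 2 - t" using sin_x_le_x[of "pi / 2 - t"] t by (simp add: cos_sin_eq)
      moreover have c0: "cos t \<ge> 0" using t by (intro cos_ge_zero) auto
      moreover have "ell_delta M t \<le> \<delta> + cos t"
      proof (rule real_le_lsqrt)
        have "1 - M * (sin t)\<^sup>2 = (cos t)\<^sup>2 + \<delta>\<^sup>2 * (sin t)\<^sup>2"
          by (simp add: M_def cos_squared_eq algebra_simps)
        also have "\<dots> \<le> (cos t)\<^sup>2 + \<delta>\<^sup>2 * 1"
          by (intro add_left_mono mult_left_mono) (auto simp: abs_square_le_1)
        also have "\<dots> \<le> (\<delta> + cos t)\<^sup>2" using \<delta> c0 by (simp add: power2_sum)
        finally show "1 - M * (sin t)\<^sup>2 \<le> (\<delta> + cos t)\<^sup>2" .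
      qed (use \<delta> c0 in auto)
      ultimately show "1 / (\<delta> + pi / 2 - t) \<le> 1 / ell_delta M t"
        using \<delta> t ell_delta_pos[of M t] M by (intro divide_left_mono) auto
    qed
    thus ?thesis using M by (simp add: complete_K_integral)
  qed
  have E: "complete_E M \<le> pi / 2"
  proof -
    have "integral {0..pi / 2} (ell_delta M) \<le> integral {0..pi / 2} (\<lambda>_. 1)"
      using M by (intro integral_le integrable_continuous_real continuous_intros ell_delta_le_1) auto
    thus ?thesis using M by (simp add: complete_E_integral)
  qed
  show ?thesis by (rule that[OF M]) (use E K in linarith)
qed

lemma m_star_ex1: "\<exists>!m. 0 < m \<and> m < 1 \<and> 2 * complete_E m - complete_K m = 0"
proof -
  obtain M where M: "0 < M" "M < 1" "2 * complete_E M - complete_K M \<le> 0" by (rule complete_gap_nonpos_near_1)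
  have 0: "2 * complete_E 0 - complete_K 0 = pi / 2" by (simp add: complete_gap_integral EK_gap_def[abs_def])
  hence 0: "2 * complete_E 0 - complete_K 0 > 0" using pi_gt_zero by linarith
  have "\<exists>m\<ge>0. m \<le> M \<and> 2 * complete_E m - complete_K m = 0"
    by (rule IVT2') (use M 0 complete_gap_continuous[of M] in auto)
  then obtain m where m: "0 \<le> m" "m \<le> M" "2 * complete_E m - complete_K m = 0" by blast
  have "m \<noteq> 0" using m 0 by auto
  hence "0 < m \<and> m < 1 \<and> 2 * complete_E m - complete_K m = 0" using m M by auto
  moreover have "m' = m''" if "0 < m' \<and> m' < 1 \<and> 2 * complete_E m' - complete_K m' = 0"
    "0 < m'' \<and> m'' < 1 \<and> 2 * complete_E m'' - complete_K m'' = 0" for m' m''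
    using complete_gap_strict[of m' m''] complete_gap_strict[of m'' m'] that by (cases m' m'' rule: linorder_cases) auto
  ultimately show ?thesis by blast
qed

lemma m_star: "0 < m_star" "m_star < 1" "2 * complete_E m_star = complete_K m_star"
  using theI'[OF m_star_ex1] by (auto simp: m_star_def)

lemma complete_K_pos: "0 \<le> m \<Longrightarrow> m < 1 \<Longrightarrow> complete_K m > 0"
proof -
  assume m: "0 \<le> m" "m < 1"
  have "ellF 0 m < ellF (pi / 2) m"
    by (rule DERIV_pos_imp_increasing)
       (use ellF_has_derivative[OF m] ell_delta_pos[OF m] in \<open>auto intro!: exI[of _ "1 / ell_delta m _"] simp del: real_sqrt_gt_0_iff\<close>)
  thus ?thesis by (simp add: complete_K_def)
qed

section \<open>The area under the momentum curve\<close>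

text \<open>The graph of the convex function \<open>x \<mapsto> x / sqrt (1 - x \<sigma>)\<close> lies above its tangent at \<open>y\<close>. In terms
  of the square roots \<open>A\<close> at \<open>x\<close> and \<open>B\<close> at \<open>y\<close>, the difference is a multiple of \<open>(B - A)\<^sup>2\<close> with a
  nonnegative factor.\<close>
lemma div_sqrt_above_tangent:
  fixes x y \<sigma> :: real
  assumes \<sigma>: "0 \<le> \<sigma>" and x: "x * \<sigma> < 1" and y: "y * \<sigma> < 1"
  shows "y / sqrt (1 - y * \<sigma>) + (x - y) * (1 - y * \<sigma> / 2) / sqrt (1 - y * \<sigma>) ^ 3 \<le> x / sqrt (1 - x * \<sigma>)"
proof (cases "\<sigma> = 0")
  case False
  define A B where "A = sqrt (1 - x * \<sigma>)" and "B = sqrt (1 - y * \<sigma>)"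
  have AB: "A > 0" "B > 0" using x y by (auto simp: A_def B_def)
  have "A\<^sup>2 = 1 - x * \<sigma>" "B\<^sup>2 = 1 - y * \<sigma>" using x y by (auto simp: A_def B_def)
  hence xy: "x * \<sigma> = 1 - A\<^sup>2" "y * \<sigma> = 1 - B\<^sup>2" by auto
  define d where "d = x / A - (y / B + (x - y) * (1 - y * \<sigma> / 2) / B ^ 3)"
  have "d * (2 * A * B ^ 3) = 2 * B ^ 3 * x - 2 * A * B\<^sup>2 * y - A * (x - y) * (2 - y * \<sigma>)"
    using AB by (simp add: d_def field_simps power2_eq_square power3_eq_cube)
  hence "\<sigma> * (d * (2 * A * B ^ 3)) = \<sigma> * (2 * B ^ 3 * x - 2 * A * B\<^sup>2 * y - A * (x - y) * (2 - y * \<sigma>))"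
    by (simp only:)
  also have "\<dots> = 2 * B ^ 3 * (x * \<sigma>) - 2 * A * B\<^sup>2 * (y * \<sigma>) - A * (x * \<sigma> - y * \<sigma>) * (2 - y * \<sigma>)"
    by (simp add: algebra_simps)
  also have "\<dots> = (B - A)\<^sup>2 * (2 * B + A + A * B\<^sup>2)"
    unfolding xy by (simp add: algebra_simps power2_eq_square power3_eq_cube)
  also have "\<dots> \<ge> 0" using AB by (intro mult_nonneg_nonneg add_nonneg_nonneg) auto
  finally have "0 \<le> d * (\<sigma> * (2 * A * B ^ 3))" by (simp add: mult_ac)
  moreover have "\<sigma> * (2 * A * B ^ 3) > 0" using AB \<sigma> False by simp
  ultimately have "d \<ge> 0" by (meson mult_neg_pos not_le)
  thus ?thesis by (simp add: A_def B_def d_def)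
qed simp

text \<open>The angle \<open>t\<close> of an arclength parametrised elastica in standard form satisfies
  \<open>t'\<^sup>2 = 4 m - 2 + 2 cos t\<close>, so this is its speed \<open>\<bar>t'\<bar>\<close>, continued by zero to the angles
  that are not reached.\<close>
abbreviation loop_momentum :: "real \<Rightarrow> real \<Rightarrow> real" where
  "loop_momentum m t \<equiv> 2 * sqrt (max 0 (m - (sin (t / 2))\<^sup>2))"

text \<open>The angles with \<open>\<bar>t\<bar> \<le> 2 arcsin (sqrt m)\<close> are those that the elastica reaches. Substituting
  \<open>sin (t / 2) = sqrt m * sin u\<close> turns the integral into that of
  \<open>4 m cos\<^sup>2 u / sqrt (1 - m sin\<^sup>2 u)\<close> over \<open>[- \<pi> / 2, \<pi> / 2]\<close>. This integrand is convex in \<open>m\<close>, and the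
  right-hand side is the integral of its tangent at \<open>m\<^sup>*\<close>. In \<open>u\<close> the domain of integration does not
  depend on \<open>m\<close>, so convexity can be used pointwise.\<close>
lemma loop_momentum_integral_ge:
  fixes m :: real
  assumes m: "0 \<le> m" "m \<le> 1" and \<Phi>: "\<And>t. (\<Phi> has_real_derivative loop_momentum m t) (at t)"
  shows "\<Phi> (2 * arcsin (sqrt m)) - \<Phi> (- 2 * arcsin (sqrt m)) \<ge> 4 * complete_K m_star * (m + m_star - 1)"
proof -
  define k where "k = m_star"
  have k: "0 < k" "k < 1" "2 * complete_E k = complete_K k" "0 \<le> k" using m_star by (auto simp: k_def)
  define \<Delta> where "\<Delta> u = ell_delta k u" for u
  have \<Delta>: "\<Delta> u > 0" "\<Delta> u \<noteq> 0" for u using ell_delta_pos[OF k(4,2), of u] by (auto simp: \<Delta>_def simp del: real_sqrt_gt_0_iff)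
  have \<Delta>2: "(\<Delta> u)\<^sup>2 = 1 - k * (sin u)\<^sup>2" for u using ell_delta_arg_pos[OF k(4,2), of u] by (simp add: \<Delta>_def)
  \<comment> \<open>\<open>H\<close> is the substituted integral, \<open>h\<close> the tangent of its integrand at \<open>k\<close>, and \<open>P\<close> a primitive of \<open>h\<close>,
    found from \<open>k cos\<^sup>2 u = \<Delta>\<^sup>2 - (1 - k)\<close> and from the derivative of \<open>sin u cos u / \<Delta>\<close>.\<close>
  define a where "a u = sqrt m * sin u" for u
  define H where "H u = \<Phi> (2 * arcsin (a u))" for u
  define P where "P u = 4 * (ellE u k - (1 - k) * ellF u k) + 2 * (m - k) * (ellF u k + sin u * cos u / \<Delta> u)" for u
  define h where "h u = 4 * (cos u)\<^sup>2 * (k / \<Delta> u + (m - k) * (1 - k * (sin u)\<^sup>2 / 2) / \<Delta> u ^ 3)" for u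
  have sm: "sqrt m \<le> 1" "0 \<le> sqrt m" using m by auto
  have abs_a: "\<bar>a u\<bar> \<le> 1" for u
    using mult_mono[of "\<bar>sqrt m\<bar>" 1 "\<bar>sin u\<bar>" 1] sm by (simp add: a_def abs_mult)
  have a2: "(a u)\<^sup>2 = m * (sin u)\<^sup>2" for u using m by (simp add: a_def power_mult_distrib)
  have D\<Delta>: "(\<Delta> has_real_derivative - k * sin u * cos u / \<Delta> u) (at u)" for u
    unfolding \<Delta>_def using ell_delta_arg_pos[OF k(4,2), of u]
    by (auto intro!: derivative_eq_intros simp: field_simps)
  have DP: "(P has_real_derivative h u) (at u)" for u
  proof -
    have d: "(P has_real_derivative 4 * (\<Delta> u - (1 - k) * (1 / \<Delta> u)) + 2 * (m - k) * 
       (1 / \<Delta> u + ((cos u * cos u + - sin u * sin u) * \<Delta> u - sin u * cos u * (- k * sin u * cos u / \<Delta> u)) / (\<Delta> u * \<Delta> u))) (at u)"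
      unfolding P_def
      by (rule derivative_eq_intros ellF_has_derivative[OF k(4,2), folded \<Delta>_def] ellE_has_derivative[OF k(4,2), folded \<Delta>_def] D\<Delta> refl \<Delta>)+
         (simp add: algebra_simps)
    have e1: "4 * (\<Delta> u - (1 - k) * (1 / \<Delta> u)) = 4 * (cos u)\<^sup>2 * (k / \<Delta> u)"
    proof -
      have "\<Delta> u - (1 - k) * (1 / \<Delta> u) = ((\<Delta> u)\<^sup>2 - (1 - k)) / \<Delta> u" using \<Delta>(2)[of u] by (simp add: field_simps power2_eq_square)
      also have "(\<Delta> u)\<^sup>2 - (1 - k) = k * (cos u)\<^sup>2" by (simp add: \<Delta>2 cos_squared_eq algebra_simps)
      finally show ?thesis by simp
    qed
    have e2: "1 / \<Delta> u + ((cos u * cos u + - sin u * sin u) * \<Delta> u - sin u * cos u * (- k * sin u * cos u / \<Delta> u)) / (\<Delta> u * \<Delta> u)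
       = 2 * ((cos u)\<^sup>2 * ((1 - k * (sin u)\<^sup>2 / 2) / \<Delta> u ^ 3))"
    proof -
      have "1 / \<Delta> u + ((cos u * cos u + - sin u * sin u) * \<Delta> u - sin u * cos u * (- k * sin u * cos u / \<Delta> u)) / (\<Delta> u * \<Delta> u)
         = ((\<Delta> u)\<^sup>2 + ((cos u)\<^sup>2 - (sin u)\<^sup>2) * (\<Delta> u)\<^sup>2 + k * (sin u)\<^sup>2 * (cos u)\<^sup>2) / \<Delta> u ^ 3"
        using \<Delta>(2)[of u] by (simp add: field_simps power2_eq_square power3_eq_cube)
      also have "(\<Delta> u)\<^sup>2 + ((cos u)\<^sup>2 - (sin u)\<^sup>2) * (\<Delta> u)\<^sup>2 + k * (sin u)\<^sup>2 * (cos u)\<^sup>2 = 2 * ((cos u)\<^sup>2 * (1 - k * (sin u)\<^sup>2 / 2))"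
        by (simp add: \<Delta>2 sin_squared_eq algebra_simps) (simp add: field_simps)
      finally show ?thesis by simp
    qed
    have e3: "4 * c * p + 2 * q * (2 * (c * (r / D))) = 4 * c * (p + q * r / D)" for c p q r D :: real
      by (simp add: algebra_simps)
    show ?thesis using d unfolding e1 e2 e3 h_def .
  qed
  have cH: "continuous_on {- (pi / 2)..pi / 2} H"
  proof -
    have "continuous_on UNIV \<Phi>" using \<Phi> by (meson DERIV_isCont continuous_at_imp_continuous_on)
    moreover have "continuous_on {- (pi / 2)..pi / 2} (\<lambda>u. 2 * arcsin (a u))"
      using abs_a unfolding a_def by (intro continuous_intros continuous_on_arcsin') (auto simp: abs_le_iff minus_le_iff)
    ultimately show ?thesis unfolding H_def by (rule continuous_on_compose2) auto
  qed
  have DH: "(H has_real_derivative 4 * m * (cos u)\<^sup>2 / sqrt (1 - m * (sin u)\<^sup>2)) (at u)" 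
    and ms: "m * (sin u)\<^sup>2 < 1" and cpos: "cos u > 0" if u: "- (pi / 2) < u" "u < pi / 2" for u
  proof -
    show cpos: "cos u > 0" using u by (intro cos_gt_zero_pi) auto
    have "(sin u)\<^sup>2 < 1" using cpos by (simp add: sin_squared_eq)
    thus ms: "m * (sin u)\<^sup>2 < 1" using m mult_left_le_one_le[of "(sin u)\<^sup>2" m] by simp
    hence "\<bar>a u\<bar> < 1" unfolding a2[symmetric] by (simp add: abs_square_less_1)
    hence a1: "-1 < a u" "a u < 1" by auto
    have Da: "(a has_real_derivative sqrt m * cos u) (at u)" unfolding a_def by (auto intro!: derivative_eq_intros)
    have "((\<lambda>u. 2 * arcsin (a u)) has_real_derivative 2 * (inverse (sqrt (1 - (a u)\<^sup>2)) * (sqrt m * cos u))) (at u)"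
      by (intro DERIV_cmult DERIV_chain2[OF DERIV_arcsin Da] a1)
    from DERIV_chain2[OF \<Phi> this]
    have "(H has_real_derivative loop_momentum m (2 * arcsin (a u)) * (2 * (inverse (sqrt (1 - (a u)\<^sup>2)) * (sqrt m * cos u)))) (at u)"
      by (simp add: H_def[abs_def])
    moreover have "loop_momentum m (2 * arcsin (a u)) = 2 * (sqrt m * cos u)"
    proof -
      have "m - (sin (2 * arcsin (a u) / 2))\<^sup>2 = m * (cos u)\<^sup>2"
        using a1 by (simp add: a2 cos_squared_eq algebra_simps)
      moreover have "\<dots> = (sqrt m * cos u)\<^sup>2" using m by (simp add: power_mult_distrib)
      ultimately show ?thesis using m cpos by (simp add: real_sqrt_mult)
    qed
    moreover have "2 * (sqrt m * cos u) * (2 * (inverse (sqrt (1 - (a u)\<^sup>2)) * (sqrt m * cos u))) = 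
        4 * m * (cos u)\<^sup>2 / sqrt (1 - m * (sin u)\<^sup>2)"
    proof -
      have "2 * (sqrt m * cos u) * (2 * (inverse (sqrt (1 - (a u)\<^sup>2)) * (sqrt m * cos u)))
          = 4 * (sqrt m * sqrt m) * (cos u)\<^sup>2 * inverse (sqrt (1 - (a u)\<^sup>2))"
        by (simp add: power2_eq_square[of "cos u"] mult_ac)
      thus ?thesis using m by (simp add: a2 divide_inverse)
    qed
    ultimately show "(H has_real_derivative 4 * m * (cos u)\<^sup>2 / sqrt (1 - m * (sin u)\<^sup>2)) (at u)" by (simp only:)
  qed
  have "H (- (pi / 2)) - P (- (pi / 2)) \<le> H (pi / 2) - P (pi / 2)"
  proof (rule DERIV_nonneg_imp_increasing_open[where f = "\<lambda>u. H u - P u"])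
    show "continuous_on {- (pi / 2)..pi / 2} (\<lambda>u. H u - P u)"
      using DP by (intro continuous_on_diff cH) (meson DERIV_isCont continuous_at_imp_continuous_on)
    fix u :: real assume u: "- (pi / 2) < u" "u < pi / 2"
    have "h u \<le> 4 * (cos u)\<^sup>2 * (m / sqrt (1 - m * (sin u)\<^sup>2))"
      using div_sqrt_above_tangent[of "(sin u)\<^sup>2" m k] ms[OF u] ell_delta_arg_pos[OF k(4,2), of u]
      unfolding h_def \<Delta>_def by (intro mult_left_mono) auto
    thus "\<exists>y. ((\<lambda>u. H u - P u) has_real_derivative y) (at u) \<and> 0 \<le> y"
      using DERIV_diff[OF DH[OF u] DP[of u]] by (intro exI conjI) (auto simp: mult_ac)
  qed auto
  moreover have "P (pi / 2) - P (- (pi / 2)) = 4 * complete_K k * (m + k - 1)"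
  proof -
    have "P (pi / 2) = 4 * (complete_E k - (1 - k) * complete_K k) + 2 * (m - k) * complete_K k"
      by (simp add: P_def complete_E_def complete_K_def)
    moreover have "P (- (pi / 2)) = - P (pi / 2)"
      unfolding P_def ellF_minus[OF k(4,2)] ellE_minus[OF k(4,2)] by (simp add: algebra_simps)
    ultimately show ?thesis using k(3) by (simp add: algebra_simps)
  qed
  moreover have "H (pi / 2) = \<Phi> (2 * arcsin (sqrt m))" "H (- (pi / 2)) = \<Phi> (- 2 * arcsin (sqrt m))"
  proof -
    have "-1 \<le> sqrt m" using sm by linarith
    hence "arcsin (- sqrt m) = - arcsin (sqrt m)" using sm by (intro arcsin_minus)
    thus "H (pi / 2) = \<Phi> (2 * arcsin (sqrt m))" "H (- (pi / 2)) = \<Phi> (- 2 * arcsin (sqrt m))"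
      by (simp_all add: H_def a_def)
  qed
  ultimately show ?thesis by (simp add: k_def)
qed

section \<open>The figure eight\<close>

text \<open>The integrand of \<^const>\<open>ellF\<close> is at least \<open>1\<close>. Hence \<^const>\<open>ellF\<close> grows at least as fast as the identity,
  which makes it bijective with a Lipschitz inverse.\<close>
lemma jacobi_am_inverts_ellF:
  assumes m: "0 \<le> m" "m < 1"
  shows "ellF (jacobi_am s m) m = s" and "jacobi_am (ellF x m) m = x"
    and "((\<lambda>s. jacobi_am s m) has_real_derivative ell_delta m (jacobi_am s m)) (at s)"
proof -
  let ?F = "\<lambda>x. ellF x m"
  note D = ellF_has_derivative[OF m] 
  have d1: "1 / ell_delta m t \<ge> 1" for t
    using ell_delta_pos[OF m, of t] ell_delta_le_1[OF m(1), of t] by (simp add: divide_simps)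
  have grow: "y - x \<le> ?F y - ?F x" if "x \<le> y" for x y
  proof -
    have "?F x - x \<le> ?F y - y"
    proof (rule DERIV_nonneg_imp_nondecreasing[OF that])
      fix t
      show "\<exists>z. ((\<lambda>x. ?F x - x) has_real_derivative z) (at t) \<and> 0 \<le> z"
        using DERIV_diff[OF D[of t] DERIV_ident] d1[of t] by (intro exI[of _ "1 / ell_delta m t - 1"] conjI) auto
    qed
    thus ?thesis by simp
  qed
  have inj: "inj ?F"
  proof (rule injI)
    fix x y assume "?F x = ?F y"
    thus "x = y" using grow[of x y] grow[of y x] by linarith
  qed
  have cont: "continuous_on A ?F" for A using D by (meson DERIV_isCont continuous_at_imp_continuous_on)
  have surj: "surj ?F"
    unfolding surj_def
  proof
    fix s
    have "\<exists>x\<ge>- \<bar>s\<bar>. x \<le> \<bar>s\<bar> \<and> ?F x = s"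
    proof (rule IVT')
      show "?F (- \<bar>s\<bar>) \<le> s" using grow[of "- \<bar>s\<bar>" 0] by simp
      show "s \<le> ?F \<bar>s\<bar>" using grow[of 0 "\<bar>s\<bar>"] by simp
    qed (use cont in auto)
    thus "\<exists>x. s = ?F x" by blast
  qed
  show F: "ellF (jacobi_am s m) m = s" for s unfolding jacobi_am_def by (rule surj_f_inv_f[OF surj])
  show "jacobi_am (ellF x m) m = x" unfolding jacobi_am_def by (rule inv_f_f[OF inj])
  have lip: "\<bar>jacobi_am s m - jacobi_am t m\<bar> \<le> \<bar>s - t\<bar>" for s t
    using grow[of "jacobi_am s m" "jacobi_am t m"] grow[of "jacobi_am t m" "jacobi_am s m"]
    unfolding F by (cases "jacobi_am s m \<le> jacobi_am t m") auto
  have "isCont (\<lambda>s. jacobi_am s m) s"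
    unfolding continuous_at_eps_delta dist_real_def using lip by (metis le_less_trans)
  from DERIV_inverse_function[OF D _ _ _ F this, of "s - 1" "s + 1"]
  have "((\<lambda>s. jacobi_am s m) has_real_derivative inverse (1 / ell_delta m (jacobi_am s m))) (at s)"
    using ell_delta_pos[OF m, of "jacobi_am s m"] by simp
  thus "((\<lambda>s. jacobi_am s m) has_real_derivative ell_delta m (jacobi_am s m)) (at s)"
    by simp
qed

abbreviation vec2 :: "real \<Rightarrow> real \<Rightarrow> real^2" where "vec2 x y \<equiv> vector [x, y]"

lemma vec2_eq: "vec2 x y = x *\<^sub>R vec2 1 0 + y *\<^sub>R vec2 0 1"
  by (simp add: vec_eq_iff forall_2)

lemma vec2_has_vector_derivative:
  assumes "(f has_real_derivative f') (at x)" "(g has_real_derivative g') (at x)"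
  shows "((\<lambda>t. vec2 (f t) (g t)) has_vector_derivative vec2 f' g') (at x)"
proof -
  have "((\<lambda>t. f t *\<^sub>R vec2 1 0 + g t *\<^sub>R vec2 0 1) has_vector_derivative (f' *\<^sub>R vec2 1 0 + g' *\<^sub>R vec2 0 1)) (at x)"
    using assms by (auto intro!: derivative_eq_intros)
  thus ?thesis unfolding vec2_eq[symmetric] .
qed

lemma norm_vec2: "norm (vec2 x y) = sqrt (x\<^sup>2 + y\<^sup>2)"
  by (simp add: norm_vec_def L2_set_def sum_2)

text \<open>The figure eight has unit speed and curvature \<open>2 sqrt m\<^sup>* cn\<close>. The square of the curvature has the
  primitive \<open>4 (E(am s) - (1 - m\<^sup>*) s)\<close>, and \<open>am\<close> takes the period \<open>4 K\<close> to \<open>2 \<pi>\<close>. Eliminating \<open>E\<close> by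
  \<open>2 E(m\<^sup>*) = K\<close> gives energy \<open>8 K (2 m\<^sup>* - 1)\<close> and length \<open>4 K\<close>.\<close>
lemma c_star_eq: "c_star = 32 * (complete_K m_star)\<^sup>2 * (2 * m_star - 1)"
proof -
  define k where "k = m_star"
  define K where "K = complete_K k"
  have k: "0 < k" "k < 1" "2 * complete_E k = K" "0 \<le> k" using m_star by (auto simp: k_def K_def)
  have K: "K > 0" unfolding K_def by (rule complete_K_pos[OF k(4,2)])
  define am where "am s = jacobi_am s k" for s
  have F_am: "ellF (am s) k = s" for s unfolding am_def by (rule jacobi_am_inverts_ellF(1)[OF k(4,2)])
  define \<Delta> where "\<Delta> s = ell_delta k (am s)" for s
  have \<Delta>: "\<Delta> s > 0" "\<Delta> s \<noteq> 0" for s using ell_delta_pos[OF k(4,2), of "am s"] by (auto simp: \<Delta>_def simp del: real_sqrt_gt_0_iff)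
  have \<Delta>2: "(\<Delta> s)\<^sup>2 = 1 - k * (sin (am s))\<^sup>2" for s using ell_delta_arg_pos[OF k(4,2), of "am s"] by (simp add: \<Delta>_def)
  have Dam: "(am has_real_derivative \<Delta> s) (at s)" for s
    using jacobi_am_inverts_ellF(3)[OF k(4,2), of s] by (simp add: am_def[abs_def] \<Delta>_def)
  have D\<Delta>: "(\<Delta> has_real_derivative - k * sin (am s) * cos (am s)) (at s)" for s
  proof -
    have "(\<Delta> has_real_derivative (0 - k * (2 * sin (am s) * (cos (am s) * \<Delta> s))) / (2 * \<Delta> s)) (at s)"
      unfolding \<Delta>_def[abs_def] using ell_delta_arg_pos[OF k(4,2), of "am s"]
      by (auto intro!: derivative_eq_intros Dam[unfolded \<Delta>_def] simp: field_simps)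
    thus ?thesis using \<Delta>(2)[of s] by (simp add: mult.assoc)
  qed
  have DE: "((\<lambda>s. ellE (am s) k) has_real_derivative (\<Delta> s)\<^sup>2) (at s)" for s
    using DERIV_chain2[OF ellE_has_derivative[OF k(4,2)] Dam, of s] by (simp add: \<Delta>_def power2_eq_square)
  define vel where "vel s = vec2 (1 - 2 * k * (sin (am s))\<^sup>2) (2 * sqrt k * sin (am s) * \<Delta> s)" for s
  define acc where "acc s = vec2 (- 4 * k * sin (am s) * cos (am s) * \<Delta> s) 
     (2 * sqrt k * cos (am s) * (1 - 2 * k * (sin (am s))\<^sup>2))" for s
  have fe: "figure_eight = (\<lambda>s. vec2 (2 * ellE (am s) k - s) (- 2 * sqrt k * cos (am s)))"
    by (simp add: figure_eight_def[abs_def] am_def k_def jacobi_cn_def)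
  have "(figure_eight has_vector_derivative vel s) (at s)" for s
    unfolding fe vel_def
    by (intro vec2_has_vector_derivative; (rule derivative_eq_intros DE Dam refl)+; simp add: \<Delta>2)
  hence vel: "velocity figure_eight s = vel s" for s by (rule vector_derivative_at)
  have Dvel: "(vel has_vector_derivative acc s) (at s)" for s
    unfolding vel_def[abs_def] acc_def
  proof (intro vec2_has_vector_derivative)
    show "((\<lambda>s. 1 - 2 * k * (sin (am s))\<^sup>2) has_real_derivative - 4 * k * sin (am s) * cos (am s) * \<Delta> s) (at s)"
      by (rule derivative_eq_intros Dam refl)+ simp
    have "((\<lambda>s. 2 * sqrt k * sin (am s) * \<Delta> s) has_real_derivative 
       2 * sqrt k * (cos (am s) * \<Delta> s) * \<Delta> s + 2 * sqrt k * sin (am s) * (- k * sin (am s) * cos (am s))) (at s)"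
      by (rule derivative_eq_intros Dam D\<Delta> refl)+ (simp add: algebra_simps)
    moreover have "2 * sqrt k * (cos (am s) * \<Delta> s) * \<Delta> s + 2 * sqrt k * sin (am s) * (- k * sin (am s) * cos (am s))
       = 2 * sqrt k * cos (am s) * ((\<Delta> s)\<^sup>2 - k * (sin (am s))\<^sup>2)" by (simp add: algebra_simps power2_eq_square)
    ultimately show "((\<lambda>s. 2 * sqrt k * sin (am s) * \<Delta> s) has_real_derivative 
       2 * sqrt k * cos (am s) * (1 - 2 * k * (sin (am s))\<^sup>2)) (at s)"
      by (simp add: \<Delta>2 mult.assoc)
  qed
  have c_am: "continuous_on A am" and c_\<Delta>: "continuous_on A \<Delta>" for A
    using Dam D\<Delta> by (meson DERIV_isCont continuous_at_imp_continuous_on)+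
  have c_acc: "continuous_on A acc" for A
    unfolding acc_def by (subst vec2_eq) (intro continuous_intros c_am c_\<Delta>)
  have prim: "primitive_on a b (velocity figure_eight) acc" for a b
    using Dvel by (intro primitive_on_C1 c_acc) (auto simp: vel intro: has_vector_derivative_at_within)
  have norm_vel: "norm (vel s) = 1" for s
  proof -
    have "(1 - 2 * k * (sin (am s))\<^sup>2)\<^sup>2 + (2 * sqrt k * sin (am s) * \<Delta> s)\<^sup>2 = 1"
      using k by (simp add: power_mult_distrib \<Delta>2) (simp add: power2_eq_square algebra_simps)
    thus ?thesis by (simp add: vel_def norm_vec2)
  qed
  let ?T = "4 * K"
  have curv: "det (vector [vel s, acc s] :: real^2^2) = 2 * sqrt k * cos (am s)" for s
  proof -
    have "det (vector [vel s, acc s] :: real^2^2) = 2 * sqrt k * cos (am s) * 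
        ((1 - 2 * k * (sin (am s))\<^sup>2)\<^sup>2 + 4 * k * (sin (am s))\<^sup>2 * (\<Delta> s)\<^sup>2)"
      by (simp add: det_2 vel_def acc_def) (simp add: power2_eq_square algebra_simps)
    also have "(1 - 2 * k * (sin (am s))\<^sup>2)\<^sup>2 + 4 * k * (sin (am s))\<^sup>2 * (\<Delta> s)\<^sup>2 = 1"
      by (simp add: \<Delta>2) (simp add: power2_eq_square algebra_simps)
    finally show ?thesis by simp
  qed
  have len: "curve_length 0 ?T figure_eight = ?T"
    using K by (simp add: curve_length_def vel norm_vel set_integral_const)
  have am0: "am 0 = 0" using jacobi_am_inverts_ellF(2)[OF k(4,2), of 0] by (simp add: am_def)
  have amT: "am ?T = 2 * pi"
    using jacobi_am_inverts_ellF(2)[OF k(4,2), of "2 * pi"] unfolding ellF_2pi[OF k(4,2)] by (simp add: am_def K_def)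
  have "elastic_energy 0 ?T figure_eight = (LINT s:{0<..<?T}|lborel. 4 * k * (cos (am s))\<^sup>2)"
    using k by (simp add: elastic_energy_eq[OF prim] vel norm_vel curv power_mult_distrib)
  also have "\<dots> = (LINT s:{0..?T}|lborel. 4 * k * (cos (am s))\<^sup>2)" by (rule set_integral_open_closed)
  also have "\<dots> = 4 * (ellE (am ?T) k - (1 - k) * ?T) - 4 * (ellE (am 0) k - (1 - k) * 0)"
  proof -
    have "primitive_on 0 ?T (\<lambda>s. 4 * (ellE (am s) k - (1 - k) * s)) (\<lambda>s. 4 * k * (cos (am s))\<^sup>2)"
    proof (rule primitive_on_C1)
      fix s
      have "((\<lambda>s. 4 * (ellE (am s) k - (1 - k) * s)) has_real_derivative 4 * ((\<Delta> s)\<^sup>2 - (1 - k))) (at s)"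
        by (rule derivative_eq_intros DE refl)+ simp
      also have "4 * ((\<Delta> s)\<^sup>2 - (1 - k)) = 4 * k * (cos (am s))\<^sup>2"
        by (simp add: \<Delta>2 cos_squared_eq algebra_simps)
      finally show "((\<lambda>s. 4 * (ellE (am s) k - (1 - k) * s)) has_vector_derivative 4 * k * (cos (am s))\<^sup>2) (at s within {0..?T})"
        by (simp add: has_real_derivative_iff_has_vector_derivative has_vector_derivative_at_within)
    qed (intro continuous_intros c_am)
    from primitive_onD(1)[OF this, of 0 ?T] show ?thesis using K by simp
  qed
  also have "\<dots> = 8 * K * (2 * k - 1)"
    using k(3) unfolding amT am0 ellE_2pi[OF k(4,2)] by (simp add: algebra_simps)
  finally show ?thesis
    unfolding c_star_def k_def[symmetric] K_def[symmetric] len by (simp add: power2_eq_square)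
qed

section \<open>The energy of a loop\<close>

lemma set_integral_lincomb3:
  fixes f g h :: "real \<Rightarrow> real"
  assumes "set_integrable M A f" "set_integrable M A g" "set_integrable M A h"
  shows "set_integrable M A (\<lambda>t. x * f t + y * g t + z * h t)"
    and "(LINT t:A|M. x * f t + y * g t + z * h t) = x * (LINT t:A|M. f t) + y * (LINT t:A|M. g t) + z * (LINT t:A|M. h t)"
  using assms by (simp_all add: set_integral_add)

text \<open>The calibration argument described at the beginning. The curve with velocity \<open>z\<close> returns to its
  starting point, where it may have a corner.\<close>
lemma loop_energy_ge:
  fixes z w :: "real \<Rightarrow> complex"
  assumes ab: "a < b" and z: "primitive_on a b z w" and nz: "\<And>t. t \<in> {a..b} \<Longrightarrow> z t \<noteq> 0"
    and closed: "(LINT t:{a..b}|lborel. z t) = 0"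
    and energy: "set_integrable lborel {a..b} (\<lambda>t. (Im (w t / z t))\<^sup>2 / norm (z t))"
  shows "8 * (complete_K m_star)\<^sup>2 * (2 * m_star - 1)
     \<le> (LINT t:{a..b}|lborel. (Im (w t / z t))\<^sup>2 / norm (z t)) * (LINT t:{a..b}|lborel. norm (z t))"
proof -
  define K where "K = complete_K m_star"
  have K: "K > 0" unfolding K_def using m_star by (intro complete_K_pos) auto
  obtain lg where lg: "\<And>t. t \<in> {a..b} \<Longrightarrow> z t = exp (lg t)" and plg: "primitive_on a b lg (\<lambda>t. inverse (z t) * w t)"
    using primitive_on_log[OF z nz] ab by auto
  define \<omega> where "\<omega> t = Im (w t / z t)" for t
  have p\<theta>: "primitive_on a b (\<lambda>t. Im (lg t)) \<omega>"
    using primitive_on_linear[OF bounded_linear_Im plg] by (simp add: \<omega>_def[abs_def] divide_inverse mult.commute)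
  have c\<theta>: "continuous_on {a..b} (\<lambda>t. Im (lg t))" by (rule primitive_on_continuous[OF p\<theta>])
  obtain p where p: "p \<in> {a..b}" "\<And>t. t \<in> {a..b} \<Longrightarrow> Im (lg p) \<le> Im (lg t)"
    using continuous_attains_inf[OF compact_Icc _ c\<theta>] ab by auto
  obtain q where q: "q \<in> {a..b}" "\<And>t. t \<in> {a..b} \<Longrightarrow> Im (lg t) \<le> Im (lg q)"
    using continuous_attains_sup[OF compact_Icc _ c\<theta>] ab by auto
  \<comment> \<open>The range of the angle is \<open>[c - hb, c + hb]\<close>. Beyond \<open>\<pi>\<close> the half-width is truncated: then \<open>m = 1\<close>, and
    the momentum is defined for all angles.\<close>
  define c where "c = (Im (lg p) + Im (lg q)) / 2"
  define hb where "hb = (Im (lg q) - Im (lg p)) / 2"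
  define \<phi> where "\<phi> t = Im (lg t) - c" for t
  have hb: "hb \<ge> 0" using p(2)[OF q(1)] by (simp add: hb_def)
  have \<phi>: "\<bar>\<phi> t\<bar> \<le> hb" if "t \<in> {a..b}" for t
    using p(2)[OF that] q(2)[OF that] by (simp add: \<phi>_def c_def hb_def abs_le_iff field_simps)
  have \<phi>pq: "\<phi> p = - hb" "\<phi> q = hb" by (simp_all add: \<phi>_def c_def hb_def field_simps)
  have p\<phi>: "primitive_on a b \<phi> \<omega>" using p\<theta> by (simp add: primitive_on_def \<phi>_def)
  define \<beta> where "\<beta> = min hb pi"
  have \<beta>: "0 \<le> \<beta>" "\<beta> \<le> pi" "\<beta> \<le> hb" using hb by (auto simp: \<beta>_def)
  define m where "m = (sin (\<beta> / 2))\<^sup>2"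
  have sin\<beta>: "sin (\<beta> / 2) \<ge> 0" using \<beta> by (intro sin_ge_zero) auto
  have m: "0 \<le> m" "m \<le> 1" by (auto simp: m_def abs_square_le_1)
  have "sqrt m = sin (\<beta> / 2)" using sin\<beta> by (simp add: m_def)
  hence asin: "2 * arcsin (sqrt m) = \<beta>" using \<beta> arcsin_sin[of "\<beta> / 2"] by simp
  let ?G = "loop_momentum m"
  have cG: "continuous_on A ?G" for A by (intro continuous_intros continuous_on_max) auto
  define \<Phi> where "\<Phi> x = (LBINT t=0..x. ?G t)" for x :: real
  have D\<Phi>: "(\<Phi> has_real_derivative ?G x) (at x)" for x
    unfolding \<Phi>_def by (rule interval_integral_has_derivative[OF cG])
  have G0: "?G t \<ge> 0" for t by simp
  have \<Phi>mono: "\<Phi> x \<le> \<Phi> y" if "x \<le> y" for x y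
    by (rule DERIV_nonneg_imp_nondecreasing[OF that]) (use D\<Phi> G0 in blast)
  have area: "4 * K * (m + m_star - 1) \<le> \<Phi> hb - \<Phi> (- hb)"
    using loop_momentum_integral_ge[OF m D\<Phi>] \<Phi>mono[OF \<beta>(3)] \<Phi>mono[of "- hb" "- \<beta>"] \<beta>(3)
    unfolding asin mult_minus_left K_def by linarith
  define A where "A = (LINT t:{a..b}|lborel. \<bar>?G (\<phi> t) * \<omega> t\<bar>)"
  have p\<Phi>: "primitive_on a b (\<lambda>t. \<Phi> (\<phi> t)) (\<lambda>t. ?G (\<phi> t) * \<omega> t)"
    by (rule primitive_on_real_chain[OF p\<phi> D\<Phi> cG])
  have A: "4 * K * (m + m_star - 1) \<le> A"
    using abs_increment_le[OF p\<Phi> p(1) q(1)] area unfolding \<phi>pq A_def by linarith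
  have iA: "set_integrable lborel {a..b} (\<lambda>t. \<bar>?G (\<phi> t) * \<omega> t\<bar>)"
    using p\<Phi> by (intro set_integrable_abs) (simp add: primitive_on_def)
  have G2: "(?G (\<phi> t))\<^sup>2 = 4 * m - 2 + 2 * cos (\<phi> t)" if "t \<in> {a..b}" for t
  proof -
    have "(sin (\<phi> t / 2))\<^sup>2 \<le> m"
    proof (cases "hb \<le> pi")
      case True
      have "\<bar>sin (\<phi> t / 2)\<bar> = \<bar>sin (\<bar>\<phi> t\<bar> / 2)\<bar>" by (cases "\<phi> t \<ge> 0") auto
      also have "\<dots> = sin (\<bar>\<phi> t\<bar> / 2)" using \<phi>[OF that] True by (intro abs_of_nonneg sin_ge_zero) auto
      also have "\<dots> \<le> sin (\<beta> / 2)"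
        using \<phi>[OF that] True \<beta> by (intro sin_monotone_2pi_le) (auto simp: \<beta>_def)
      finally show ?thesis unfolding m_def by (metis abs_ge_zero power2_abs power_mono)
    next
      case False
      hence "m = 1" by (simp add: m_def \<beta>_def)
      thus ?thesis by (simp add: abs_square_le_1)
    qed
    hence "(?G (\<phi> t))\<^sup>2 = 4 * (m - (sin (\<phi> t / 2))\<^sup>2)" by (simp add: power_mult_distrib)
    thus ?thesis using cos_double_sin[of "\<phi> t / 2"] by simp
  qed
  have cz: "continuous_on {a..b} z" by (rule primitive_on_continuous[OF z])
  have iz: "set_integrable lborel {a..b} z" by (rule borel_integrable_atLeastAtMost'[OF cz])
  define L where "L = (LINT t:{a..b}|lborel. norm (z t))"
  have iL: "set_integrable lborel {a..b} (\<lambda>t. norm (z t))" by (rule set_integrable_norm'[OF iz])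
  have L: "L > 0"
  proof -
    have cn: "continuous_on {a..b} (\<lambda>t. norm (z t))" by (intro continuous_intros cz)
    have "L = integral {a..b} (\<lambda>t. norm (z t))" unfolding L_def by (rule set_borel_integral_eq_integral(2)[OF iL])
    moreover have "integral {a..b} (\<lambda>t. norm (z t)) \<noteq> 0"
    proof
      assume "integral {a..b} (\<lambda>t. norm (z t)) = 0"
      hence "\<forall>t\<in>{a..b}. norm (z t) = 0"
        using integral_cbox_eq_0_iff[of a b "\<lambda>t. norm (z t)"] cn ab by auto
      thus False using nz[of a] ab by auto
    qed
    moreover have "integral {a..b} (\<lambda>t. norm (z t)) \<ge> 0"
      by (intro integral_nonneg integrable_continuous_real cn) auto
    ultimately show ?thesis by linarith
  qed
  have cos_eq: "norm (z t) * cos (\<phi> t) = Re (z t * cis (- c))" if "t \<in> {a..b}" for t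
    using lg[OF that] by (simp add: \<phi>_def exp_eq_polar norm_mult cos_diff distrib_left)
  have iC: "set_integrable lborel {a..b} (\<lambda>t. Re (z t * cis (- c)))"
    by (intro borel_integrable_atLeastAtMost' continuous_intros cz)
  have C0: "(LINT t:{a..b}|lborel. Re (z t * cis (- c))) = 0"
  proof -
    have T: "bounded_linear (\<lambda>u. Re (u * cis (- c)))"
      by (rule bounded_linear_compose[OF bounded_linear_Re bounded_linear_mult_left])
    have "(LINT t:{a..b}|lborel. Re (z t * cis (- c))) = Re ((LINT t:{a..b}|lborel. z t) * cis (- c))"
      using integral_bounded_linear[OF T, of lborel "\<lambda>t. indicator {a..b} t *\<^sub>R z t"] iz
      by (simp add: set_integrable_def set_lebesgue_integral_def scaleR_diff_right mult.assoc right_diff_distrib)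
    thus ?thesis by (simp add: closed)
  qed
  \<comment> \<open>\<open>s\<close> rescales the loop to length \<open>2 K\<close>, that of one loop of the figure eight.\<close>
  define s where "s = 2 * K / L"
  have s: "s > 0" using K L by (simp add: s_def)
  define En where "En = (LINT t:{a..b}|lborel. (\<omega> t)\<^sup>2 / norm (z t))"
  note comb = set_integral_lincomb3[OF iA iL iC, of "2 * s" "- (s\<^sup>2 * (4 * m - 2))" "- (2 * s\<^sup>2)"]
  have "2 * s * A + - (s\<^sup>2 * (4 * m - 2)) * L + - (2 * s\<^sup>2) * (LINT t:{a..b}|lborel. Re (z t * cis (- c))) \<le> En"
    unfolding A_def L_def comb(2)[symmetric] En_def
  proof (rule set_integral_mono[OF comb(1)])
    show "set_integrable lborel {a..b} (\<lambda>t. (\<omega> t)\<^sup>2 / norm (z t))" using energy by (simp add: \<omega>_def)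
    fix t assume t: "t \<in> {a..b}"
    define \<rho> g where "\<rho> = norm (z t)" and "g = ?G (\<phi> t)"
    have \<rho>: "\<rho> > 0" using nz[OF t] by (simp add: \<rho>_def)
    have g: "g \<ge> 0" by (simp add: g_def)
    \<comment> \<open>Equality holds when the rescaled angle moves with the speed of the elastica.\<close>
    have "0 \<le> (\<bar>\<omega> t\<bar> - s * g * \<rho>)\<^sup>2 / \<rho>" using \<rho> by simp
    also have "\<dots> = (\<omega> t)\<^sup>2 / \<rho> - 2 * s * (g * \<bar>\<omega> t\<bar>) + s\<^sup>2 * g\<^sup>2 * \<rho>"
      using \<rho> by (simp add: power2_diff field_simps power2_eq_square)
    also have "g\<^sup>2 = 4 * m - 2 + 2 * cos (\<phi> t)" unfolding g_def by (rule G2[OF t])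
    finally show "2 * s * \<bar>?G (\<phi> t) * \<omega> t\<bar> + - (s\<^sup>2 * (4 * m - 2)) * norm (z t) + - (2 * s\<^sup>2) * Re (z t * cis (- c)) 
        \<le> (\<omega> t)\<^sup>2 / norm (z t)"
      using g unfolding cos_eq[OF t, symmetric] g_def[symmetric] \<rho>_def[symmetric] abs_mult
      by (simp add: algebra_simps)
  qed
  hence "(2 * s * A - s\<^sup>2 * (4 * m - 2) * L) * L \<le> En * L"
    using L unfolding C0 by (intro mult_right_mono) auto
  also have "(2 * s * A - s\<^sup>2 * (4 * m - 2) * L) * L = 4 * K * A - 4 * K\<^sup>2 * (4 * m - 2)"
    using L by (simp add: s_def field_simps power2_eq_square)
  finally have "4 * K * A - 4 * K\<^sup>2 * (4 * m - 2) \<le> En * L" .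
  moreover have "4 * K * (4 * K * (m + m_star - 1)) \<le> 4 * K * A" using A K by (intro mult_left_mono) auto
  moreover have "4 * K * (4 * K * (m + m_star - 1)) - 4 * K\<^sup>2 * (4 * m - 2) = 8 * K\<^sup>2 * (2 * m_star - 1)"
    by (simp add: algebra_simps power2_eq_square)
  ultimately show ?thesis unfolding En_def L_def K_def \<omega>_def by linarith
qed

section \<open>Splitting at a double point\<close>

lemma set_integral_shift:
  fixes f :: "real \<Rightarrow> 'a::euclidean_space"
  shows "set_integrable lborel {p..q} (\<lambda>t. f (t + 1)) \<longleftrightarrow> set_integrable lborel {p + 1..q + 1} f"
    and "(LINT t:{p..q}|lborel. f (t + 1)) = (LINT t:{p + 1..q + 1}|lborel. f t)"
proof -
  have e: "(\<lambda>t. indicat_real {p + 1..q + 1} (1 + 1 * t) *\<^sub>R f (1 + 1 * t)) = (\<lambda>t. indicat_real {p..q} t *\<^sub>R f (t + 1))"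
    by (auto simp: indicator_def add.commute)
  show "set_integrable lborel {p..q} (\<lambda>t. f (t + 1)) \<longleftrightarrow> set_integrable lborel {p + 1..q + 1} f"
    using lborel_integrable_real_affine_iff[of 1 "\<lambda>t. indicat_real {p + 1..q + 1} t *\<^sub>R f t" 1]
    unfolding e by (simp add: set_integrable_def)
  show "(LINT t:{p..q}|lborel. f (t + 1)) = (LINT t:{p + 1..q + 1}|lborel. f t)"
    using lborel_integral_real_affine[of 1 "\<lambda>t. indicat_real {p + 1..q + 1} t *\<^sub>R f t" 1]
    unfolding e by (simp add: set_lebesgue_integral_def)
qed

text \<open>One of the two loops crosses the point where the circle is cut open, so its integrals run beyond
  the period \<open>[0, 1]\<close>.\<close>
lemma periodic_set_integral:
  fixes f :: "real \<Rightarrow> real"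
  assumes meas: "\<And>c d. (\<lambda>t. indicator {c..d} t *\<^sub>R f t) \<in> borel_measurable lborel"
    and per: "AE t in lborel. f (t + 1) = f t"
    and int: "set_integrable lborel {0..1} f" and x: "0 \<le> x" "x \<le> 1"
  shows "set_integrable lborel {0..2} f" "(LINT t:{x..x + 1}|lborel. f t) = (LINT t:{0..1}|lborel. f t)"
proof -
  have meas': "(\<lambda>t. indicat_real {c..d} t *\<^sub>R f (t + 1)) \<in> borel_measurable lborel" for c d
  proof -
    have "(\<lambda>t. indicat_real {c + 1..d + 1} (t + 1) *\<^sub>R f (t + 1)) \<in> borel_measurable lborel"
      by (rule measurable_compose[of "\<lambda>t. t + 1" lborel lborel, OF _ meas]) simp
    moreover have "(\<lambda>t. indicat_real {c + 1..d + 1} (t + 1) *\<^sub>R f (t + 1)) = (\<lambda>t. indicat_real {c..d} t *\<^sub>R f (t + 1))"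
      by (auto simp: indicator_def)
    ultimately show ?thesis by simp
  qed
  have ae: "AE t in lborel. indicat_real {c..d} t *\<^sub>R f (t + 1) = indicat_real {c..d} t *\<^sub>R f t" for c d
    using per by eventually_elim simp
  have "set_integrable lborel {0..1} (\<lambda>t. f (t + 1))"
    using int integrable_cong_AE[OF meas' meas ae] by (simp add: set_integrable_def)
  hence "set_integrable lborel {1..2} f" using set_integral_shift(1)[of 0 1 f] by simp
  hence "set_integrable lborel ({0..1} \<union> {1..2}) f" by (intro set_integrable_Un int) auto
  moreover have "{0..1} \<union> {1..2} = {0..2::real}" by auto
  ultimately show i2: "set_integrable lborel {0..2} f" by simp
  have sub: "set_integrable lborel {c..d} f" if "0 \<le> c" "d \<le> 2" for c d
    by (rule set_integrable_subset[OF i2]) (use that in auto)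
  have "(LINT t:{x..x + 1}|lborel. f t) = (LINT t:{x..1}|lborel. f t) + (LINT t:{1..x + 1}|lborel. f t)"
    using x by (intro interval_integral_add sub) auto
  also have "(LINT t:{1..x + 1}|lborel. f t) = (LINT t:{0..x}|lborel. f (t + 1))"
    using set_integral_shift(2)[of 0 x f] by simp
  also have "\<dots> = (LINT t:{0..x}|lborel. f t)"
    unfolding set_lebesgue_integral_def by (rule integral_cong_AE[OF meas' meas ae])
  also have "(LINT t:{x..1}|lborel. f t) + (LINT t:{0..x}|lborel. f t) = (LINT t:{0..1}|lborel. f t)"
    using interval_integral_add[of 0 x 1 f] sub[of 0 1] x by simp
  finally show "(LINT t:{x..x + 1}|lborel. f t) = (LINT t:{0..1}|lborel. f t)" .
qed

text \<open>The mixed terms are bounded below by twice the geometric mean of \<open>E1 * L1\<close> and \<open>E2 * L2\<close>.\<close>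
lemma two_loops_product_ge:
  fixes E1 E2 L1 L2 C :: real
  assumes "E1 * L1 \<ge> C" "E2 * L2 \<ge> C" "E1 \<ge> 0" "E2 \<ge> 0" "L1 \<ge> 0" "L2 \<ge> 0" "C \<ge> 0"
  shows "(E1 + E2) * (L1 + L2) \<ge> 4 * C"
proof -
  have "C * C \<le> (E1 * L1) * (E2 * L2)" using assms by (intro mult_mono) auto
  also have "\<dots> = (E1 * L2) * (E2 * L1)" by simp
  also have "4 * \<dots> \<le> (E1 * L2 + E2 * L1)\<^sup>2"
    using zero_le_power2[of "E1 * L2 - E2 * L1"] by (simp add: power2_eq_square algebra_simps)
  finally have "(2 * C)\<^sup>2 \<le> (E1 * L2 + E2 * L1)\<^sup>2" by (simp add: power2_eq_square)
  hence "2 * C \<le> E1 * L2 + E2 * L1" by (rule power2_le_imp_le) (use assms in auto)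
  thus ?thesis using assms by (simp add: algebra_simps)
qed

text \<open>\<open>x \<mapsto> cis (2 \<pi> x)\<close> is a quotient map from the compact interval onto the circle, so \<open>\<gamma>\<close> descends to a
  continuous map, and a continuous injection of a compact space into a Hausdorff space is an
  embedding.\<close>
lemma circle_embedding_if_inj:
  fixes \<gamma> :: "real \<Rightarrow> real^2"
  assumes imm: "immersed \<gamma>" and cont: "continuous_on UNIV \<gamma>" and per: "\<And>x. \<gamma> (x + 1) = \<gamma> x"
    and inj: "inj_on \<gamma> {0..<1}"
  shows "circle_embedding \<gamma>"
proof -
  have pern: "\<gamma> (x + real n) = \<gamma> x" for x n
    by (induction n) (use per in \<open>auto simp: add.assoc[symmetric] add.commute[of 1]\<close>)
  have peri: "\<gamma> (x + of_int n) = \<gamma> x" for x n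
  proof (cases "n \<ge> 0")
    case True
    thus ?thesis using pern[of x "nat n"] by simp
  next
    case False
    thus ?thesis using pern[of "x + of_int n" "nat (- n)"] by simp
  qed
  have frac: "\<gamma> x = \<gamma> (frac x)" for x using peri[of "frac x" "\<lfloor>x\<rfloor>"] by (simp add: frac_def)
  define f where "f x = cis (2 * pi * x)" for x
  have f_eq: "\<exists>n::int. x = y + of_int n" if "f x = f y" for x y
  proof -
    have "exp (\<i> * complex_of_real (2 * pi * x)) = exp (\<i> * complex_of_real (2 * pi * y))"
      using that by (simp add: f_def cis_conv_exp)
    then obtain n :: int where "\<i> * complex_of_real (2 * pi * x) = \<i> * complex_of_real (2 * pi * y) + (of_int (2 * n) * pi) * \<i>"
      unfolding exp_eq by blast
    hence "Im (\<i> * complex_of_real (2 * pi * x)) = Im (\<i> * complex_of_real (2 * pi * y) + (of_int (2 * n) * pi) * \<i>)" by simp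
    hence "2 * pi * x = 2 * pi * y + 2 * of_int n * pi" by simp
    hence "2 * pi * x = 2 * pi * (y + of_int n)" by (simp add: algebra_simps)
    thus ?thesis by auto
  qed
  define g where "g u = \<gamma> (SOME x. f x = u)" for u
  have gf: "g (f x) = \<gamma> x" for x
  proof -
    have "f (SOME y. f y = f x) = f x" by (rule someI[of "\<lambda>y. f y = f x"]) simp
    from f_eq[OF this] show ?thesis using peri by (auto simp: g_def)
  qed
  let ?S = "top_of_set (sphere (0::complex) 1)" and ?I = "top_of_set {0..1::real}"
  have surj: "f ` {0..1} = sphere 0 1"
  proof
    show "f ` {0..1} \<subseteq> sphere 0 1" by (auto simp: f_def)
    show "sphere 0 1 \<subseteq> f ` {0..1}"
    proof
      fix u :: complex assume "u \<in> sphere 0 1"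
      hence "u = f (Arg2pi u / (2 * pi))" using Arg2pi_eq[of u] by (simp add: f_def cis_conv_exp)
      moreover have "Arg2pi u / (2 * pi) \<in> {0..1}" using Arg2pi_ge_0[of u] Arg2pi_lt_2pi[of u] by (simp add: less_imp_le)
      ultimately show "u \<in> f ` {0..1}" by blast
    qed
  qed
  have cf: "continuous_map ?I ?S f"
  proof -
    have "continuous_on {0..1} f" unfolding f_def by (intro continuous_intros)
    thus ?thesis using surj by (auto simp: continuous_map_in_subtopology)
  qed
  have compS: "compact_space ?S" by (intro compact_space_subtopology) (simp add: compact_sphere)
  have compI: "compact_space ?I" by (intro compact_space_subtopology) simp
  have hS: "Hausdorff_space ?S" by (intro Hausdorff_space_subtopology Hausdorff_space_euclidean)
  have quot: "quotient_map ?I ?S f"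
    by (rule continuous_imp_quotient_map[OF cf compI hS]) (use surj in simp)
  have "continuous_on {0..1} (g \<circ> f)"
    using cont by (auto simp: o_def gf intro: continuous_on_subset)
  hence cg: "continuous_map ?S euclidean g"
    by (intro continuous_compose_quotient_map[OF quot]) simp
  have "inj_on g (sphere 0 1)"
  proof (rule inj_onI)
    fix u v :: complex assume uv: "u \<in> sphere 0 1" "v \<in> sphere 0 1" "g u = g v"
    obtain x y where xy: "u = f x" "v = f y" using uv(1,2) unfolding surj[symmetric] by blast
    have "\<gamma> (frac x) = \<gamma> (frac y)" using uv(3) by (simp add: xy gf frac[symmetric])
    hence "frac x = frac y" by (rule inj_onD[OF inj]) (simp_all add: frac_lt_1)
    hence "x = y + of_int (\<lfloor>x\<rfloor> - \<lfloor>y\<rfloor>)" by (simp add: frac_def algebra_simps)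
    then obtain n :: int where "x = y + of_int n" by blast
    hence "f x = cis (2 * pi * y) * cis (2 * pi * of_int n)" by (simp only: f_def cis_mult distrib_left)
    also have "\<dots> = f y" using cis_multiple_2pi[of "of_int n"] by (simp add: f_def)
    finally show "u = v" by (simp add: xy)
  qed
  hence "embedding_map ?S euclidean g"
    by (intro injective_closed_imp_embedding_map cg continuous_imp_closed_map[OF cg compS Hausdorff_space_euclidean]) simp
  thus ?thesis unfolding circle_embedding_def using imm gf by (auto simp: f_def)
qed

text \<open>In complex notation the tangent angle is the imaginary part of a logarithm of the velocity.\<close>
definition complex_of_vec :: "real^2 \<Rightarrow> complex" where
  "complex_of_vec v = Complex (v $ 1) (v $ 2)"

lemma bounded_linear_complex_of_vec: "bounded_linear complex_of_vec"
proof -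
  have "linear complex_of_vec"
    by (rule linearI) (auto simp: complex_of_vec_def complex_eq_iff)
  thus ?thesis by (simp add: linear_conv_bounded_linear)
qed

lemma norm_complex_of_vec: "norm (complex_of_vec v) = norm v"
  by (simp add: complex_of_vec_def norm_vec_def L2_set_def sum_2 cmod_def)

text \<open>Both sides are \<open>\<theta>'\<^sup>2 / \<rho>\<close>, where \<open>\<theta>' = det (v, w) / \<rho>\<^sup>2\<close> is the angular velocity of \<open>v\<close> and \<open>\<rho>\<close> its norm.\<close>
lemma bending_density_eq:
  fixes v w :: "real^2"
  assumes "v \<noteq> 0"
  shows "(det (vector [v, w] :: real^2^2) / norm v ^ 3)\<^sup>2 * norm v
    = (Im (complex_of_vec w / complex_of_vec v))\<^sup>2 / norm (complex_of_vec v)"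
proof -
  have n: "norm v > 0" using assms by simp
  have "Im (complex_of_vec w / complex_of_vec v) = det (vector [v, w] :: real^2^2) / (norm v)\<^sup>2"
    unfolding norm_complex_of_vec[symmetric]
    by (simp add: Im_divide det_2 complex_of_vec_def cmod_power2 algebra_simps)
  thus ?thesis using n by (simp add: norm_complex_of_vec field_simps power2_eq_square power3_eq_cube)
qed

lemma self_intersection_energy_ge:
  fixes \<gamma> :: "real \<Rightarrow> real^2"
  assumes W: "\<gamma> \<in> W22_circle" and imm: "immersed \<gamma>"
    and x: "0 \<le> x0" "x0 < x1" "x1 < 1" and eq: "\<gamma> x0 = \<gamma> x1"
  shows "c_star \<le> elastic_energy 0 1 \<gamma> * curve_length 0 1 \<gamma>"
proof -
  obtain acc where D: "\<And>x. (\<gamma> has_vector_derivative velocity \<gamma> x) (at x)"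
    and prim: "\<And>a b. primitive_on a b (velocity \<gamma>) acc" and L2: "L2_on {0..1} acc"
    using W22_circle_velocity[OF W] by blast
  define V where "V = velocity \<gamma>"
  have per\<gamma>: "\<gamma> (x + 1) = \<gamma> x" for x using W by (simp add: W22_circle_def)
  have perV: "V (x + 1) = V x" for x
  proof -
    have s: "((\<lambda>t. t + 1) has_vector_derivative 1) (at x)" by (auto intro!: derivative_eq_intros)
    have "(\<gamma> \<circ> (\<lambda>t. t + 1) has_vector_derivative 1 *\<^sub>R velocity \<gamma> (x + 1)) (at x)"
      by (rule vector_diff_chain_at[OF s D])
    moreover have "\<gamma> \<circ> (\<lambda>t. t + 1) = \<gamma>" using per\<gamma> by (auto simp: o_def)
    ultimately show ?thesis using vector_derivative_unique_at[OF D] by (auto simp: V_def)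
  qed
  have primV: "primitive_on a b V acc" for a b using prim by (simp add: V_def)
  have iacc: "set_integrable lborel {a..b} acc" for a b using primV by (simp add: primitive_on_def)
  have cV: "continuous_on A V" for A
    using continuous_on_UNIV_Icc[OF primitive_on_continuous[OF primV]] continuous_on_subset by blast
  have V0: "V x \<noteq> 0" for x using imm by (auto simp: immersed_def V_def)
  \<comment> \<open>The acceleration and its shift have the same primitive.\<close>
  have per_acc: "AE t in lborel. acc (t + 1) = acc t"
  proof -
    have loc: "AE t in lborel. t \<in> {- real n..real n} \<longrightarrow> acc (t + 1) - acc t = 0" for n
    proof (rule AE_zero_if_interval_integrals_zero)
      have i1: "set_integrable lborel {p..q} (\<lambda>t. acc (t + 1))" for p q
        by (simp add: set_integral_shift(1) iacc)
      show "set_integrable lborel {- real n..real n} (\<lambda>t. acc (t + 1) - acc t)"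
        by (intro set_integral_diff i1 iacc)
      fix p q :: real assume pq: "p \<le> q"
      have "(LINT t:{p..q}|lborel. acc (t + 1)) = V (q + 1) - V (p + 1)"
        using primitive_onD(1)[OF primV[of "p + 1" "q + 1"], of "p + 1" "q + 1"] pq by (simp add: set_integral_shift(2))
      also have "\<dots> = (LINT t:{p..q}|lborel. acc t)"
        using primitive_onD(1)[OF primV[of p q], of p q] pq by (simp add: perV)
      finally show "(LINT t:{p..q}|lborel. acc (t + 1) - acc t) = 0"
        by (simp add: set_integral_diff(2) i1 iacc)
    qed
    have "AE t in lborel. \<forall>n. t \<in> {- real n..real n} \<longrightarrow> acc (t + 1) - acc t = 0"
      unfolding AE_all_countable using loc by blast
    thus ?thesis
    proof eventually_elim
      case (elim t)
      obtain n where "\<bar>t\<bar> \<le> real n" using real_arch_simple by blast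
      thus ?case using elim[rule_format, of n] by (auto simp: abs_le_iff)
    qed
  qed
  define z w where "z t = complex_of_vec (V t)" and "w t = complex_of_vec (acc t)" for t
  define e where "e t = (Im (w t / z t))\<^sup>2 / norm (z t)" for t
  have primz: "primitive_on a b z w" for a b
    unfolding z_def w_def by (rule primitive_on_linear[OF bounded_linear_complex_of_vec primV])
  have z0: "z t \<noteq> 0" for t using V0[of t] norm_complex_of_vec[of "V t"] by (auto simp: z_def)
  have cz: "continuous_on A z" for A
    unfolding z_def by (intro bounded_linear.continuous_on[OF bounded_linear_complex_of_vec] cV)
  have mz: "z \<in> borel_measurable lborel" using borel_measurable_continuous_onI[OF cz] by simp
  have meas_e: "(\<lambda>t. indicat_real {c..d} t *\<^sub>R e t) \<in> borel_measurable lborel" for c d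
  proof -
    have mw: "(\<lambda>t. indicat_real {c..d} t *\<^sub>R w t) \<in> borel_measurable lborel"
      using primz[of c d] by (auto simp: primitive_on_def set_integrable_def)
    have "(\<lambda>t. (Im ((indicat_real {c..d} t *\<^sub>R w t) / z t))\<^sup>2 / norm (z t)) \<in> borel_measurable lborel"
      by (intro borel_measurable_divide borel_measurable_power measurable_compose[OF _ borel_measurable_Im]
           measurable_compose[OF mz borel_measurable_norm] mw mz)
    moreover have "(\<lambda>t. (Im ((indicat_real {c..d} t *\<^sub>R w t) / z t))\<^sup>2 / norm (z t)) = (\<lambda>t. indicat_real {c..d} t *\<^sub>R e t)"
      by (auto simp: indicator_def e_def)
    ultimately show ?thesis by simp
  qed
  \<comment> \<open>The speed is bounded below by some \<open>\<mu> > 0\<close>, and the acceleration is square integrable.\<close>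
  have int_e: "set_integrable lborel {0..1} e"
  proof -
    have "continuous_on {0..1::real} (\<lambda>t. norm (z t))" by (intro continuous_intros cz)
    from continuous_attains_inf[OF compact_Icc _ this]
    obtain t0 where "\<forall>t\<in>{0..1}. norm (z t0) \<le> norm (z t)" by auto
    hence t0: "norm (z t0) \<le> norm (z t)" if "t \<in> {0..1}" for t using that by blast
    define \<mu> where "\<mu> = norm (z t0)"
    have \<mu>: "\<mu> > 0" using z0 by (simp add: \<mu>_def)
    have le: "e t \<le> (norm (acc t))\<^sup>2 / \<mu> ^ 3" if "t \<in> {0..1}" for t
    proof -
      have \<mu>z: "\<mu> \<le> norm (z t)" using t0[OF that] by (simp add: \<mu>_def)
      have "\<bar>Im (w t / z t)\<bar> \<le> norm (w t) / norm (z t)" using abs_Im_le_cmod[of "w t / z t"] by (simp add: norm_divide)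
      also have "\<dots> \<le> norm (w t) / \<mu>" using \<mu> \<mu>z by (intro frac_le) auto
      finally have "(Im (w t / z t))\<^sup>2 \<le> (norm (w t) / \<mu>)\<^sup>2" by (metis abs_ge_zero power2_abs power_mono)
      hence "e t \<le> (norm (w t) / \<mu>)\<^sup>2 / \<mu>"
        unfolding e_def using \<mu> \<mu>z by (intro frac_le) auto
      thus ?thesis by (simp add: w_def norm_complex_of_vec power_divide power2_eq_square power3_eq_cube)
    qed
    have i: "integrable lborel (\<lambda>t. indicat_real {0..1} t *\<^sub>R ((norm (acc t))\<^sup>2 / \<mu> ^ 3))"
      using L2 unfolding L2_on_def set_integrable_def[symmetric] by simp
    show ?thesis
      unfolding set_integrable_def
    proof (rule Bochner_Integration.integrable_bound[OF i meas_e], rule AE_I2)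
      fix t
      have "e t \<ge> 0" by (simp add: e_def)
      thus "norm (indicat_real {0..1} t *\<^sub>R e t) \<le> norm (indicat_real {0..1} t *\<^sub>R ((norm (acc t))\<^sup>2 / \<mu> ^ 3))"
        using le[of t] \<mu> by (auto simp: indicator_def)
    qed
  qed
  have perz: "z (t + 1) = z t" for t by (simp add: z_def perV)
  have per_e: "AE t in lborel. e (t + 1) = e t"
    using per_acc by eventually_elim (simp add: e_def perz w_def)
  let ?E = "\<lambda>a b. LINT t:{a..b}|lborel. e t" and ?L = "\<lambda>a b. LINT t:{a..b}|lborel. norm (z t)"
  have iL: "set_integrable lborel {a..b} (\<lambda>t. norm (z t))" for a b
    by (intro borel_integrable_atLeastAtMost' continuous_intros cz)
  have E1: "elastic_energy 0 1 \<gamma> = ?E 0 1"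
    unfolding elastic_energy_eq[OF prim] bending_density_eq[OF V0[unfolded V_def]] set_integral_open_closed
    by (simp add: e_def z_def w_def V_def)
  have L1: "curve_length 0 1 \<gamma> = ?L 0 1"
    by (simp add: curve_length_def set_integral_open_closed z_def norm_complex_of_vec V_def)
  have x0': "0 \<le> x0" "x0 \<le> 1" using x by auto
  note PE = periodic_set_integral[OF meas_e per_e int_e x0']
  have PL: "?L x0 (x0 + 1) = ?L 0 1"
    by (rule periodic_set_integral(2)[OF _ _ iL x0']) 
       (use iL in \<open>auto simp: perz set_integrable_def\<close>)
  have ie: "set_integrable lborel {a..b} e" if "0 \<le> a" "b \<le> 2" for a b
    by (rule set_integrable_subset[OF PE(1)]) (use that in auto)
  have E2: "?E x0 (x0 + 1) = ?E x0 x1 + ?E x1 (x0 + 1)" using x by (intro interval_integral_add ie) auto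
  have L2': "?L x0 (x0 + 1) = ?L x0 x1 + ?L x1 (x0 + 1)" using x by (intro interval_integral_add iL) auto
  have loop: "(LINT t:{a..b}|lborel. z t) = 0" if "a \<le> b" "\<gamma> a = \<gamma> b" for a b
  proof -
    have "primitive_on a b \<gamma> V"
      using D by (intro primitive_on_C1 cV) (auto simp: V_def intro: has_vector_derivative_at_within)
    from primitive_onD(1)[OF primitive_on_linear[OF bounded_linear_complex_of_vec this], of a b]
    show ?thesis using that by (simp add: z_def)
  qed
  define C where "C = 8 * (complete_K m_star)\<^sup>2 * (2 * m_star - 1)"
  have loop_ge: "C \<le> ?E a b * ?L a b" if "0 \<le> a" "a < b" "b \<le> 2" "\<gamma> a = \<gamma> b" for a b
    unfolding C_def e_def
    by (rule loop_energy_ge[OF that(2) primz z0 loop]) (use that ie[of a b] in \<open>auto simp: e_def[abs_def]\<close>)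
  have cs: "c_star = 4 * C" by (simp add: c_star_eq C_def)
  have nonneg: "?E a b \<ge> 0" "?L a b \<ge> 0" for a b
    unfolding set_lebesgue_integral_def by (intro Bochner_Integration.integral_nonneg; simp add: e_def)+
  show ?thesis
  proof (cases "C \<ge> 0")
    case True
    have "4 * C \<le> (?E x0 x1 + ?E x1 (x0 + 1)) * (?L x0 x1 + ?L x1 (x0 + 1))"
      using x eq per\<gamma>[of x0] True by (intro two_loops_product_ge loop_ge nonneg) auto
    thus ?thesis unfolding cs E1 L1 PE(2)[symmetric] PL[symmetric] E2 L2' .
  next
    case False
    have "0 \<le> ?E 0 1 * ?L 0 1" by (intro mult_nonneg_nonneg nonneg)
    thus ?thesis using False unfolding cs E1 L1 by linarith
  qed
qed

theorem theorem1p2: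
  fixes \<gamma> :: "real \<Rightarrow> real^2"
  assumes "\<gamma> \<in> W22_circle"
    and "immersed \<gamma>"
    and "elastic_energy 0 1 \<gamma> * curve_length 0 1 \<gamma> < c_star"
  shows "circle_embedding \<gamma>"
proof (rule circle_embedding_if_inj[OF assms(2)])
  show "continuous_on UNIV \<gamma>" "\<And>x. \<gamma> (x + 1) = \<gamma> x" using assms(1) by (auto simp: W22_circle_def)
  have no: False if "0 \<le> x0" "x0 < x1" "x1 < 1" "\<gamma> x0 = \<gamma> x1" for x0 x1
    using self_intersection_energy_ge[OF assms(1,2) that] assms(3) by linarith
  show "inj_on \<gamma> {0..<1}"
  proof (rule inj_onI)
    fix x y :: real assume "x \<in> {0..<1}" "y \<in> {0..<1}" "\<gamma> x = \<gamma> y"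
    thus "x = y" using no[of x y] no[of y x] by (cases x y rule: linorder_cases) auto
  qed
qed

end
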